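(* Let $(M,\varphi,\xi,\eta,g)$ be a $3$-dimensional non-Sasakian $(\kappa,\mu,\nu)$-contact metric manifold with $\nu$ constant and $\xi(I_M)=0$, where $I_M=\dfrac{1-\frac\mu2}{\sqrt{1-\kappa}}$. Let $(\tilde\varphi,\xi,\eta,\tilde g)$ be the canonical paracontact metric structure induced on $M$, $$\tilde\varphi:=\frac1{\sqrt{1-\kappa}}h,\qquad\tilde g:=\frac1{\sqrt{1-\kappa}}d\eta(\cdot,h\cdot)+\eta\otimes\eta.$$ Then the characteristic vector field $\xi$ is an eigenvector of the Ricci operator $\tilde Q$ of $(M,\tilde g)$.
   Context: A contact metric manifold $(M,\varphi,\xi,\eta,g)$ is a manifold with a $(1,1)$-tensor $\varphi$, vector field $\xi$, $1$-form $\eta$ and Riemannian metric $g$ with $\eta(\xi)=1$, $\varphi^2=-I+\eta\otimes\xi$, $g(\varphi X,\varphi Y)=g(X,Y)-\eta(X)\eta(Y)$, $d\eta(X,Y)=g(X,\varphi Y)$, where $2d\eta(X,Y)=X\eta(Y)-Y\eta(X)-\eta([X,Y])$. One sets $h=\frac12\mathcal L_\xi\varphi$; then $\nabla\xi=-\varphi-\varphi h$. It is a $(\kappa,\mu,\nu)$-contact metric manifold if there are smooth functions $\kappa,\mu,\nu$ with $$R(X,Y)\xi=\kappa(\eta(Y)X-\eta(X)Y)+\mu(\eta(Y)hX-\eta(X)hY)+\nu(\eta(Y)\varphi hX-\eta(X)\varphi hY),$$ where $R(X,Y)=[\nabla_X,\nabla_Y]-\nabla_{[X,Y]}$. Then $h^2=(\kappa-1)\varphi^2$,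 $\kappa\le1$; non-Sasakian means $\kappa<1$ everywhere. It is known that the canonical structure $(\tilde\varphi,\xi,\eta,\tilde g)$ above is a paracontact metric structure, i.e. $\eta(\xi)=1$, $\tilde\varphi^2=I-\eta\otimes\xi$, $\tilde g(\tilde\varphi X,\tilde\varphi Y)=-\tilde g(X,Y)+\eta(X)\eta(Y)$, $d\eta(X,Y)=\tilde g(X,\tilde\varphi Y)$, with $\tilde\varphi$ having $\pm1$-eigendistributions of equal dimension on $\ker\eta$. *)

theory Defs
  imports "HOL-Analysis.Analysis"
begin

section \<open>Smooth manifolds\<close>

fun Ck_on :: "nat \<Rightarrow> 'a set \<Rightarrow> ('a::real_normed_vector \<Rightarrow> 'b::real_normed_vector) \<Rightarrow> bool" where
  "Ck_on 0 S f \<longleftrightarrow> continuous_on S f"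
| "Ck_on (Suc k) S f \<longleftrightarrow>
     (\<forall>x\<in>S. f differentiable (at x)) \<and>
     (\<forall>v. Ck_on k S (\<lambda>x. frechet_derivative f (at x) v))"

definition smooth_map_on :: "'a set \<Rightarrow> ('a::real_normed_vector \<Rightarrow> 'b::real_normed_vector) \<Rightarrow> bool" where
  "smooth_map_on S f \<longleftrightarrow> (\<forall>k. Ck_on k S f)"

text \<open>A chart is its domain together with the coordinate map. The manifold is the whole
  type \<open>'m\<close>, its dimension is \<open>CARD('n)\<close>, and its smooth structure is the one generated by the
  atlas \<open>A\<close>, which need not be maximal.\<close>

type_synonym ('m, 'n) chart = "'m set \<times> ('m \<Rightarrow> real ^ 'n)"

definition smooth_manifold ::
  "('m::{t2_space, second_countable_topology}, 'n::finite) chart set \<Rightarrow> bool" where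
  "smooth_manifold A \<longleftrightarrow>
     (\<Union>(U, c)\<in>A. U) = UNIV \<and>
     (\<forall>(U, c)\<in>A. open U \<and> open (c ` U) \<and> homeomorphism U (c ` U) c (inv_into U c)) \<and>
     (\<forall>(U, c)\<in>A. \<forall>(V, d)\<in>A. smooth_map_on (c ` (U \<inter> V)) (d \<circ> inv_into U c))"

definition smooth_fun_on ::
  "('m::topological_space, 'n::finite) chart set \<Rightarrow> 'm set \<Rightarrow> ('m \<Rightarrow> real) \<Rightarrow> bool" where
  "smooth_fun_on A W f \<longleftrightarrow> (\<forall>(U, c)\<in>A. smooth_map_on (c ` (U \<inter> W)) (f \<circ> inv_into U c))"

definition smooth_fun_near ::
  "('m::topological_space, 'n::finite) chart set \<Rightarrow> 'm \<Rightarrow> ('m \<Rightarrow> real) \<Rightarrow> bool" where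
  "smooth_fun_near A p f \<longleftrightarrow> (\<exists>W. open W \<and> p \<in> W \<and> smooth_fun_on A W f)"

section \<open>Tangent vectors and vector fields\<close>

text \<open>A tangent vector at \<open>p\<close> is a directional derivative operator on the functions that are
  smooth near \<open>p\<close>. Operators are set to \<open>0\<close> on all other functions, so that two tangent
  vectors at \<open>p\<close> are equal as soon as they agree on the functions smooth near \<open>p\<close>.\<close>

type_synonym 'm tvec = "('m \<Rightarrow> real) \<Rightarrow> real"
type_synonym 'm vfield = "'m \<Rightarrow> 'm tvec"

definition tv_zero :: "'m tvec" where
  "tv_zero = (\<lambda>f. 0)"

definition tv_add :: "'m tvec \<Rightarrow> 'm tvec \<Rightarrow> 'm tvec" (infixl \<open>+\<^sub>t\<close> 65) where
  "u +\<^sub>t v = (\<lambda>f. u f + v f)"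

definition tv_diff :: "'m tvec \<Rightarrow> 'm tvec \<Rightarrow> 'm tvec" (infixl \<open>-\<^sub>t\<close> 65) where
  "u -\<^sub>t v = (\<lambda>f. u f - v f)"

definition tv_scale :: "real \<Rightarrow> 'm tvec \<Rightarrow> 'm tvec" (infixr \<open>*\<^sub>t\<close> 75) where
  "a *\<^sub>t u = (\<lambda>f. a * u f)"

definition chart_dir ::
  "('m::topological_space, 'n::finite) chart set \<Rightarrow> ('m, 'n) chart \<Rightarrow> 'm \<Rightarrow> real ^ 'n \<Rightarrow> 'm tvec" where
  "chart_dir A ch p v = (\<lambda>f.
     if smooth_fun_near A p f
     then frechet_derivative (f \<circ> inv_into (fst ch) (snd ch)) (at (snd ch p)) v
     else 0)"

definition tangent_space ::
  "('m::topological_space, 'n::finite) chart set \<Rightarrow> 'm \<Rightarrow> 'm tvec set" where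
  "tangent_space A p = {chart_dir A ch p v | ch v. ch \<in> A \<and> p \<in> fst ch}"

definition vector_field_on ::
  "('m::topological_space, 'n::finite) chart set \<Rightarrow> 'm set \<Rightarrow> 'm vfield \<Rightarrow> bool" where
  "vector_field_on A U X \<longleftrightarrow>
     (\<forall>p\<in>U. X p \<in> tangent_space A p) \<and>
     (\<forall>W f. open W \<and> W \<subseteq> U \<and> smooth_fun_on A W f \<longrightarrow> smooth_fun_on A W (\<lambda>p. X p f))"

definition lie_bracket ::
  "('m::topological_space, 'n::finite) chart set \<Rightarrow> 'm vfield \<Rightarrow> 'm vfield \<Rightarrow> 'm vfield" where
  "lie_bracket A X Y = (\<lambda>p f.
     if smooth_fun_near A p f then X p (\<lambda>q. Y q f) - Y p (\<lambda>q. X q f) else 0)"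

text \<open>Some smooth vector field near \<open>p\<close> with value \<open>v\<close> at \<open>p\<close>. It is used to turn
  expressions in vector fields that are tensorial into tensors on the tangent spaces; the
  values obtained do not depend on the choice of the extension.\<close>

definition local_ext ::
  "('m::topological_space, 'n::finite) chart set \<Rightarrow> 'm \<Rightarrow> 'm tvec \<Rightarrow> 'm vfield" where
  "local_ext A p v = (SOME X. \<exists>U. open U \<and> p \<in> U \<and> vector_field_on A U X \<and> X p = v)"

section \<open>Tensor fields\<close>

type_synonym 'm form1 = "'m \<Rightarrow> 'm tvec \<Rightarrow> real"
type_synonym 'm endo = "'m \<Rightarrow> 'm tvec \<Rightarrow> 'm tvec"
type_synonym 'm form2 = "'m \<Rightarrow> 'm tvec \<Rightarrow> 'm tvec \<Rightarrow> real"

definition one_form ::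
  "('m::topological_space, 'n::finite) chart set \<Rightarrow> 'm form1 \<Rightarrow> bool" where
  "one_form A \<eta> \<longleftrightarrow>
     (\<forall>p. \<forall>u\<in>tangent_space A p. \<forall>v\<in>tangent_space A p. \<forall>a b.
        \<eta> p (a *\<^sub>t u +\<^sub>t b *\<^sub>t v) = a * \<eta> p u + b * \<eta> p v) \<and>
     (\<forall>U X. open U \<and> vector_field_on A U X \<longrightarrow> smooth_fun_on A U (\<lambda>p. \<eta> p (X p)))"

definition endo_field ::
  "('m::topological_space, 'n::finite) chart set \<Rightarrow> 'm endo \<Rightarrow> bool" where
  "endo_field A \<phi> \<longleftrightarrow>
     (\<forall>p. \<forall>u\<in>tangent_space A p. \<phi> p u \<in> tangent_space A p) \<and>
     (\<forall>p. \<forall>u\<in>tangent_space A p. \<forall>v\<in>tangent_space A p. \<forall>a b.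
        \<phi> p (a *\<^sub>t u +\<^sub>t b *\<^sub>t v) = a *\<^sub>t \<phi> p u +\<^sub>t b *\<^sub>t \<phi> p v) \<and>
     (\<forall>U X. open U \<and> vector_field_on A U X \<longrightarrow> vector_field_on A U (\<lambda>p. \<phi> p (X p)))"

definition bilinear_field ::
  "('m::topological_space, 'n::finite) chart set \<Rightarrow> 'm form2 \<Rightarrow> bool" where
  "bilinear_field A g \<longleftrightarrow>
     (\<forall>p. \<forall>u\<in>tangent_space A p. \<forall>v\<in>tangent_space A p. \<forall>w\<in>tangent_space A p. \<forall>a b.
        g p (a *\<^sub>t u +\<^sub>t b *\<^sub>t v) w = a * g p u w + b * g p v w \<and>
        g p w (a *\<^sub>t u +\<^sub>t b *\<^sub>t v) = a * g p w u + b * g p w v) \<and>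
     (\<forall>U X Y. open U \<and> vector_field_on A U X \<and> vector_field_on A U Y \<longrightarrow>
        smooth_fun_on A U (\<lambda>p. g p (X p) (Y p)))"

definition riemannian_metric ::
  "('m::topological_space, 'n::finite) chart set \<Rightarrow> 'm form2 \<Rightarrow> bool" where
  "riemannian_metric A g \<longleftrightarrow> bilinear_field A g \<and>
     (\<forall>p. \<forall>u\<in>tangent_space A p. \<forall>v\<in>tangent_space A p. g p u v = g p v u) \<and>
     (\<forall>p. \<forall>u\<in>tangent_space A p. u \<noteq> tv_zero \<longrightarrow> g p u u > 0)"

text \<open>Exterior derivative in the normalisation
  \<open>2 d\<eta>(X, Y) = X \<eta>(Y) - Y \<eta>(X) - \<eta>([X, Y])\<close>.\<close>

definition ext_deriv ::
  "('m::topological_space, 'n::finite) chart set \<Rightarrow> 'm form1 \<Rightarrow> 'm form2" where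
  "ext_deriv A \<eta> p u v =
     (let X = local_ext A p u; Y = local_ext A p v in
        (X p (\<lambda>q. \<eta> q (Y q)) - Y p (\<lambda>q. \<eta> q (X q)) - \<eta> p (lie_bracket A X Y p)) / 2)"

text \<open>\<open>(L\<^sub>\<xi> \<phi>) X = [\<xi>, \<phi> X] - \<phi> [\<xi>, X]\<close>\<close>

definition lie_deriv_endo ::
  "('m::topological_space, 'n::finite) chart set \<Rightarrow> 'm vfield \<Rightarrow> 'm endo \<Rightarrow> 'm endo" where
  "lie_deriv_endo A \<xi> \<phi> p u =
     (let X = local_ext A p u in
        lie_bracket A \<xi> (\<lambda>q. \<phi> q (X q)) p -\<^sub>t \<phi> p (lie_bracket A \<xi> X p))"

section \<open>Levi-Civita connection and curvature\<close>

definition affine_connection ::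
  "('m::topological_space, 'n::finite) chart set \<Rightarrow> ('m vfield \<Rightarrow> 'm vfield \<Rightarrow> 'm vfield) \<Rightarrow> bool" where
  "affine_connection A D \<longleftrightarrow>
     (\<forall>U X Y. open U \<and> vector_field_on A U X \<and> vector_field_on A U Y \<longrightarrow>
        vector_field_on A U (D X Y)) \<and>
     (\<forall>U X Y X' Y'. open U \<and> vector_field_on A U X \<and> vector_field_on A U Y \<and>
        (\<forall>q\<in>U. X' q = X q) \<and> (\<forall>q\<in>U. Y' q = Y q) \<longrightarrow> (\<forall>p\<in>U. D X' Y' p = D X Y p)) \<and>
     (\<forall>U X Y Z a. open U \<and> vector_field_on A U X \<and> vector_field_on A U Y \<and>
        vector_field_on A U Z \<and> smooth_fun_on A U a \<longrightarrow>
        (\<forall>p\<in>U.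
           D (\<lambda>q. X q +\<^sub>t Y q) Z p = D X Z p +\<^sub>t D Y Z p \<and>
           D (\<lambda>q. a q *\<^sub>t X q) Z p = a p *\<^sub>t D X Z p \<and>
           D X (\<lambda>q. Y q +\<^sub>t Z q) p = D X Y p +\<^sub>t D X Z p \<and>
           D X (\<lambda>q. a q *\<^sub>t Y q) p = X p a *\<^sub>t Y p +\<^sub>t a p *\<^sub>t D X Y p))"

definition levi_civita ::
  "('m::topological_space, 'n::finite) chart set \<Rightarrow> 'm form2 \<Rightarrow>
   ('m vfield \<Rightarrow> 'm vfield \<Rightarrow> 'm vfield) \<Rightarrow> bool" where
  "levi_civita A g D \<longleftrightarrow> affine_connection A D \<and>
     (\<forall>U X Y. open U \<and> vector_field_on A U X \<and> vector_field_on A U Y \<longrightarrow>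
        (\<forall>p\<in>U. D X Y p -\<^sub>t D Y X p = lie_bracket A X Y p)) \<and>
     (\<forall>U X Y Z. open U \<and> vector_field_on A U X \<and> vector_field_on A U Y \<and>
        vector_field_on A U Z \<longrightarrow>
        (\<forall>p\<in>U. X p (\<lambda>q. g q (Y q) (Z q)) = g p (D X Y p) (Z p) + g p (Y p) (D X Z p)))"

definition curvature ::
  "('m::topological_space, 'n::finite) chart set \<Rightarrow> ('m vfield \<Rightarrow> 'm vfield \<Rightarrow> 'm vfield) \<Rightarrow>
   'm \<Rightarrow> 'm tvec \<Rightarrow> 'm tvec \<Rightarrow> 'm tvec \<Rightarrow> 'm tvec" where
  "curvature A D p u v w =
     (let X = local_ext A p u; Y = local_ext A p v; Z = local_ext A p w in
        D X (D Y Z) p -\<^sub>t D Y (D X Z) p -\<^sub>t D (lie_bracket A X Y) Z p)"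

text \<open>Trace of a linear endomorphism of the tangent space at \<open>p\<close>, computed in the coordinate
  basis of some chart around \<open>p\<close>; applying a tangent vector to the coordinate functions gives
  its components.\<close>

definition tangent_trace ::
  "('m::topological_space, 'n::finite) chart set \<Rightarrow> 'm \<Rightarrow> ('m tvec \<Rightarrow> 'm tvec) \<Rightarrow> real" where
  "tangent_trace A p L =
     (let ch = (SOME ch. ch \<in> A \<and> p \<in> fst ch) in
        \<Sum>i\<in>UNIV. L (chart_dir A ch p (axis i 1)) (\<lambda>q. snd ch q $ i))"

definition ricci ::
  "('m::topological_space, 'n::finite) chart set \<Rightarrow> ('m vfield \<Rightarrow> 'm vfield \<Rightarrow> 'm vfield) \<Rightarrow>
   'm form2" where
  "ricci A D p v w = tangent_trace A p (\<lambda>u. curvature A D p u v w)"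

definition ricci_operator ::
  "('m::topological_space, 'n::finite) chart set \<Rightarrow> 'm form2 \<Rightarrow>
   ('m vfield \<Rightarrow> 'm vfield \<Rightarrow> 'm vfield) \<Rightarrow> 'm endo" where
  "ricci_operator A g D p v =
     (THE z. z \<in> tangent_space A p \<and> (\<forall>w\<in>tangent_space A p. g p z w = ricci A D p v w))"

definition tangent_eigenvector ::
  "('m::topological_space, 'n::finite) chart set \<Rightarrow> 'm \<Rightarrow> ('m tvec \<Rightarrow> 'm tvec) \<Rightarrow> 'm tvec \<Rightarrow> bool" where
  "tangent_eigenvector A p L v \<longleftrightarrow>
     v \<in> tangent_space A p \<and> v \<noteq> tv_zero \<and> (\<exists>a. L v = a *\<^sub>t v)"

section \<open>Contact metric structures\<close>

definition contact_metric ::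
  "('m::topological_space, 'n::finite) chart set \<Rightarrow> 'm endo \<Rightarrow> 'm vfield \<Rightarrow> 'm form1 \<Rightarrow> 'm form2 \<Rightarrow> bool" where
  "contact_metric A \<phi> \<xi> \<eta> g \<longleftrightarrow>
     endo_field A \<phi> \<and> vector_field_on A UNIV \<xi> \<and> one_form A \<eta> \<and> riemannian_metric A g \<and>
     (\<forall>p. \<eta> p (\<xi> p) = 1) \<and>
     (\<forall>p. \<forall>u\<in>tangent_space A p. \<phi> p (\<phi> p u) = \<eta> p u *\<^sub>t \<xi> p -\<^sub>t u) \<and>
     (\<forall>p. \<forall>u\<in>tangent_space A p. \<forall>v\<in>tangent_space A p.
        g p (\<phi> p u) (\<phi> p v) = g p u v - \<eta> p u * \<eta> p v) \<and>
     (\<forall>p. \<forall>u\<in>tangent_space A p. \<forall>v\<in>tangent_space A p. ext_deriv A \<eta> p u v = g p u (\<phi> p v))"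

definition contact_h ::
  "('m::topological_space, 'n::finite) chart set \<Rightarrow> 'm vfield \<Rightarrow> 'm endo \<Rightarrow> 'm endo" where
  "contact_h A \<xi> \<phi> p u = (1/2) *\<^sub>t lie_deriv_endo A \<xi> \<phi> p u"

definition kmn_contact_metric ::
  "('m::topological_space, 'n::finite) chart set \<Rightarrow> 'm endo \<Rightarrow> 'm vfield \<Rightarrow> 'm form1 \<Rightarrow> 'm form2 \<Rightarrow>
   ('m vfield \<Rightarrow> 'm vfield \<Rightarrow> 'm vfield) \<Rightarrow> ('m \<Rightarrow> real) \<Rightarrow> ('m \<Rightarrow> real) \<Rightarrow> ('m \<Rightarrow> real) \<Rightarrow> bool" where
  "kmn_contact_metric A \<phi> \<xi> \<eta> g D \<kappa> \<mu> \<nu> \<longleftrightarrow>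
     contact_metric A \<phi> \<xi> \<eta> g \<and> levi_civita A g D \<and>
     smooth_fun_on A UNIV \<kappa> \<and> smooth_fun_on A UNIV \<mu> \<and> smooth_fun_on A UNIV \<nu> \<and>
     (\<forall>p. \<forall>u\<in>tangent_space A p. \<forall>v\<in>tangent_space A p.
        (let h = contact_h A \<xi> \<phi> in
          curvature A D p u v (\<xi> p) =
            \<kappa> p *\<^sub>t (\<eta> p v *\<^sub>t u -\<^sub>t \<eta> p u *\<^sub>t v) +\<^sub>t
            \<mu> p *\<^sub>t (\<eta> p v *\<^sub>t h p u -\<^sub>t \<eta> p u *\<^sub>t h p v) +\<^sub>t
            \<nu> p *\<^sub>t (\<eta> p v *\<^sub>t \<phi> p (h p u) -\<^sub>t \<eta> p u *\<^sub>t \<phi> p (h p v))))"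

definition I_inv :: "('m \<Rightarrow> real) \<Rightarrow> ('m \<Rightarrow> real) \<Rightarrow> 'm \<Rightarrow> real" where
  "I_inv \<kappa> \<mu> p = (1 - \<mu> p / 2) / sqrt (1 - \<kappa> p)"

definition canonical_paracontact ::
  "('m::topological_space, 'n::finite) chart set \<Rightarrow> ('m \<Rightarrow> real) \<Rightarrow> 'm endo \<Rightarrow> 'm vfield \<Rightarrow> 'm form1 \<Rightarrow>
   'm endo \<times> 'm vfield \<times> 'm form1 \<times> 'm form2" where
  "canonical_paracontact A \<kappa> \<phi> \<xi> \<eta> =
     (let h = contact_h A \<xi> \<phi> in
       (\<lambda>p u. (1 / sqrt (1 - \<kappa> p)) *\<^sub>t h p u,
        \<xi>,
        \<eta>,
        \<lambda>p u v. (1 / sqrt (1 - \<kappa> p)) * ext_deriv A \<eta> p u (h p v) + \<eta> p u * \<eta> p v))"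

end

(*
Near every point there is a g-orthonormal frame e, phi e, xi with h e = lam e, lam = sqrt (1 - kappa).
Write a, b, c for the remaining connection coefficients: a = g(D_xi e, phi e), b = g(D_e e, phi e),
c = g(D_(phi e) phi e, e). The curvature condition gives a = - mu/2, xi(lam) = nu lam, e(lam) = 2 lam c and
(phi e)(lam) = 2 lam b; with nu constant, the Jacobi identity adds e(a) = e(lam) and
(phi e)(a) = - (phi e)(lam). The hypothesis xi(I) = 0 says xi(a) = nu (1 + a), so m = 1 + lam + a and
n = 1 - lam + a both satisfy xi(f) = nu f, while (phi e)(m) = 0 = e(n). Applying the bracket [phi e, xi]
to m and [e, xi] to n forces c n = 0 and b m = 0.
In the same frame e and phi e are null for the paracontact metric, with product 1, and its
Levi-Civita connection comes out explicitly: Ric(xi, e) = 2 m b and Ric(xi, phi e) = - 2 n c.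
*)

theory Submission
  imports Defs
begin

section \<open>Calculus of \<open>C\<^sup>k\<close> maps\<close>

text \<open>Tensors are defined through an arbitrary local extension of tangent vectors, so
  pointwise expressions must be shown tensorial before a frame can evaluate them. Only the axioms of
  the structure are assumed: the classical formulas for D xi and h^2 are recovered in the frame,
  from d eta, the Jacobi identity and the curvature condition. A smooth eigenframe exists because
  kappa < 1 keeps the eigenvalues lam and -lam of h apart. The functions m and n come from the
  brackets: [e, xi] = - m phi e and [phi e, xi] = n e. Testing a bracket on m or n therefore
  reproduces m or n as a factor, and since nu is constant, the factor in xi(f) = nu f passes through
  the derivatives along e and phi e. Which factor of c n or b m vanishes may change from point to
  point. As the mixed Ricci components contain exactly these products, the manifold need not be
  split into open pieces.\<close>

lemma frechet_derivative_eqI: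
  "(f has_derivative f') (at x) \<Longrightarrow> frechet_derivative f (at x) v = f' v"
  using frechet_derivative_at by fastforce

text \<open>Openness makes \<open>f\<close> and \<open>g\<close> agree near each point of
  \<open>S\<close>, hence their derivatives agree on all of \<open>S\<close> and the induction can
  pass to them.\<close>

lemma Ck_on_cong:
  assumes "open S" "\<And>x. x \<in> S \<Longrightarrow> f x = g x" "Ck_on k S f"
  shows "Ck_on k S g"
  using assms(2,3)
proof (induction k arbitrary: f g)
  case 0
  then show ?case by (metis Ck_on.simps(1) continuous_on_cong)
next
  case (Suc k)
  have d: "f differentiable (at x)" if "x \<in> S" for x
    using Suc.prems that by simp
  have eq: "frechet_derivative f (at x) = frechet_derivative g (at x)" if "x \<in> S" for x
    using frechet_derivative_transform_within_open[OF d[OF that] assms(1) that Suc.prems(1)] by simp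
  have "g differentiable (at x)" if "x \<in> S" for x
    using d[OF that] Suc.prems(1) assms(1) that
    unfolding differentiable_def by (metis has_derivative_transform_within_open)
  moreover have "Ck_on k S (\<lambda>x. frechet_derivative g (at x) v)" for v
    by (rule Suc.IH[of "\<lambda>x. frechet_derivative f (at x) v"]) (use eq Suc.prems in auto)
  ultimately show ?case by simp
qed

lemma Ck_on_subset: "Ck_on k S f \<Longrightarrow> T \<subseteq> S \<Longrightarrow> Ck_on k T f"
  by (induction k arbitrary: f) (auto intro: continuous_on_subset)

lemma Ck_on_Suc_imp: "Ck_on (Suc k) S f \<Longrightarrow> Ck_on k S f"
proof (induction k arbitrary: f)
  case 0
  then show ?case
    by (auto intro!: continuous_at_imp_continuous_on differentiable_imp_continuous_within)
next
  case (Suc k)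
  then show ?case by (metis Ck_on.simps(2))
qed

lemma Ck_on_const [simp]: "Ck_on k S (\<lambda>x. c)"
  by (induction k arbitrary: c) auto

lemma Ck_on_bounded_linear:
  assumes "open S" "bounded_linear L" "Ck_on k S f"
  shows "Ck_on k S (\<lambda>x. L (f x))"
  using assms(3)
proof (induction k arbitrary: f)
  case 0
  then show ?case
    using assms(2) by (simp add: bounded_linear.continuous_on)
next
  case (Suc k)
  have *: "((\<lambda>x. L (f x)) has_derivative (\<lambda>v. L (frechet_derivative f (at x) v))) (at x)"
    if "x \<in> S" for x
    by (rule bounded_linear.has_derivative[OF assms(2)])
      (use Suc.prems that in \<open>auto simp flip: frechet_derivative_works\<close>)
  then have eq: "frechet_derivative (\<lambda>x. L (f x)) (at x) v = L (frechet_derivative f (at x) v)"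
    if "x \<in> S" for x v
    by (rule frechet_derivative_eqI) (rule that)
  have "Ck_on k S (\<lambda>x. frechet_derivative (\<lambda>x. L (f x)) (at x) v)" for v
    by (rule Ck_on_cong[OF assms(1) _ Suc.IH[of "\<lambda>x. frechet_derivative f (at x) v"]])
      (use eq Suc.prems in auto)
  with * show ?case unfolding Ck_on.simps(2) differentiable_def by blast
qed

lemma Ck_on_add:
  assumes "open S" "Ck_on k S f" "Ck_on k S g"
  shows "Ck_on k S (\<lambda>x. f x + g x)"
  using assms(2,3)
proof (induction k arbitrary: f g)
  case 0
  then show ?case by (simp add: continuous_on_add)
next
  case (Suc k)
  have *: "((\<lambda>x. f x + g x) has_derivative
      (\<lambda>v. frechet_derivative f (at x) v + frechet_derivative g (at x) v)) (at x)" if "x \<in> S" for x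
    by (rule has_derivative_add) (use Suc.prems that in \<open>auto simp: frechet_derivative_works\<close>)
  then have eq: "frechet_derivative (\<lambda>x. f x + g x) (at x) v =
      frechet_derivative f (at x) v + frechet_derivative g (at x) v" if "x \<in> S" for x v
    by (rule frechet_derivative_eqI) (rule that)
  have "Ck_on k S (\<lambda>x. frechet_derivative (\<lambda>x. f x + g x) (at x) v)" for v
    by (rule Ck_on_cong[OF assms(1) _ Suc.IH]) (use eq Suc.prems in auto)
  with * show ?case unfolding Ck_on.simps(2) differentiable_def by blast
qed

lemma Ck_on_sum:
  assumes "open S" "\<And>i. i \<in> I \<Longrightarrow> Ck_on k S (f i)"
  shows "Ck_on k S (\<lambda>x. \<Sum>i\<in>I. f i x)"
  using assms(2)
  by (induction I rule: infinite_finite_induct) (auto intro: Ck_on_add[OF assms(1)])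

lemma Ck_on_mult:
  fixes f g :: "'a::real_normed_vector \<Rightarrow> real"
  assumes "open S" "Ck_on k S f" "Ck_on k S g"
  shows "Ck_on k S (\<lambda>x. f x * g x)"
  using assms(2,3)
proof (induction k arbitrary: f g)
  case 0
  then show ?case by (simp add: continuous_on_mult)
next
  case (Suc k)
  have *: "((\<lambda>x. f x * g x) has_derivative
      (\<lambda>v. f x * frechet_derivative g (at x) v + frechet_derivative f (at x) v * g x)) (at x)"
    if "x \<in> S" for x
    by (rule has_derivative_mult) (use Suc.prems that in \<open>auto simp: frechet_derivative_works\<close>)
  then have eq: "frechet_derivative (\<lambda>x. f x * g x) (at x) v =
      f x * frechet_derivative g (at x) v + frechet_derivative f (at x) v * g x" if "x \<in> S" for x v
    by (rule frechet_derivative_eqI) (rule that)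
  have "Ck_on k S (\<lambda>x. f x * frechet_derivative g (at x) v + frechet_derivative f (at x) v * g x)" for v
    by (intro Ck_on_add[OF assms(1)] Suc.IH) (use Suc.prems Ck_on_Suc_imp in \<open>auto\<close>)
  then have "Ck_on k S (\<lambda>x. frechet_derivative (\<lambda>x. f x * g x) (at x) v)" for v
    using Ck_on_cong[OF assms(1)] eq by (metis (no_types, lifting))
  with * show ?case unfolding Ck_on.simps(2) differentiable_def by blast
qed

text \<open>\<open>Ck_on\<close> differentiates in fixed directions only, while the chain rule
  differentiates \<open>f\<close> in a direction that varies with x. Expanding that direction over
  \<open>Basis\<close> gives a finite sum of products to which the induction hypothesis
  applies.\<close>

lemma Ck_on_compose:
  fixes f :: "'b::euclidean_space \<Rightarrow> real" and g :: "'a::real_normed_vector \<Rightarrow> 'b"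
  assumes "open S" "open T" "g ` S \<subseteq> T" "Ck_on k T f" "Ck_on k S g"
  shows "Ck_on k S (\<lambda>x. f (g x))"
  using assms(4,5)
proof (induction k arbitrary: f)
  case 0
  then show ?case using assms(3) by (simp add: continuous_on_compose2)
next
  case (Suc k)
  have df: "(f has_derivative frechet_derivative f (at (g x))) (at (g x))" if "x \<in> S" for x
    using Suc.prems assms(3) that by (auto simp: frechet_derivative_works)
  have dg: "(g has_derivative frechet_derivative g (at x)) (at x)" if "x \<in> S" for x
    using Suc.prems that by (auto simp: frechet_derivative_works)
  have *: "((\<lambda>x. f (g x)) has_derivative
      (\<lambda>v. frechet_derivative f (at (g x)) (frechet_derivative g (at x) v))) (at x)" if "x \<in> S" for x
    using diff_chain_at[OF dg df] that by (simp add: o_def)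
  have eq: "frechet_derivative (\<lambda>x. f (g x)) (at x) v =
      (\<Sum>b\<in>Basis. (frechet_derivative g (at x) v \<bullet> b) * frechet_derivative f (at (g x)) b)"
    if "x \<in> S" for x v
  proof -
    have "frechet_derivative (\<lambda>x. f (g x)) (at x) v = frechet_derivative f (at (g x)) (frechet_derivative g (at x) v)"
      by (rule frechet_derivative_eqI[OF *[OF that]])
    also have "\<dots> = frechet_derivative f (at (g x))
       (\<Sum>b\<in>Basis. (frechet_derivative g (at x) v \<bullet> b) *\<^sub>R b)"
      by (simp add: euclidean_representation)
    also have "\<dots> = (\<Sum>b\<in>Basis. (frechet_derivative g (at x) v \<bullet> b) * frechet_derivative f (at (g x)) b)"
      using has_derivative_linear[OF df[OF that]] by (simp add: linear_sum linear_cmul)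
    finally show ?thesis .
  qed
  have gk: "Ck_on k S g" using Ck_on_Suc_imp[OF Suc.prems(2)] .
  have "Ck_on k S (\<lambda>x. frechet_derivative g (at x) v \<bullet> b)" for v b
    by (rule Ck_on_bounded_linear[OF assms(1) bounded_linear_inner_left]) (use Suc.prems in auto)
  moreover have "Ck_on k S (\<lambda>x. frechet_derivative f (at (g x)) b)" for b
    by (rule Suc.IH) (use Suc.prems gk in auto)
  ultimately have "Ck_on k S (\<lambda>x. (\<Sum>b\<in>Basis. (frechet_derivative g (at x) v \<bullet> b) * frechet_derivative f (at (g x)) b))" for v
    by (intro Ck_on_sum[OF assms(1)] Ck_on_mult[OF assms(1)])
  then have "Ck_on k S (\<lambda>x. frechet_derivative (\<lambda>x. f (g x)) (at x) v)" for v
    using Ck_on_cong[OF assms(1)] eq by (metis (no_types, lifting))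
  with * show ?case unfolding Ck_on.simps(2) differentiable_def by blast
qed

text \<open>The exponent is arbitrary because each derivative lowers it by one. Square roots and
  reciprocals are the exponents 1/2 and -1.\<close>

lemma Ck_on_powr: "Ck_on k {0<..} (\<lambda>x::real. x powr a)"
proof (induction k arbitrary: a)
  case 0
  show ?case by (auto intro!: continuous_intros)
next
  case (Suc k)
  have *: "((\<lambda>x. x powr a) has_derivative (\<lambda>v. a * x powr (a - 1) * v)) (at x)"
    if "x \<in> {0<..}" for x :: real
    using has_real_derivative_powr[of x a] that unfolding has_field_derivative_def by simp
  then have eq: "frechet_derivative (\<lambda>x. x powr a) (at x) v = (a * v) * x powr (a - 1)"
    if "x \<in> {0<..}" for x v :: real
    using frechet_derivative_eqI[OF *[OF that]] by simp
  have "Ck_on k {0<..} (\<lambda>x. (a * v) * x powr (a - 1))" for v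
    by (rule Ck_on_mult) (auto intro: Suc)
  then have "Ck_on k {0<..} (\<lambda>x. frechet_derivative (\<lambda>x. x powr a) (at x) v)" for v
    using Ck_on_cong[OF open_greaterThan] eq by (metis (no_types, lifting))
  with * show ?case unfolding Ck_on.simps(2) differentiable_def by blast
qed

section \<open>Smooth functions and vector fields in charts\<close>

locale smooth_mfd =
  fixes A :: "('m::{t2_space, second_countable_topology}, 'n::finite) chart set"
  assumes manifold: "smooth_manifold A"
begin

lemma chartD:
  assumes "(U, c) \<in> A"
  shows "open U" "open (c ` U)" "homeomorphism U (c ` U) c (inv_into U c)"
proof -
  have "\<forall>(U, c)\<in>A. open U \<and> open (c ` U) \<and> homeomorphism U (c ` U) c (inv_into U c)"
    using manifold unfolding smooth_manifold_def by (elim conjE)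
  from bspec[OF this assms]
  show "open U" "open (c ` U)" "homeomorphism U (c ` U) c (inv_into U c)"
    by simp_all
qed

lemma inv_chart [simp]: "(U, c) \<in> A \<Longrightarrow> q \<in> U \<Longrightarrow> inv_into U c (c q) = q"
  by (rule homeomorphism_apply1[OF chartD(3)])

lemma open_chart_image:
  assumes "(U, c) \<in> A" "open W"
  shows "open (c ` (U \<inter> W))"
proof -
  have "openin (top_of_set (c ` U)) (c ` (U \<inter> W))"
    by (rule homeomorphism_imp_open_map[OF chartD(3)[OF assms(1)]]) (rule openin_open_Int[OF assms(2)])
  then show ?thesis using openin_open_eq[OF chartD(2)[OF assms(1)]] by metis
qed

lemma ex_chart: "\<exists>U c. (U, c) \<in> A \<and> p \<in> U"
proof -
  have "p \<in> (\<Union>(U, c)\<in>A. U)" using manifold unfolding smooth_manifold_def by simp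
  then show ?thesis by blast
qed

lemma Ck_transition:
  assumes "(U, c) \<in> A" "(V, d) \<in> A"
  shows "Ck_on k (d ` (V \<inter> U)) (\<lambda>x. c (inv_into V d x))"
proof -
  have "\<forall>(U, c)\<in>A. \<forall>(V, d)\<in>A. smooth_map_on (c ` (U \<inter> V)) (d \<circ> inv_into U c)"
    using manifold unfolding smooth_manifold_def by (elim conjE)
  from bspec[OF this assms(2)] have "\<forall>(U, c)\<in>A. smooth_map_on (d ` (V \<inter> U)) (c \<circ> inv_into V d)"
    unfolding prod.case .
  from bspec[OF this assms(1)] show ?thesis
    unfolding prod.case smooth_map_on_def o_def by (rule spec)
qed

lemma smooth_fun_onD:
  "smooth_fun_on A W f \<Longrightarrow> (U, c) \<in> A \<Longrightarrow> Ck_on k (c ` (U \<inter> W)) (\<lambda>x. f (inv_into U c x))"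
  unfolding smooth_fun_on_def smooth_map_on_def o_def by (drule (1) bspec) simp

lemma smooth_fun_onI:
  "(\<And>U c k. (U, c) \<in> A \<Longrightarrow> Ck_on k (c ` (U \<inter> W)) (\<lambda>x. f (inv_into U c x))) \<Longrightarrow> smooth_fun_on A W f"
  unfolding smooth_fun_on_def smooth_map_on_def o_def by (auto simp only: prod.case split_paired_all)

lemma smooth_fun_on_subset: "smooth_fun_on A W f \<Longrightarrow> V \<subseteq> W \<Longrightarrow> smooth_fun_on A V f"
  by (rule smooth_fun_onI) (rule Ck_on_subset[OF smooth_fun_onD], auto)

lemma smooth_fun_on_cong:
  assumes "open W" "\<And>q. q \<in> W \<Longrightarrow> f q = g q" "smooth_fun_on A W f"
  shows "smooth_fun_on A W g"
  by (rule smooth_fun_onI, rule Ck_on_cong[OF open_chart_image _ smooth_fun_onD[OF assms(3)]])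
    (use assms in auto)

lemma smooth_const [simp]: "smooth_fun_on A W (\<lambda>q. c)"
  by (rule smooth_fun_onI) simp

lemma smooth_add:
  assumes "open W" "smooth_fun_on A W f" "smooth_fun_on A W g"
  shows "smooth_fun_on A W (\<lambda>q. f q + g q)"
  by (rule smooth_fun_onI, rule Ck_on_add[OF open_chart_image])
    (use assms smooth_fun_onD in auto)

lemma smooth_mult:
  assumes "open W" "smooth_fun_on A W f" "smooth_fun_on A W g"
  shows "smooth_fun_on A W (\<lambda>q. f q * g q)"
  by (rule smooth_fun_onI, rule Ck_on_mult[OF open_chart_image])
    (use assms smooth_fun_onD in auto)

lemma smooth_minus:
  assumes "open W" "smooth_fun_on A W f"
  shows "smooth_fun_on A W (\<lambda>q. - f q)"
  using smooth_mult[OF assms(1) smooth_const[of W "-1"] assms(2)] by simp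

lemma smooth_diff:
  assumes "open W" "smooth_fun_on A W f" "smooth_fun_on A W g"
  shows "smooth_fun_on A W (\<lambda>q. f q - g q)"
  using smooth_add[OF assms(1,2) smooth_minus[OF assms(1,3)]] by simp

lemma smooth_powr:
  assumes "open W" "smooth_fun_on A W f" "\<And>q. q \<in> W \<Longrightarrow> f q > 0"
  shows "smooth_fun_on A W (\<lambda>q. f q powr a)"
proof (rule smooth_fun_onI)
  fix U c k assume U: "(U, c) \<in> A"
  show "Ck_on k (c ` (U \<inter> W)) (\<lambda>x. f (inv_into U c x) powr a)"
    by (rule Ck_on_compose[OF open_chart_image[OF U assms(1)] open_greaterThan _ Ck_on_powr
          smooth_fun_onD[OF assms(2) U]]) (use U assms(3) in auto)
qed

lemma smooth_sqrt:
  assumes "open W" "smooth_fun_on A W f" "\<And>q. q \<in> W \<Longrightarrow> f q > 0"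
  shows "smooth_fun_on A W (\<lambda>q. sqrt (f q))"
proof (rule smooth_fun_on_cong[OF assms(1) _ smooth_powr[OF assms, of "1/2"]])
  fix q assume "q \<in> W"
  then show "f q powr (1/2) = sqrt (f q)" using assms(3)[of q] by (intro powr_half_sqrt) simp
qed

lemma smooth_inverse:
  assumes "open W" "smooth_fun_on A W f" "\<And>q. q \<in> W \<Longrightarrow> f q > 0"
  shows "smooth_fun_on A W (\<lambda>q. 1 / f q)"
proof (rule smooth_fun_on_cong[OF assms(1) _ smooth_powr[OF assms, of "-1"]])
  fix q assume "q \<in> W"
  then show "f q powr (-1) = 1 / f q" using assms(3)[of q] by (simp add: powr_minus_divide)
qed

lemma smooth_divide:
  assumes "open W" "smooth_fun_on A W f" "smooth_fun_on A W g" "\<And>q. q \<in> W \<Longrightarrow> g q > 0"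
  shows "smooth_fun_on A W (\<lambda>q. f q / g q)"
  using smooth_mult[OF assms(1,2) smooth_inverse[OF assms(1,3,4)]] by simp

lemma smooth_coordinate:
  assumes "(U, c) \<in> A"
  shows "smooth_fun_on A U (\<lambda>q. c q $ i)"
proof (rule smooth_fun_onI)
  fix V d k assume V: "(V, d) \<in> A"
  show "Ck_on k (d ` (V \<inter> U)) (\<lambda>x. c (inv_into V d x) $ i)"
    by (rule Ck_on_bounded_linear[OF open_chart_image[OF V chartD(1)[OF assms]]
          bounded_linear_vec_nth Ck_transition[OF assms V]])
qed

lemma smooth_imp_continuous:
  assumes "open W" "smooth_fun_on A W f"
  shows "continuous_on W f"
proof (rule continuous_at_imp_continuous_on, rule ballI)
  fix p assume p: "p \<in> W"
  obtain U c where U: "(U, c) \<in> A" "p \<in> U" using ex_chart by blast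
  have c: "continuous_on (c ` (U \<inter> W)) (\<lambda>x. f (inv_into U c x))"
    using smooth_fun_onD[OF assms(2) U(1), of 0] by simp
  have "continuous_on (U \<inter> W) (\<lambda>q. f (inv_into U c (c q)))"
    by (rule continuous_on_compose2[OF c continuous_on_subset[OF homeomorphism_cont1[OF chartD(3)[OF U(1)]]]])
      auto
  then have "continuous_on (U \<inter> W) f"
    by (rule continuous_on_eq) (simp add: U(1))
  moreover have "open (U \<inter> W)" using chartD(1)[OF U(1)] assms(1) by blast
  ultimately have "\<forall>x\<in>U \<inter> W. isCont f x" by (simp only: continuous_on_eq_continuous_at)
  then show "isCont f p" using p U(2) by (rule_tac bspec) simp_all
qed

lemma open_pos_set:
  assumes "open W" "smooth_fun_on A W f"
  shows "open {q \<in> W. f q > 0}"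
proof -
  have "open (W \<inter> f -` {0<..})"
    by (rule continuous_open_preimage[OF smooth_imp_continuous[OF assms] assms(1) open_greaterThan])
  moreover have "{q \<in> W. f q > 0} = W \<inter> f -` {0<..}" by (rule set_eqI) simp
  ultimately show ?thesis by (simp only:)
qed

section \<open>Tangent vectors as derivations, and their components in a chart\<close>

lemma smooth_differentiable:
  assumes "(U, c) \<in> A" "p \<in> U" "p \<in> W" "smooth_fun_on A W f"
  shows "(\<lambda>x. f (inv_into U c x)) differentiable (at (c p))"
proof -
  have "\<forall>x\<in>c ` (U \<inter> W). (\<lambda>x. f (inv_into U c x)) differentiable (at x)"
    using smooth_fun_onD[OF assms(4,1), of "Suc 0"] unfolding Ck_on.simps by (rule conjunct1)
  with assms(2,3) show ?thesis by blast
qed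

lemma chart_dir_has_derivative:
  assumes "(U, c) \<in> A" "p \<in> U" "open W" "p \<in> W" "smooth_fun_on A W f"
  shows "((\<lambda>x. f (inv_into U c x)) has_derivative (\<lambda>v. chart_dir A (U, c) p v f)) (at (c p))"
proof -
  have "smooth_fun_near A p f" using assms unfolding smooth_fun_near_def by blast
  then have "(\<lambda>v. chart_dir A (U, c) p v f) = frechet_derivative (\<lambda>x. f (inv_into U c x)) (at (c p))"
    unfolding chart_dir_def by (auto simp: o_def)
  then show ?thesis
    using smooth_differentiable[OF assms(1,2,4,5)] by (simp add: frechet_derivative_works)
qed

lemma chart_dir_eqI:
  assumes "(U, c) \<in> A" "p \<in> U" "open W" "p \<in> W" "smooth_fun_on A W f"
    and "((\<lambda>x. f (inv_into U c x)) has_derivative f') (at (c p))"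
  shows "chart_dir A (U, c) p v f = f' v"
  using has_derivative_unique[OF chart_dir_has_derivative[OF assms(1-5)] assms(6)] by meson

lemma chart_dir_linear: "(U, c) \<in> A \<Longrightarrow> p \<in> U \<Longrightarrow> linear (\<lambda>v. chart_dir A (U, c) p v f)"
proof (cases "smooth_fun_near A p f")
  case True
  assume "(U, c) \<in> A" "p \<in> U"
  with True show ?thesis
    unfolding smooth_fun_near_def using chart_dir_has_derivative has_derivative_linear by blast
next
  case False
  then show ?thesis by (simp add: chart_dir_def linear_iff)
qed

lemma smooth_fun_near_cong:
  assumes "open W" "p \<in> W" "\<And>q. q \<in> W \<Longrightarrow> f q = g q" "smooth_fun_near A p f"
  shows "smooth_fun_near A p g"
proof -
  obtain V where V: "open V" "p \<in> V" "smooth_fun_on A V f"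
    using assms(4) unfolding smooth_fun_near_def by blast
  have "smooth_fun_on A (V \<inter> W) g"
    by (rule smooth_fun_on_cong[OF _ _ smooth_fun_on_subset[OF V(3)]]) (use V assms in auto)
  then show ?thesis unfolding smooth_fun_near_def using V assms(1,2) by blast
qed

lemma tangent_spaceE:
  assumes "u \<in> tangent_space A p"
  obtains U c v where "(U, c) \<in> A" "p \<in> U" "u = chart_dir A (U, c) p v"
  using assms unfolding tangent_space_def by force

lemma tv_nonsmooth: "u \<in> tangent_space A p \<Longrightarrow> \<not> smooth_fun_near A p f \<Longrightarrow> u f = 0"
  by (auto elim!: tangent_spaceE simp: chart_dir_def)

text \<open>Tangent vectors take the default value 0 on functions that are not smooth near p.
  Smoothness near p is itself a local property, so \<open>f\<close> and \<open>g\<close> fall into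
  the same case, and only the smooth one needs a chart.\<close>

lemma tv_cong:
  assumes "u \<in> tangent_space A p" "open W" "p \<in> W" "\<And>q. q \<in> W \<Longrightarrow> f q = g q"
  shows "u f = u g"
proof (cases "smooth_fun_near A p f")
  case False
  then have "\<not> smooth_fun_near A p g"
    using smooth_fun_near_cong[OF assms(2,3), of g f] assms(4) by auto
  with False show ?thesis using tv_nonsmooth[OF assms(1)] by simp
next
  case True
  then obtain V where V: "open V" "p \<in> V" "smooth_fun_on A V f"
    unfolding smooth_fun_near_def by blast
  obtain U c v where U: "(U, c) \<in> A" "p \<in> U" "u = chart_dir A (U, c) p v"
    using tangent_spaceE[OF assms(1)] .
  have s: "smooth_fun_on A (V \<inter> W) g"
    by (rule smooth_fun_on_cong[OF _ _ smooth_fun_on_subset[OF V(3)]]) (use V assms in auto)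
  have "((\<lambda>x. g (inv_into U c x)) has_derivative (\<lambda>v. chart_dir A (U, c) p v f)) (at (c p))"
    by (rule has_derivative_transform_within_open[OF chart_dir_has_derivative[OF U(1,2) V]
          open_chart_image[OF U(1) assms(2)]]) (use U assms in auto)
  from chart_dir_eqI[OF U(1,2) _ _ s this] show ?thesis
    unfolding U(3) using V assms by (metis IntI open_Int)
qed

lemma tv_add_fun:
  assumes "u \<in> tangent_space A p" "open W" "p \<in> W" "smooth_fun_on A W f" "smooth_fun_on A W g"
  shows "u (\<lambda>q. f q + g q) = u f + u g"
proof -
  obtain U c v where U: "(U, c) \<in> A" "p \<in> U" "u = chart_dir A (U, c) p v"
    using tangent_spaceE[OF assms(1)] .
  note d = chart_dir_has_derivative[OF U(1,2) assms(2,3)]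
  show ?thesis unfolding U(3)
    by (rule chart_dir_eqI[OF U(1,2) assms(2,3) smooth_add])
      (use assms has_derivative_add[OF d[OF assms(4)] d[OF assms(5)]] in auto)
qed

lemma tv_mult_fun:
  assumes "u \<in> tangent_space A p" "open W" "p \<in> W" "smooth_fun_on A W f" "smooth_fun_on A W g"
  shows "u (\<lambda>q. f q * g q) = f p * u g + u f * g p"
proof -
  obtain U c v where U: "(U, c) \<in> A" "p \<in> U" "u = chart_dir A (U, c) p v"
    using tangent_spaceE[OF assms(1)] .
  note d = chart_dir_has_derivative[OF U(1,2) assms(2,3)]
  show ?thesis unfolding U(3)
    by (rule chart_dir_eqI[OF U(1,2) assms(2,3) smooth_mult])
      (use assms U has_derivative_mult[OF d[OF assms(4)] d[OF assms(5)]] in auto)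
qed

lemma tv_const [simp]:
  assumes "u \<in> tangent_space A p"
  shows "u (\<lambda>q. k) = 0"
proof -
  obtain U c v where U: "(U, c) \<in> A" "p \<in> U" "u = chart_dir A (U, c) p v"
    using tangent_spaceE[OF assms(1)] .
  show ?thesis unfolding U(3)
    by (rule chart_dir_eqI[OF U(1,2) open_UNIV UNIV_I smooth_const]) auto
qed

lemma tv_minus_fun:
  assumes "u \<in> tangent_space A p" "open W" "p \<in> W" "smooth_fun_on A W f"
  shows "u (\<lambda>q. - f q) = - u f"
  using tv_mult_fun[OF assms(1-3) smooth_const[of W "-1"] assms(4)] tv_const[OF assms(1)] by simp

lemma tv_diff_fun:
  assumes "u \<in> tangent_space A p" "open W" "p \<in> W" "smooth_fun_on A W f" "smooth_fun_on A W g"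
  shows "u (\<lambda>q. f q - g q) = u f - u g"
  using tv_add_fun[OF assms(1-4) smooth_minus[OF assms(2,5)]] tv_minus_fun[OF assms(1-3,5)] by simp

lemma chart_dir_coordinate:
  assumes "(U, c) \<in> A" "p \<in> U"
  shows "chart_dir A (U, c) p v (\<lambda>q. c q $ i) = v $ i"
proof (rule chart_dir_eqI[OF assms chartD(1)[OF assms(1)] assms(2) smooth_coordinate[OF assms(1)]])
  show "((\<lambda>x. c (inv_into U c x) $ i) has_derivative (\<lambda>v. v $ i)) (at (c p))"
    by (rule has_derivative_transform_within_open[OF _ chartD(2)[OF assms(1)], of "\<lambda>x. x $ i"])
      (use assms in \<open>auto intro!: bounded_linear.has_derivative[OF bounded_linear_vec_nth, of "\<lambda>x. x" "\<lambda>x. x", simplified]\<close>)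
qed

text \<open>The chain rule through the transition map \<open>t\<close>. As
  \<open>tangent_space\<close> collects directions from all charts, this is what allows vectors at p
  to be compared and added in a single chart.\<close>

lemma tangent_eq_chart_dir:
  assumes "(U, c) \<in> A" "p \<in> U" "u \<in> tangent_space A p"
  shows "u = chart_dir A (U, c) p (\<chi> i. u (\<lambda>q. c q $ i))"
proof
  fix f
  show "u f = chart_dir A (U, c) p (\<chi> i. u (\<lambda>q. c q $ i)) f"
  proof (cases "smooth_fun_near A p f")
    case False
    then show ?thesis using tv_nonsmooth[OF assms(3)] by (simp add: chart_dir_def)
  next
    case True
    then obtain W where W: "open W" "p \<in> W" "smooth_fun_on A W f"
      unfolding smooth_fun_near_def by blast
    obtain V d v where V: "(V, d) \<in> A" "p \<in> V" "u = chart_dir A (V, d) p v"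
      using tangent_spaceE[OF assms(3)] .
    define t where "t = (\<lambda>x. c (inv_into V d x))"
    have tp: "t (d p) = c p" using V by (simp add: t_def)
    have "\<forall>x\<in>d ` (V \<inter> U). t differentiable (at x)"
      using Ck_transition[OF assms(1) V(1), of "Suc 0"] unfolding Ck_on.simps t_def by (rule conjunct1)
    then have "t differentiable (at (d p))" using assms(2) V(2) by blast
    then have dt: "(t has_derivative frechet_derivative t (at (d p))) (at (d p))"
      by (simp add: frechet_derivative_works)
    \<comment> \<open>The derivative of \<open>t\<close> transforms components: its i-th entry is
      the derivative of the i-th coordinate of \<open>c\<close>, taken in the chart
      \<open>d\<close>.\<close>
    have comp: "frechet_derivative t (at (d p)) v = (\<chi> i. u (\<lambda>q. c q $ i))"
    proof (subst vec_eq_iff, rule allI)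
      fix i
      have "u (\<lambda>q. c q $ i) = frechet_derivative t (at (d p)) v $ i"
        unfolding V(3)
        by (rule chart_dir_eqI[OF V(1,2) chartD(1)[OF assms(1)] assms(2) smooth_coordinate[OF assms(1)]])
          (use bounded_linear.has_derivative[OF bounded_linear_vec_nth dt] in \<open>simp add: t_def\<close>)
      then show "frechet_derivative t (at (d p)) v $ i = (\<chi> i. u (\<lambda>q. c q $ i)) $ i" by simp
    qed
    have "(((\<lambda>x. f (inv_into U c x)) \<circ> t) has_derivative
        ((\<lambda>v. chart_dir A (U, c) p v f) \<circ> frechet_derivative t (at (d p)))) (at (d p))"
      by (rule diff_chain_at[OF dt]) (use chart_dir_has_derivative[OF assms(1,2) W] tp in simp)
    then have "((\<lambda>x. f (inv_into V d x)) has_derivative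
        ((\<lambda>v. chart_dir A (U, c) p v f) \<circ> frechet_derivative t (at (d p)))) (at (d p))"
      by (rule has_derivative_transform_within_open[OF _ open_chart_image[OF V(1) chartD(1)[OF assms(1)]]])
        (use assms V in \<open>auto simp: t_def\<close>)
    then have "u f = chart_dir A (U, c) p (frechet_derivative t (at (d p)) v) f"
      using chart_dir_eqI[OF V(1,2) W] V(3) by simp
    then show ?thesis by (simp add: comp)
  qed
qed

lemma chart_dir_in_tangent [intro]:
  "(U, c) \<in> A \<Longrightarrow> p \<in> U \<Longrightarrow> chart_dir A (U, c) p v \<in> tangent_space A p"
  unfolding tangent_space_def by force

lemma chart_dir_lin:
  assumes "(U, c) \<in> A" "p \<in> U"
  shows "chart_dir A (U, c) p (a *\<^sub>R v + b *\<^sub>R w) = a *\<^sub>t chart_dir A (U, c) p v +\<^sub>t b *\<^sub>t chart_dir A (U, c) p w"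
  unfolding tv_add_def tv_scale_def
  by (rule ext) (simp add: linear_add[OF chart_dir_linear[OF assms]] linear_cmul[OF chart_dir_linear[OF assms]])

lemma tangent_lin:
  assumes "u \<in> tangent_space A p" "w \<in> tangent_space A p"
  shows "a *\<^sub>t u +\<^sub>t b *\<^sub>t w \<in> tangent_space A p"
proof -
  obtain U c where U: "(U, c) \<in> A" "p \<in> U" using ex_chart by blast
  show ?thesis
    by (subst tangent_eq_chart_dir[OF U assms(1)], subst tangent_eq_chart_dir[OF U assms(2)],
        subst chart_dir_lin[OF U, symmetric], rule chart_dir_in_tangent[OF U])
qed

lemma tangent_add: "u \<in> tangent_space A p \<Longrightarrow> w \<in> tangent_space A p \<Longrightarrow> u +\<^sub>t w \<in> tangent_space A p"
  using tangent_lin[of u p w 1 1] by (simp add: tv_scale_def)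

lemma tangent_scale: "u \<in> tangent_space A p \<Longrightarrow> a *\<^sub>t u \<in> tangent_space A p"
  using tangent_lin[of u p u a 0] by (simp add: tv_scale_def tv_add_def)

lemma tangent_diff: "u \<in> tangent_space A p \<Longrightarrow> w \<in> tangent_space A p \<Longrightarrow> u -\<^sub>t w \<in> tangent_space A p"
  using tangent_lin[of u p w 1 "-1"] by (simp add: tv_scale_def tv_add_def tv_diff_def)

lemma tangent_zero: "(\<lambda>f. 0) \<in> tangent_space A p"
proof -
  obtain U c where U: "(U, c) \<in> A" "p \<in> U" using ex_chart by blast
  show ?thesis using tangent_scale[OF chart_dir_in_tangent[OF U], of 0] by (simp add: tv_scale_def)
qed

lemma tangent_sum:
  assumes "\<And>i. i \<in> I \<Longrightarrow> u i \<in> tangent_space A p"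
  shows "(\<lambda>f. \<Sum>i\<in>I. a i * u i f) \<in> tangent_space A p"
  using assms
proof (induction I rule: infinite_finite_induct)
  case (insert i I)
  then have "a i *\<^sub>t u i +\<^sub>t 1 *\<^sub>t (\<lambda>f. \<Sum>i\<in>I. a i * u i f) \<in> tangent_space A p"
    by (intro tangent_lin) auto
  with insert show ?case by (simp add: tv_add_def tv_scale_def)
qed (auto simp: tangent_zero)

lemma tangent_expand:
  assumes "(U, c) \<in> A" "p \<in> U" "u \<in> tangent_space A p"
  shows "u f = (\<Sum>i\<in>UNIV. u (\<lambda>q. c q $ i) * chart_dir A (U, c) p (axis i 1) f)"
proof -
  define v where "v = (\<chi> i. u (\<lambda>q. c q $ i))"
  have "(\<Sum>i\<in>UNIV. v $ i *\<^sub>R axis i 1) = v"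
    using basis_expansion[of v] by (simp add: scalar_mult_eq_scaleR)
  then have "u f = chart_dir A (U, c) p (\<Sum>i\<in>UNIV. v $ i *\<^sub>R axis i 1) f"
    using tangent_eq_chart_dir[OF assms] by (simp add: v_def)
  also have "\<dots> = (\<Sum>i\<in>UNIV. v $ i * chart_dir A (U, c) p (axis i 1) f)"
    by (simp add: linear_sum[OF chart_dir_linear[OF assms(1,2)]] linear_cmul[OF chart_dir_linear[OF assms(1,2)]])
  finally show ?thesis by (simp add: v_def)
qed

section \<open>Smooth vector fields\<close>

lemma vector_field_onD:
  assumes "vector_field_on A U X"
  shows "q \<in> U \<Longrightarrow> X q \<in> tangent_space A q"
    and "open W \<Longrightarrow> W \<subseteq> U \<Longrightarrow> smooth_fun_on A W f \<Longrightarrow> smooth_fun_on A W (\<lambda>p. X p f)"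
  using assms unfolding vector_field_on_def by auto

lemma vector_field_onI:
  assumes "\<And>q. q \<in> U \<Longrightarrow> X q \<in> tangent_space A q"
    and "\<And>W f. open W \<Longrightarrow> W \<subseteq> U \<Longrightarrow> smooth_fun_on A W f \<Longrightarrow> smooth_fun_on A W (\<lambda>p. X p f)"
  shows "vector_field_on A U X"
  unfolding vector_field_on_def
proof (intro conjI ballI allI impI)
  fix W f assume "open W \<and> W \<subseteq> U \<and> smooth_fun_on A W f"
  then show "smooth_fun_on A W (\<lambda>p. X p f)" by (elim conjE) (rule assms(2))
qed (rule assms(1))

lemma vector_field_on_subset:
  assumes "vector_field_on A U X" "V \<subseteq> U"
  shows "vector_field_on A V X"
proof (rule vector_field_onI)
  fix q assume "q \<in> V"
  then show "X q \<in> tangent_space A q" using assms(2) vector_field_onD(1)[OF assms(1)] by blast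
next
  fix W f assume "open W" "W \<subseteq> V" "smooth_fun_on A W f"
  then show "smooth_fun_on A W (\<lambda>p. X p f)"
    using vector_field_onD(2)[OF assms(1)] assms(2) by (meson order_trans)
qed

lemma vector_field_on_cong:
  assumes "vector_field_on A U X" "\<And>q. q \<in> U \<Longrightarrow> X q = Y q"
  shows "vector_field_on A U Y"
proof (rule vector_field_onI)
  fix q assume "q \<in> U"
  then show "Y q \<in> tangent_space A q" using assms vector_field_onD(1) by metis
next
  fix W f assume W: "open W" "W \<subseteq> U" "smooth_fun_on A W f"
  show "smooth_fun_on A W (\<lambda>p. Y p f)"
    by (rule smooth_fun_on_cong[OF W(1) _ vector_field_onD(2)[OF assms(1) W]])
      (simp add: assms(2) subsetD[OF W(2)])
qed

lemma vector_field_add: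
  assumes "vector_field_on A U X" "vector_field_on A U Y"
  shows "vector_field_on A U (\<lambda>q. X q +\<^sub>t Y q)"
proof (rule vector_field_onI)
  show "smooth_fun_on A W (\<lambda>q. (X q +\<^sub>t Y q) f)"
    if "open W" "W \<subseteq> U" "smooth_fun_on A W f" for W f
    unfolding tv_add_def
    by (rule smooth_add[OF that(1) vector_field_onD(2)[OF assms(1) that] vector_field_onD(2)[OF assms(2) that]])
qed (intro tangent_add vector_field_onD(1)[OF assms(1)] vector_field_onD(1)[OF assms(2)])

lemma vector_field_scale:
  assumes "vector_field_on A U X" "smooth_fun_on A U a"
  shows "vector_field_on A U (\<lambda>q. a q *\<^sub>t X q)"
proof (rule vector_field_onI)
  show "smooth_fun_on A W (\<lambda>q. (a q *\<^sub>t X q) f)"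
    if "open W" "W \<subseteq> U" "smooth_fun_on A W f" for W f
    unfolding tv_scale_def
    by (rule smooth_mult[OF that(1) smooth_fun_on_subset[OF assms(2) that(2)] vector_field_onD(2)[OF assms(1) that]])
qed (intro tangent_scale vector_field_onD(1)[OF assms(1)])

lemma vector_field_diff:
  assumes "vector_field_on A U X" "vector_field_on A U Y"
  shows "vector_field_on A U (\<lambda>q. X q -\<^sub>t Y q)"
  by (rule vector_field_on_cong[OF vector_field_add[OF assms(1) vector_field_scale[OF assms(2)
          smooth_const[of _ "-1"]]]])
    (simp add: tv_add_def tv_diff_def tv_scale_def)

lemma vector_field_zero: "vector_field_on A U (\<lambda>q f. 0)"
  by (rule vector_field_onI) (simp_all add: tangent_zero)

text \<open>Smoothness is demanded in every chart \<open>d\<close>, where the derivative taken in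
  \<open>c\<close> appears composed with the transition map.\<close>

lemma vector_field_chart_dir:
  assumes "(U, c) \<in> A"
  shows "vector_field_on A U (\<lambda>q. chart_dir A (U, c) q v)"
proof (rule vector_field_onI)
  fix W f assume W: "open W" "W \<subseteq> U" "smooth_fun_on A W f"
  show "smooth_fun_on A W (\<lambda>q. chart_dir A (U, c) q v f)"
  proof (rule smooth_fun_onI)
    fix V d k assume V: "(V, d) \<in> A"
    let ?F = "\<lambda>x. frechet_derivative (\<lambda>x. f (inv_into U c x)) (at x) v"
    have F: "Ck_on k (c ` (U \<inter> W)) ?F"
      using smooth_fun_onD[OF W(3) assms, of "Suc k"] unfolding Ck_on.simps by (elim conjE) (rule spec)
    have t: "Ck_on k (d ` (V \<inter> W)) (\<lambda>x. c (inv_into V d x))"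
      by (rule Ck_on_subset[OF Ck_transition[OF assms V]]) (use W in auto)
    have "(\<lambda>x. c (inv_into V d x)) ` d ` (V \<inter> W) \<subseteq> c ` (U \<inter> W)"
      using inv_chart[OF V] subsetD[OF W(2)] by auto
    from Ck_on_compose[OF open_chart_image[OF V W(1)] open_chart_image[OF assms W(1)] this F t]
    show "Ck_on k (d ` (V \<inter> W)) (\<lambda>x. chart_dir A (U, c) (inv_into V d x) v f)"
    proof (rule Ck_on_cong[OF open_chart_image[OF V W(1)], rotated])
      fix x assume "x \<in> d ` (V \<inter> W)"
      then obtain q where q: "q \<in> V" "q \<in> W" "x = d q" by blast
      from frechet_derivative_eqI[OF chart_dir_has_derivative[OF assms subsetD[OF W(2) q(2)] W(1) q(2) W(3)]]
      show "?F (c (inv_into V d x)) = chart_dir A (U, c) (inv_into V d x) v f"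
        using q(3) inv_chart[OF V q(1)] by simp
    qed
  qed
qed (rule chart_dir_in_tangent[OF assms])

text \<open>The coordinate field with constant components \<open>v\<close> is an extension, so the
  choice in \<open>local_ext\<close> has a witness.\<close>

lemma local_ext:
  assumes "u \<in> tangent_space A p"
  obtains V where "open V" "p \<in> V" "vector_field_on A V (local_ext A p u)" "local_ext A p u p = u"
proof -
  obtain U c v where U: "(U, c) \<in> A" "p \<in> U" "u = chart_dir A (U, c) p v"
    using tangent_spaceE[OF assms(1)] .
  have "\<exists>X V. open V \<and> p \<in> V \<and> vector_field_on A V X \<and> X p = u"
    using vector_field_chart_dir[OF U(1)] chartD(1)[OF U(1)] U by metis
  then have "\<exists>V. open V \<and> p \<in> V \<and> vector_field_on A V (local_ext A p u) \<and> local_ext A p u p = u"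
    unfolding local_ext_def by (rule someI_ex)
  with that show ?thesis by blast
qed

end

section \<open>Tensoriality, traces and the Levi-Civita connection\<close>

text \<open>Fields are total functions that are smooth on some open set only, so dependence on the
  germ at p has to be a clause of its own.\<close>

definition tensorial_at ::
  "('m::topological_space, 'n::finite) chart set \<Rightarrow> 'm \<Rightarrow> ('m vfield \<Rightarrow> real) \<Rightarrow> bool" where
  "tensorial_at A p T \<longleftrightarrow>
     (\<forall>V X X'. open V \<longrightarrow> p \<in> V \<longrightarrow> vector_field_on A V X \<longrightarrow> (\<forall>q\<in>V. X' q = X q) \<longrightarrow> T X' = T X) \<and>
     (\<forall>V X Y. open V \<longrightarrow> p \<in> V \<longrightarrow> vector_field_on A V X \<longrightarrow> vector_field_on A V Y \<longrightarrow>
        T (\<lambda>q. X q +\<^sub>t Y q) = T X + T Y) \<and>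
     (\<forall>V X a. open V \<longrightarrow> p \<in> V \<longrightarrow> vector_field_on A V X \<longrightarrow> smooth_fun_on A V a \<longrightarrow>
        T (\<lambda>q. a q *\<^sub>t X q) = a p * T X)"

text \<open>Real valued; a linear map into the tangent space is treated by evaluating it on one test
  function at a time.\<close>

definition linear_at ::
  "('m::topological_space, 'n::finite) chart set \<Rightarrow> 'm \<Rightarrow> ('m tvec \<Rightarrow> real) \<Rightarrow> bool" where
  "linear_at A p F \<longleftrightarrow> (\<forall>u\<in>tangent_space A p. \<forall>v\<in>tangent_space A p. \<forall>a b.
     F (a *\<^sub>t u +\<^sub>t b *\<^sub>t v) = a * F u + b * F v)"

context smooth_mfd
begin

lemma vector_field_sum:
  assumes "open V" "\<And>i. i \<in> I \<Longrightarrow> vector_field_on A V (X i)" "\<And>i. i \<in> I \<Longrightarrow> smooth_fun_on A V (a i)"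
  shows "vector_field_on A V (\<lambda>q f. \<Sum>i\<in>I. a i q * X i q f)"
  using assms(2,3)
proof (induction I rule: infinite_finite_induct)
  case (insert i I)
  have "vector_field_on A V (\<lambda>q. a i q *\<^sub>t X i q +\<^sub>t (\<lambda>f. \<Sum>i\<in>I. a i q * X i q f))"
    by (intro vector_field_add vector_field_scale insert) auto
  with insert show ?case by (simp add: tv_add_def tv_scale_def)
qed (auto simp: vector_field_zero)

lemma tensorialD:
  assumes "tensorial_at A p T" "open V" "p \<in> V" "vector_field_on A V X"
  shows "(\<And>q. q \<in> V \<Longrightarrow> X' q = X q) \<Longrightarrow> T X' = T X"
    and "vector_field_on A V Y \<Longrightarrow> T (\<lambda>q. X q +\<^sub>t Y q) = T X + T Y"
    and "smooth_fun_on A V a \<Longrightarrow> T (\<lambda>q. a q *\<^sub>t X q) = a p * T X"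
proof -
  note T = assms(1)[unfolded tensorial_at_def]
  show "(\<And>q. q \<in> V \<Longrightarrow> X' q = X q) \<Longrightarrow> T X' = T X"
    by (rule T[THEN conjunct1, rule_format, OF assms(2-4)])
  show "vector_field_on A V Y \<Longrightarrow> T (\<lambda>q. X q +\<^sub>t Y q) = T X + T Y"
    by (rule T[THEN conjunct2, THEN conjunct1, rule_format, OF assms(2-4)])
  show "smooth_fun_on A V a \<Longrightarrow> T (\<lambda>q. a q *\<^sub>t X q) = a p * T X"
    by (rule T[THEN conjunct2, THEN conjunct2, rule_format, OF assms(2-4)])
qed

lemma tensorial_zero:
  assumes "tensorial_at A p T"
  shows "T (\<lambda>q f. 0) = 0"
  using tensorialD(3)[OF assms open_UNIV UNIV_I vector_field_zero smooth_const[of _ 0]]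
  by (simp add: tv_scale_def)

lemma tensorial_sum:
  assumes "tensorial_at A p T" "open V" "p \<in> V"
    and "\<And>i. i \<in> I \<Longrightarrow> vector_field_on A V (X i)" "\<And>i. i \<in> I \<Longrightarrow> smooth_fun_on A V (a i)"
  shows "T (\<lambda>q f. \<Sum>i\<in>I. a i q * X i q f) = (\<Sum>i\<in>I. a i p * T (X i))"
  using assms(4,5)
proof (induction I rule: infinite_finite_induct)
  case (insert i I)
  have "T (\<lambda>q. a i q *\<^sub>t X i q +\<^sub>t (\<lambda>f. \<Sum>i\<in>I. a i q * X i q f)) =
      T (\<lambda>q. a i q *\<^sub>t X i q) + T (\<lambda>q f. \<Sum>i\<in>I. a i q * X i q f)"
    by (rule tensorialD(2)[OF assms(1-3)]) (intro vector_field_scale vector_field_sum insert assms(2); simp)+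
  also have "T (\<lambda>q. a i q *\<^sub>t X i q) = a i p * T (X i)"
    by (rule tensorialD(3)[OF assms(1-3)]) (intro insert; simp)+
  finally show ?case using insert by (simp add: tv_add_def tv_scale_def)
qed (use tensorial_zero[OF assms(1)] in simp_all)

text \<open>Near \<open>p\<close> a field is a combination of the coordinate fields whose coefficients are its
  values on the coordinate functions.\<close>

lemma tensorial_eqI:
  assumes "tensorial_at A p T" "open V" "p \<in> V" "vector_field_on A V X" "vector_field_on A V Y"
    and "X p = Y p"
  shows "T X = T Y"
proof -
  obtain U c where U: "(U, c) \<in> A" "p \<in> U" using ex_chart by blast
  have VU: "open (V \<inter> U)" "p \<in> V \<inter> U" using assms(2,3) chartD(1)[OF U(1)] U(2) by auto
  have *: "T Z = (\<Sum>i\<in>UNIV. Z p (\<lambda>q. c q $ i) * T (\<lambda>q. chart_dir A (U, c) q (axis i 1)))"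
    if Z: "vector_field_on A V Z" for Z
  proof -
    have d: "vector_field_on A (V \<inter> U) (\<lambda>q. chart_dir A (U, c) q (axis i 1))" for i
      by (rule vector_field_on_subset[OF vector_field_chart_dir[OF U(1)]]) simp
    have s: "smooth_fun_on A (V \<inter> U) (\<lambda>q. Z q (\<lambda>q. c q $ i))" for i
      by (rule vector_field_onD(2)[OF Z VU(1) Int_lower1 smooth_fun_on_subset[OF smooth_coordinate[OF U(1)] Int_lower2]])
    have Z': "vector_field_on A (V \<inter> U) Z" by (rule vector_field_on_subset[OF Z Int_lower1])
    have "T (\<lambda>q f. \<Sum>i\<in>UNIV. Z q (\<lambda>q. c q $ i) * chart_dir A (U, c) q (axis i 1) f) = T Z"
    proof (rule tensorialD(1)[OF assms(1) VU Z'])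
      fix q assume "q \<in> V \<inter> U"
      then show "(\<lambda>f. \<Sum>i\<in>UNIV. Z q (\<lambda>q. c q $ i) * chart_dir A (U, c) q (axis i 1) f) = Z q"
        by (intro ext tangent_expand[OF U(1) _ vector_field_onD(1)[OF Z], symmetric]) auto
    qed
    moreover have "T (\<lambda>q f. \<Sum>i\<in>UNIV. Z q (\<lambda>q. c q $ i) * chart_dir A (U, c) q (axis i 1) f) =
        (\<Sum>i\<in>UNIV. Z p (\<lambda>q. c q $ i) * T (\<lambda>q. chart_dir A (U, c) q (axis i 1)))"
      by (rule tensorial_sum[OF assms(1) VU d s])
    ultimately show ?thesis by simp
  qed
  show ?thesis using *[OF assms(4)] *[OF assms(5)] assms(6) by simp
qed

text \<open>This makes the definitions through \<open>local_ext\<close> computable: the chosen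
  extension may be replaced by any smooth field with the same value at p.\<close>

lemma tensorial_local_ext:
  assumes "tensorial_at A p T" "open V" "p \<in> V" "vector_field_on A V X" "u = X p"
  shows "T (local_ext A p u) = T X"
proof -
  have "u \<in> tangent_space A p" using vector_field_onD(1)[OF assms(4,3)] assms(5) by simp
  from local_ext[OF this] obtain W where W:
    "open W" "p \<in> W" "vector_field_on A W (local_ext A p u)" "local_ext A p u p = u" .
  have "open (V \<inter> W)" "p \<in> V \<inter> W" using assms(2,3) W by auto
  from tensorial_eqI[OF assms(1) this vector_field_on_subset[OF W(3) Int_lower2]
      vector_field_on_subset[OF assms(4) Int_lower1]] show ?thesis
    using W(4) assms(5) by simp
qed

lemma tensorial_linear_at:
  assumes "tensorial_at A p T"
  shows "linear_at A p (\<lambda>u. T (local_ext A p u))"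
  unfolding linear_at_def
proof (intro ballI allI)
  fix u v a b assume u: "u \<in> tangent_space A p" and v: "v \<in> tangent_space A p"
  obtain V where V: "open V" "p \<in> V" "vector_field_on A V (local_ext A p u)" "local_ext A p u p = u"
    by (rule local_ext[OF u])
  obtain W where W: "open W" "p \<in> W" "vector_field_on A W (local_ext A p v)" "local_ext A p v p = v"
    by (rule local_ext[OF v])
  have o: "open (V \<inter> W)" "p \<in> V \<inter> W" using V W by auto
  note V' = vector_field_on_subset[OF V(3) Int_lower1, of W]
  note W' = vector_field_on_subset[OF W(3) Int_lower2, of V]
  note aV = vector_field_scale[OF V' smooth_const, of a]
  note bW = vector_field_scale[OF W' smooth_const, of b]
  let ?Z = "\<lambda>q. a *\<^sub>t local_ext A p u q +\<^sub>t b *\<^sub>t local_ext A p v q"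
  have "T (local_ext A p (a *\<^sub>t u +\<^sub>t b *\<^sub>t v)) = T ?Z"
    by (rule tensorial_local_ext[OF assms o vector_field_add[OF aV bW]]) (simp add: V W)
  also have "\<dots> = T (\<lambda>q. a *\<^sub>t local_ext A p u q) + T (\<lambda>q. b *\<^sub>t local_ext A p v q)"
    by (rule tensorialD(2)[OF assms o aV bW])
  also have "\<dots> = a * T (local_ext A p u) + b * T (local_ext A p v)"
    using tensorialD(3)[OF assms o V' smooth_const] tensorialD(3)[OF assms o W' smooth_const] by simp
  finally show "T (local_ext A p (a *\<^sub>t u +\<^sub>t b *\<^sub>t v)) = a * T (local_ext A p u) + b * T (local_ext A p v)" .
qed

lemma linear_atD:
  "linear_at A p F \<Longrightarrow> u \<in> tangent_space A p \<Longrightarrow> v \<in> tangent_space A p \<Longrightarrow>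
    F (a *\<^sub>t u +\<^sub>t b *\<^sub>t v) = a * F u + b * F v"
  unfolding linear_at_def by simp

lemma linear_at_sum:
  assumes "linear_at A p F" "\<And>i. i \<in> I \<Longrightarrow> u i \<in> tangent_space A p"
  shows "F (\<lambda>f. \<Sum>i\<in>I. a i * u i f) = (\<Sum>i\<in>I. a i * F (u i))"
proof -
  have z: "F (\<lambda>f. 0) = 0"
    using linear_atD[OF assms(1) tangent_zero tangent_zero, of 0 0] by (simp add: tv_add_def tv_scale_def)
  show ?thesis using assms(2)
  proof (induction I rule: infinite_finite_induct)
    case (insert i I)
    have "F (a i *\<^sub>t u i +\<^sub>t 1 *\<^sub>t (\<lambda>f. \<Sum>i\<in>I. a i * u i f)) = a i * F (u i) + 1 * F (\<lambda>f. \<Sum>i\<in>I. a i * u i f)"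
      by (rule linear_atD[OF assms(1)]) (use insert in \<open>auto intro!: tangent_sum\<close>)
    with insert show ?case by (simp add: tv_add_def tv_scale_def)
  qed (use z in simp_all)
qed

text \<open>Basis independence of the trace. Expanding the coordinate vectors in \<open>E\<close>,
  or the images of \<open>E\<close> in coordinates, leads to the same double sum in the two orders
  of summation; \<open>\<theta>\<close> is the dual frame.\<close>

lemma tangent_trace_frame:
  fixes E :: "'k::finite \<Rightarrow> 'm tvec" and \<theta> :: "'k \<Rightarrow> 'm tvec \<Rightarrow> real"
  assumes E: "\<And>k. E k \<in> tangent_space A p"
    and \<theta>: "\<And>k. linear_at A p (\<theta> k)"
    and ex: "\<And>u. u \<in> tangent_space A p \<Longrightarrow> u = (\<lambda>f. \<Sum>k\<in>UNIV. \<theta> k u * E k f)"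
    and L: "\<And>u. u \<in> tangent_space A p \<Longrightarrow> L u \<in> tangent_space A p" "\<And>f. linear_at A p (\<lambda>u. L u f)"
  shows "tangent_trace A p L = (\<Sum>k\<in>UNIV. \<theta> k (L (E k)))"
proof -
  define ch where "ch = (SOME ch. ch \<in> A \<and> p \<in> fst ch)"
  have "\<exists>ch. ch \<in> A \<and> p \<in> fst ch" using ex_chart[of p] by force
  then have "ch \<in> A \<and> p \<in> fst ch" unfolding ch_def by (rule someI_ex)
  then obtain U c where ch: "ch = (U, c)" "(U, c) \<in> A" "p \<in> U" by (cases ch) auto
  let ?d = "\<lambda>i. chart_dir A (U, c) p (axis i 1)"
  have d: "?d i \<in> tangent_space A p" for i by (rule chart_dir_in_tangent[OF ch(2,3)])
  have Ld: "L (?d i) (\<lambda>q. c q $ i) = (\<Sum>k\<in>UNIV. \<theta> k (?d i) * L (E k) (\<lambda>q. c q $ i))" for i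
  proof -
    have "L (?d i) (\<lambda>q. c q $ i) = L (\<lambda>f. \<Sum>k\<in>UNIV. \<theta> k (?d i) * E k f) (\<lambda>q. c q $ i)"
      by (rule arg_cong[OF ex[OF d]])
    also have "\<dots> = (\<Sum>k\<in>UNIV. \<theta> k (?d i) * L (E k) (\<lambda>q. c q $ i))"
      by (rule linear_at_sum[OF L(2)]) (rule E)
    finally show ?thesis .
  qed
  have \<theta>L: "(\<Sum>i\<in>UNIV. L (E k) (\<lambda>q. c q $ i) * \<theta> k (?d i)) = \<theta> k (L (E k))" for k
  proof -
    have "L (E k) = (\<lambda>f. \<Sum>i\<in>UNIV. L (E k) (\<lambda>q. c q $ i) * ?d i f)"
      by (rule ext) (rule tangent_expand[OF ch(2,3) L(1)[OF E]])
    then have "\<theta> k (L (E k)) = \<theta> k (\<lambda>f. \<Sum>i\<in>UNIV. L (E k) (\<lambda>q. c q $ i) * ?d i f)"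
      by (rule arg_cong)
    also have "\<dots> = (\<Sum>i\<in>UNIV. L (E k) (\<lambda>q. c q $ i) * \<theta> k (?d i))"
      by (rule linear_at_sum[OF \<theta>]) (rule d)
    finally show ?thesis ..
  qed
  have "tangent_trace A p L = (\<Sum>i\<in>UNIV. \<Sum>k\<in>UNIV. \<theta> k (?d i) * L (E k) (\<lambda>q. c q $ i))"
    unfolding tangent_trace_def ch_def[symmetric] Let_def ch(1) snd_conv by (simp only: Ld)
  also have "\<dots> = (\<Sum>k\<in>UNIV. \<Sum>i\<in>UNIV. L (E k) (\<lambda>q. c q $ i) * \<theta> k (?d i))"
    by (subst sum.swap) (simp add: mult.commute)
  finally show ?thesis by (simp add: \<theta>L)
qed

end

text \<open>Used for two metrics on the same manifold, the Riemannian one and the indefinite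
  paracontact one.\<close>

locale levi_civita_mfd = smooth_mfd A
  for A :: "('m::{t2_space, second_countable_topology}, 'n::finite) chart set" +
  fixes g :: "'m form2" and D :: "'m vfield \<Rightarrow> 'm vfield \<Rightarrow> 'm vfield"
  assumes lc: "levi_civita A g D"
begin

lemma D_vector_field:
  "open U \<Longrightarrow> vector_field_on A U X \<Longrightarrow> vector_field_on A U Y \<Longrightarrow> vector_field_on A U (D X Y)"
proof -
  have "\<forall>U X Y. open U \<and> vector_field_on A U X \<and> vector_field_on A U Y \<longrightarrow>
        vector_field_on A U (D X Y)"
    using lc unfolding levi_civita_def affine_connection_def by (elim conjE)
  then show "open U \<Longrightarrow> vector_field_on A U X \<Longrightarrow> vector_field_on A U Y \<Longrightarrow> vector_field_on A U (D X Y)"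
    by metis
qed

lemma D_cong:
  assumes "open U" "vector_field_on A U X" "vector_field_on A U Y" "p \<in> U"
    and "\<And>q. q \<in> U \<Longrightarrow> X' q = X q" "\<And>q. q \<in> U \<Longrightarrow> Y' q = Y q"
  shows "D X' Y' p = D X Y p"
proof -
  have "\<forall>U X Y X' Y'. open U \<and> vector_field_on A U X \<and> vector_field_on A U Y \<and>
        (\<forall>q\<in>U. X' q = X q) \<and> (\<forall>q\<in>U. Y' q = Y q) \<longrightarrow> (\<forall>p\<in>U. D X' Y' p = D X Y p)"
    using lc unfolding levi_civita_def affine_connection_def by (elim conjE)
  from this[rule_format, of U X Y X' Y' p] show ?thesis using assms by simp
qed

lemma D_rules:
  assumes "open U" "p \<in> U" "vector_field_on A U X" "vector_field_on A U Y" "vector_field_on A U Z"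
    and "smooth_fun_on A U a"
  shows "D (\<lambda>q. X q +\<^sub>t Y q) Z p = D X Z p +\<^sub>t D Y Z p"
    and "D (\<lambda>q. a q *\<^sub>t X q) Z p = a p *\<^sub>t D X Z p"
    and "D X (\<lambda>q. Y q +\<^sub>t Z q) p = D X Y p +\<^sub>t D X Z p"
    and "D X (\<lambda>q. a q *\<^sub>t Y q) p = X p a *\<^sub>t Y p +\<^sub>t a p *\<^sub>t D X Y p"
proof -
  have "\<forall>U X Y Z a. open U \<and> vector_field_on A U X \<and> vector_field_on A U Y \<and>
        vector_field_on A U Z \<and> smooth_fun_on A U a \<longrightarrow>
        (\<forall>p\<in>U.
           D (\<lambda>q. X q +\<^sub>t Y q) Z p = D X Z p +\<^sub>t D Y Z p \<and>
           D (\<lambda>q. a q *\<^sub>t X q) Z p = a p *\<^sub>t D X Z p \<and>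
           D X (\<lambda>q. Y q +\<^sub>t Z q) p = D X Y p +\<^sub>t D X Z p \<and>
           D X (\<lambda>q. a q *\<^sub>t Y q) p = X p a *\<^sub>t Y p +\<^sub>t a p *\<^sub>t D X Y p)"
    using lc unfolding levi_civita_def affine_connection_def by (elim conjE)
  from this[rule_format, of U X Y Z a p]
  show "D (\<lambda>q. X q +\<^sub>t Y q) Z p = D X Z p +\<^sub>t D Y Z p"
    "D (\<lambda>q. a q *\<^sub>t X q) Z p = a p *\<^sub>t D X Z p"
    "D X (\<lambda>q. Y q +\<^sub>t Z q) p = D X Y p +\<^sub>t D X Z p"
    "D X (\<lambda>q. a q *\<^sub>t Y q) p = X p a *\<^sub>t Y p +\<^sub>t a p *\<^sub>t D X Y p"
    using assms by simp_all
qed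

lemma torsion_free:
  assumes "open U" "p \<in> U" "vector_field_on A U X" "vector_field_on A U Y"
  shows "lie_bracket A X Y p = D X Y p -\<^sub>t D Y X p"
proof -
  have "\<forall>U X Y. open U \<and> vector_field_on A U X \<and> vector_field_on A U Y \<longrightarrow>
        (\<forall>p\<in>U. D X Y p -\<^sub>t D Y X p = lie_bracket A X Y p)"
    using lc unfolding levi_civita_def by (elim conjE)
  from this[rule_format, of U X Y p] show ?thesis using assms by simp
qed

lemma metric_compatible:
  assumes "open U" "p \<in> U" "vector_field_on A U X" "vector_field_on A U Y" "vector_field_on A U Z"
  shows "X p (\<lambda>q. g q (Y q) (Z q)) = g p (D X Y p) (Z p) + g p (Y p) (D X Z p)"
proof -
  have "\<forall>U X Y Z. open U \<and> vector_field_on A U X \<and> vector_field_on A U Y \<and>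
        vector_field_on A U Z \<longrightarrow>
        (\<forall>p\<in>U. X p (\<lambda>q. g q (Y q) (Z q)) = g p (D X Y p) (Z p) + g p (Y p) (D X Z p))"
    using lc unfolding levi_civita_def by (elim conjE)
  from this[rule_format, of U X Y Z p] show ?thesis using assms by simp
qed

text \<open>Torsion-freeness yields smoothness of the bracket, so that no symmetry of second derivatives
  has to be proved.\<close>

lemma lie_vector_field:
  assumes "open U" "vector_field_on A U X" "vector_field_on A U Y"
  shows "vector_field_on A U (lie_bracket A X Y)"
  by (rule vector_field_on_cong[OF vector_field_diff[OF D_vector_field[OF assms]
          D_vector_field[OF assms(1,3,2)]]])
    (rule torsion_free[OF assms(1) _ assms(2,3), symmetric])

lemma lie_add_left:
  assumes "open U" "p \<in> U" "vector_field_on A U X" "vector_field_on A U X'" "vector_field_on A U Y"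
  shows "lie_bracket A (\<lambda>q. X q +\<^sub>t X' q) Y p = lie_bracket A X Y p +\<^sub>t lie_bracket A X' Y p"
  unfolding torsion_free[OF assms(1-3,5)] torsion_free[OF assms(1,2,4,5)]
    torsion_free[OF assms(1,2) vector_field_add[OF assms(3,4)] assms(5)]
    D_rules(1)[OF assms(1-5) smooth_const] D_rules(3)[OF assms(1,2,5,3,4) smooth_const]
  by (rule ext) (simp add: tv_add_def tv_diff_def)

lemma lie_scale_left:
  assumes "open U" "p \<in> U" "vector_field_on A U X" "vector_field_on A U Y" "smooth_fun_on A U a"
  shows "lie_bracket A (\<lambda>q. a q *\<^sub>t X q) Y p = a p *\<^sub>t lie_bracket A X Y p -\<^sub>t Y p a *\<^sub>t X p"
  unfolding torsion_free[OF assms(1-4)]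
    torsion_free[OF assms(1,2) vector_field_scale[OF assms(3,5)] assms(4)]
    D_rules(2)[OF assms(1-3) assms(3) assms(4,5)] D_rules(4)[OF assms(1,2,4,3,3,5)]
  by (rule ext) (simp add: tv_add_def tv_diff_def tv_scale_def algebra_simps)

lemma lie_antisym:
  assumes "open U" "p \<in> U" "vector_field_on A U X" "vector_field_on A U Y"
  shows "lie_bracket A Y X p = (-1) *\<^sub>t lie_bracket A X Y p"
  unfolding torsion_free[OF assms] torsion_free[OF assms(1,2,4,3)]
  by (rule ext) (simp add: tv_diff_def tv_scale_def)

lemma lie_add_right:
  assumes "open U" "p \<in> U" "vector_field_on A U X" "vector_field_on A U Y" "vector_field_on A U Z"
  shows "lie_bracket A X (\<lambda>q. Y q +\<^sub>t Z q) p = lie_bracket A X Y p +\<^sub>t lie_bracket A X Z p"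
  unfolding torsion_free[OF assms(1-4)] torsion_free[OF assms(1-3,5)]
    torsion_free[OF assms(1-3) vector_field_add[OF assms(4,5)]]
    D_rules(1)[OF assms(1,2,4,5,3) smooth_const] D_rules(3)[OF assms(1-5) smooth_const]
  by (rule ext) (simp add: tv_add_def tv_diff_def)

lemma lie_scale_right:
  assumes "open U" "p \<in> U" "vector_field_on A U X" "vector_field_on A U Y" "smooth_fun_on A U a"
  shows "lie_bracket A X (\<lambda>q. a q *\<^sub>t Y q) p = a p *\<^sub>t lie_bracket A X Y p +\<^sub>t X p a *\<^sub>t Y p"
  unfolding torsion_free[OF assms(1-4)]
    torsion_free[OF assms(1-3) vector_field_scale[OF assms(4,5)]]
    D_rules(2)[OF assms(1,2,4,4,3,5)] D_rules(4)[OF assms(1,2,3,4,4,5)]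
  by (rule ext) (simp add: tv_add_def tv_diff_def tv_scale_def algebra_simps)

lemma lie_cong_right:
  assumes "open U" "p \<in> U" "vector_field_on A U X" "vector_field_on A U Y" "\<And>q. q \<in> U \<Longrightarrow> Y' q = Y q"
  shows "lie_bracket A X Y' p = lie_bracket A X Y p"
proof -
  note Y' = vector_field_on_cong[OF assms(4) assms(5)[symmetric]]
  have "D X Y' p = D X Y p" "D Y' X p = D Y X p"
    by (rule D_cong[OF assms(1,3,4,2) refl assms(5)], assumption)
      (rule D_cong[OF assms(1,4,3,2) assms(5) refl], assumption)
  then show ?thesis by (simp only: torsion_free[OF assms(1-4)] torsion_free[OF assms(1-3) Y'])
qed

text \<open>Each nested bracket expands into third-order terms such as X(Y(Z f)), and these cancel
  in the cyclic sum. If \<open>f\<close> is not smooth near p, every bracket is 0 by its default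
  value.\<close>

lemma jacobi:
  assumes "open U" "p \<in> U" "vector_field_on A U X" "vector_field_on A U Y" "vector_field_on A U Z"
  shows "lie_bracket A (lie_bracket A X Y) Z p f + lie_bracket A (lie_bracket A Y Z) X p f +
    lie_bracket A (lie_bracket A Z X) Y p f = 0"
proof (cases "smooth_fun_near A p f")
  case True
  then obtain V where V: "open V" "p \<in> V" "smooth_fun_on A V f"
    unfolding smooth_fun_near_def by auto
  define W where "W = V \<inter> U"
  have W: "open W" "p \<in> W" "W \<subseteq> U" "smooth_fun_on A W f"
    using V assms(1,2) smooth_fun_on_subset[OF V(3)] by (auto simp: W_def)
  have *: "lie_bracket A (lie_bracket A X Y) Z p f = X p (\<lambda>q. Y q (\<lambda>q. Z q f)) - Y p (\<lambda>q. X q (\<lambda>q. Z q f))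
      - (Z p (\<lambda>q. X q (\<lambda>q. Y q f)) - Z p (\<lambda>q. Y q (\<lambda>q. X q f)))"
    if X: "vector_field_on A U X" and Y: "vector_field_on A U Y" and Z: "vector_field_on A U Z" for X Y Z
  proof -
    note Zf = vector_field_onD(2)[OF Z W(1,3,4)]
    have near: "smooth_fun_near A q h" if "q \<in> W" "smooth_fun_on A W h" for q h
      using that W(1) unfolding smooth_fun_near_def by auto
    have "Z p (\<lambda>q. lie_bracket A X Y q f) = Z p (\<lambda>q. X q (\<lambda>q. Y q f) - Y q (\<lambda>q. X q f))"
      by (rule tv_cong[OF vector_field_onD(1)[OF Z assms(2)] W(1,2)]) (simp add: lie_bracket_def near W(4))
    also have "\<dots> = Z p (\<lambda>q. X q (\<lambda>q. Y q f)) - Z p (\<lambda>q. Y q (\<lambda>q. X q f))"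
      by (rule tv_diff_fun[OF vector_field_onD(1)[OF Z assms(2)] W(1,2)])
        (intro vector_field_onD(2)[OF X W(1,3)] vector_field_onD(2)[OF Y W(1,3)] W(4))+
    finally show ?thesis
      using near[OF W(2) Zf] near[OF W(2,4)] by (simp add: lie_bracket_def)
  qed
  show ?thesis using *[OF assms(3,4,5)] *[OF assms(4,5,3)] *[OF assms(5,3,4)] by simp
qed (simp add: lie_bracket_def)

text \<open>Curvature of fields instead of vectors, without chosen extensions, so that it can be
  computed from tables of \<open>D\<close>; \<open>curvature_eq_curv\<close> connects the
  two.\<close>

definition curv :: "'m vfield \<Rightarrow> 'm vfield \<Rightarrow> 'm vfield \<Rightarrow> 'm vfield" where
  "curv X Y Z p = D X (D Y Z) p -\<^sub>t D Y (D X Z) p -\<^sub>t D (lie_bracket A X Y) Z p"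

text \<open>It also carries tensoriality over from the first argument to the second.\<close>

lemma curv_antisym:
  assumes "open U" "p \<in> U" "vector_field_on A U X" "vector_field_on A U Y" "vector_field_on A U Z"
  shows "curv Y X Z p f = - curv X Y Z p f"
proof -
  note l = lie_vector_field[OF assms(1,3,4)]
  have "D (lie_bracket A Y X) Z p = D (\<lambda>q. (-1) *\<^sub>t lie_bracket A X Y q) Z p"
    by (rule D_cong[OF assms(1) vector_field_scale[OF l smooth_const] assms(5,2)])
      (simp_all add: lie_antisym[OF assms(1) _ assms(3,4)])
  also have "\<dots> = (-1) *\<^sub>t D (lie_bracket A X Y) Z p"
    by (rule D_rules(2)[OF assms(1,2) l l assms(5) smooth_const])
  finally show ?thesis by (simp add: curv_def tv_diff_def tv_scale_def)
qed

lemma D_tensorial: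
  assumes "open U" "p \<in> U" "vector_field_on A U Z"
  shows "tensorial_at A p (\<lambda>X. D X Z p f)"
  unfolding tensorial_at_def
proof (intro conjI allI impI)
  fix V X X' assume V: "open V" "p \<in> V" "vector_field_on A V X" "\<forall>q\<in>V. X' q = X q"
  have o: "open (V \<inter> U)" "p \<in> V \<inter> U" using V assms by auto
  show "D X' Z p f = D X Z p f"
    using D_cong[OF o(1) vector_field_on_subset[OF V(3) Int_lower1]
        vector_field_on_subset[OF assms(3) Int_lower2] o(2), of X' Z] V(4) by simp
next
  fix V X Y assume V: "open V" "p \<in> V" "vector_field_on A V X" "vector_field_on A V Y"
  have o: "open (V \<inter> U)" "p \<in> V \<inter> U" using V assms by auto
  show "D (\<lambda>q. X q +\<^sub>t Y q) Z p f = D X Z p f + D Y Z p f"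
    using D_rules(1)[OF o vector_field_on_subset[OF V(3) Int_lower1] vector_field_on_subset[OF V(4) Int_lower1]
        vector_field_on_subset[OF assms(3) Int_lower2] smooth_const] by (simp add: tv_add_def)
next
  fix V X a assume V: "open V" "p \<in> V" "vector_field_on A V X" "smooth_fun_on A V a"
  have o: "open (V \<inter> U)" "p \<in> V \<inter> U" using V assms by auto
  note X = vector_field_on_subset[OF V(3) Int_lower1]
  show "D (\<lambda>q. a q *\<^sub>t X q) Z p f = a p * D X Z p f"
    using D_rules(2)[OF o X X
        vector_field_on_subset[OF assms(3) Int_lower2] smooth_fun_on_subset[OF V(4) Int_lower1]] by (simp add: tv_scale_def)
qed

lemma D_cong_left:
  assumes "open U" "p \<in> U" "vector_field_on A U Z" "vector_field_on A U X" "vector_field_on A U Y" "X p = Y p"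
  shows "D X Z p = D Y Z p"
  by (rule ext) (rule tensorial_eqI[OF D_tensorial[OF assms(1-3)] assms(1,2,4-6)])

lemma curv_cong:
  assumes "open U" "p \<in> U" "vector_field_on A U X" "vector_field_on A U Y" "vector_field_on A U Z"
    and "\<And>q. q \<in> U \<Longrightarrow> X' q = X q" "\<And>q. q \<in> U \<Longrightarrow> Y' q = Y q" "\<And>q. q \<in> U \<Longrightarrow> Z' q = Z q"
  shows "curv X' Y' Z' p = curv X Y Z p"
proof -
  note X' = vector_field_on_cong[OF assms(3) assms(6)[symmetric]]
  note Y' = vector_field_on_cong[OF assms(4) assms(7)[symmetric]]
  note Z' = vector_field_on_cong[OF assms(5) assms(8)[symmetric]]
  have DY: "D Y' Z' q = D Y Z q" if "q \<in> U" for q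
    by (rule D_cong[OF assms(1,4,5) that]) (erule assms)+
  have DX: "D X' Z' q = D X Z q" if "q \<in> U" for q
    by (rule D_cong[OF assms(1,3,5) that]) (erule assms)+
  have 1: "D X' (D Y' Z') p = D X (D Y Z) p"
    by (rule D_cong[OF assms(1,3) D_vector_field[OF assms(1,4,5)] assms(2)]) (erule assms DY)+
  have 2: "D Y' (D X' Z') p = D Y (D X Z) p"
    by (rule D_cong[OF assms(1,4) D_vector_field[OF assms(1,3,5)] assms(2)]) (erule assms DX)+
  have l: "lie_bracket A X' Y' q = lie_bracket A X Y q" if q: "q \<in> U" for q
  proof -
    have "D X' Y' q = D X Y q" by (rule D_cong[OF assms(1,3,4) q]) (erule assms)+
    moreover have "D Y' X' q = D Y X q" by (rule D_cong[OF assms(1,4,3) q]) (erule assms)+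
    ultimately show ?thesis
      by (simp only: torsion_free[OF assms(1) q assms(3,4)] torsion_free[OF assms(1) q X' Y'])
  qed
  have 3: "D (lie_bracket A X' Y') Z' p = D (lie_bracket A X Y) Z p"
    by (rule D_cong[OF assms(1) lie_vector_field[OF assms(1,3,4)] assms(5,2)]) (erule l assms)+
  show ?thesis unfolding curv_def 1 2 3 ..
qed

lemma curv_add_left:
  assumes "open U" "p \<in> U" "vector_field_on A U X" "vector_field_on A U X'" "vector_field_on A U Y" "vector_field_on A U Z"
  shows "curv (\<lambda>q. X q +\<^sub>t X' q) Y Z p f = curv X Y Z p f + curv X' Y Z p f"
proof -
  note U = assms(1) and p = assms(2) and X = assms(3) and X' = assms(4) and Y = assms(5) and Z = assms(6)
  note DYZ = D_vector_field[OF U Y Z] and DXZ = D_vector_field[OF U X Z] and DXZ' = D_vector_field[OF U X' Z]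
  note lX = lie_vector_field[OF U X Y] and lX' = lie_vector_field[OF U X' Y]
  have "D Y (D (\<lambda>q. X q +\<^sub>t X' q) Z) p = D Y (\<lambda>q. D X Z q +\<^sub>t D X' Z q) p"
    by (rule D_cong[OF U Y vector_field_add[OF DXZ DXZ'] p refl])
      (rule D_rules(1)[OF U _ X X' Z smooth_const])
  also have "\<dots> = D Y (D X Z) p +\<^sub>t D Y (D X' Z) p"
    by (rule D_rules(3)[OF U p Y DXZ DXZ' smooth_const])
  finally have 2: "D Y (D (\<lambda>q. X q +\<^sub>t X' q) Z) p = \<dots>" .
  have "D (lie_bracket A (\<lambda>q. X q +\<^sub>t X' q) Y) Z p = D (\<lambda>q. lie_bracket A X Y q +\<^sub>t lie_bracket A X' Y q) Z p"
    by (rule D_cong[OF U vector_field_add[OF lX lX'] Z p _ refl]) (rule lie_add_left[OF U _ X X' Y])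
  also have "\<dots> = D (lie_bracket A X Y) Z p +\<^sub>t D (lie_bracket A X' Y) Z p"
    by (rule D_rules(1)[OF U p lX lX' Z smooth_const])
  finally have 3: "D (lie_bracket A (\<lambda>q. X q +\<^sub>t X' q) Y) Z p = \<dots>" .
  show ?thesis unfolding curv_def 2 3 D_rules(1)[OF U p X X' DYZ smooth_const]
    by (simp add: tv_add_def tv_diff_def)
qed

text \<open>Differentiating \<open>a\<close> along \<open>Y\<close> produces Y(a) D_X Z, and this
  cancels against the correction term in [a X, Y] = a [X, Y] - Y(a) X.\<close>

lemma curv_scale_left:
  assumes "open U" "p \<in> U" "vector_field_on A U X" "vector_field_on A U Y" "vector_field_on A U Z" "smooth_fun_on A U a"
  shows "curv (\<lambda>q. a q *\<^sub>t X q) Y Z p f = a p * curv X Y Z p f"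
proof -
  note U = assms(1) and p = assms(2) and X = assms(3) and Y = assms(4) and Z = assms(5) and a = assms(6)
  note DYZ = D_vector_field[OF U Y Z] and DXZ = D_vector_field[OF U X Z]
  note lX = lie_vector_field[OF U X Y]
  note Ya = vector_field_onD(2)[OF Y U order_refl a]
  have "D Y (D (\<lambda>q. a q *\<^sub>t X q) Z) p = D Y (\<lambda>q. a q *\<^sub>t D X Z q) p"
    by (rule D_cong[OF U Y vector_field_scale[OF DXZ a] p refl])
      (rule D_rules(2)[OF U _ X X Z a])
  also have "\<dots> = Y p a *\<^sub>t D X Z p +\<^sub>t a p *\<^sub>t D Y (D X Z) p"
    by (rule D_rules(4)[OF U p Y DXZ DXZ a])
  finally have 2: "D Y (D (\<lambda>q. a q *\<^sub>t X q) Z) p = \<dots>" .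
  have sX: "vector_field_on A U (\<lambda>q. (- Y q a) *\<^sub>t X q)" by (rule vector_field_scale[OF X smooth_minus[OF U Ya]])
  have "D (lie_bracket A (\<lambda>q. a q *\<^sub>t X q) Y) Z p = D (\<lambda>q. a q *\<^sub>t lie_bracket A X Y q +\<^sub>t (- Y q a) *\<^sub>t X q) Z p"
    by (rule D_cong[OF U vector_field_add[OF vector_field_scale[OF lX a] sX] Z p _ refl])
      (subst lie_scale_left[OF U _ X Y a], assumption, simp add: tv_add_def tv_diff_def tv_scale_def)
  also have "\<dots> = D (\<lambda>q. a q *\<^sub>t lie_bracket A X Y q) Z p +\<^sub>t D (\<lambda>q. (- Y q a) *\<^sub>t X q) Z p"
    by (rule D_rules(1)[OF U p vector_field_scale[OF lX a] sX Z smooth_const])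
  also have "\<dots> = a p *\<^sub>t D (lie_bracket A X Y) Z p +\<^sub>t (- Y p a) *\<^sub>t D X Z p"
    unfolding D_rules(2)[OF U p lX lX Z a] D_rules(2)[OF U p X X Z smooth_minus[OF U Ya]] ..
  finally have 3: "D (lie_bracket A (\<lambda>q. a q *\<^sub>t X q) Y) Z p = \<dots>" .
  show ?thesis unfolding curv_def 2 3 D_rules(2)[OF U p X X DYZ a]
    by (simp add: tv_add_def tv_diff_def tv_scale_def algebra_simps)
qed

lemma curv_add_right:
  assumes "open U" "p \<in> U" "vector_field_on A U X" "vector_field_on A U Y" "vector_field_on A U Z" "vector_field_on A U Z'"
  shows "curv X Y (\<lambda>q. Z q +\<^sub>t Z' q) p f = curv X Y Z p f + curv X Y Z' p f"
proof -
  note U = assms(1) and p = assms(2) and X = assms(3) and Y = assms(4) and Z = assms(5) and Z' = assms(6)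
  have 1: "D X (D Y (\<lambda>q. Z q +\<^sub>t Z' q)) p = D X (D Y Z) p +\<^sub>t D X (D Y Z') p"
    if X: "vector_field_on A U X" and Y: "vector_field_on A U Y" for X Y
  proof -
    note DZ = D_vector_field[OF U Y Z] and DZ' = D_vector_field[OF U Y Z']
    have "D X (D Y (\<lambda>q. Z q +\<^sub>t Z' q)) p = D X (\<lambda>q. D Y Z q +\<^sub>t D Y Z' q) p"
      by (rule D_cong[OF U X vector_field_add[OF DZ DZ'] p refl]) (rule D_rules(3)[OF U _ Y Z Z' smooth_const])
    also have "\<dots> = D X (D Y Z) p +\<^sub>t D X (D Y Z') p" by (rule D_rules(3)[OF U p X DZ DZ' smooth_const])
    finally show ?thesis .
  qed
  show ?thesis unfolding curv_def 1[OF X Y] 1[OF Y X] D_rules(3)[OF U p lie_vector_field[OF U X Y] Z Z' smooth_const]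
    by (simp add: tv_add_def tv_diff_def)
qed

text \<open>The second derivatives of \<open>a\<close> occur as X(Y a) - Y(X a) and cancel against
  [X, Y] a; the mixed first-order terms are symmetric in \<open>X\<close> and
  \<open>Y\<close>.\<close>

lemma curv_scale_right:
  assumes "open U" "p \<in> U" "vector_field_on A U X" "vector_field_on A U Y" "vector_field_on A U Z" "smooth_fun_on A U a"
  shows "curv X Y (\<lambda>q. a q *\<^sub>t Z q) p f = a p * curv X Y Z p f"
proof -
  note U = assms(1) and p = assms(2) and X = assms(3) and Y = assms(4) and Z = assms(5) and a = assms(6)
  have 1: "D X (D Y (\<lambda>q. a q *\<^sub>t Z q)) p f =
      X p (\<lambda>q. Y q a) * Z p f + Y p a * D X Z p f + X p a * D Y Z p f + a p * D X (D Y Z) p f"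
    if X: "vector_field_on A U X" and Y: "vector_field_on A U Y" for X Y
  proof -
    note DZ = D_vector_field[OF U Y Z]
    note Ya = vector_field_onD(2)[OF Y U order_refl a]
    note v1 = vector_field_scale[OF Z Ya] and v2 = vector_field_scale[OF DZ a]
    have "D X (D Y (\<lambda>q. a q *\<^sub>t Z q)) p = D X (\<lambda>q. Y q a *\<^sub>t Z q +\<^sub>t a q *\<^sub>t D Y Z q) p"
      by (rule D_cong[OF U X vector_field_add[OF v1 v2] p refl]) (rule D_rules(4)[OF U _ Y Z Z a])
    also have "\<dots> = D X (\<lambda>q. Y q a *\<^sub>t Z q) p +\<^sub>t D X (\<lambda>q. a q *\<^sub>t D Y Z q) p"
      by (rule D_rules(3)[OF U p X v1 v2 smooth_const])
    finally show ?thesis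
      unfolding D_rules(4)[OF U p X Z Z Ya] D_rules(4)[OF U p X DZ DZ a]
      by (simp add: tv_add_def tv_scale_def)
  qed
  note l = lie_vector_field[OF U X Y]
  have a': "smooth_fun_near A p a" using U p a unfolding smooth_fun_near_def by blast
  show ?thesis
    unfolding curv_def tv_diff_def 1[OF X Y] 1[OF Y X] D_rules(4)[OF U p l Z Z a]
    by (simp add: tv_add_def tv_scale_def lie_bracket_def a' algebra_simps)
qed

lemma curv_tensorial_left:
  assumes "open U" "p \<in> U" "vector_field_on A U Y" "vector_field_on A U Z"
  shows "tensorial_at A p (\<lambda>X. curv X Y Z p f)"
  unfolding tensorial_at_def
proof (intro conjI allI impI)
  fix V X X' assume V: "open V" "p \<in> V" "vector_field_on A V X" "\<forall>q\<in>V. X' q = X q"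
  have o: "open (V \<inter> U)" "p \<in> V \<inter> U" using V assms by auto
  note YZ = vector_field_on_subset[OF assms(3) Int_lower2, of V] vector_field_on_subset[OF assms(4) Int_lower2, of V]
  show "curv X' Y Z p f = curv X Y Z p f"
    using curv_cong[OF o vector_field_on_subset[OF V(3) Int_lower1] YZ, of X' Y Z] V(4) by simp
next
  fix V X X' assume V: "open V" "p \<in> V" "vector_field_on A V X" "vector_field_on A V X'"
  have o: "open (V \<inter> U)" "p \<in> V \<inter> U" using V assms by auto
  show "curv (\<lambda>q. X q +\<^sub>t X' q) Y Z p f = curv X Y Z p f + curv X' Y Z p f"
    by (rule curv_add_left[OF o vector_field_on_subset[OF V(3) Int_lower1] vector_field_on_subset[OF V(4) Int_lower1]
      vector_field_on_subset[OF assms(3) Int_lower2] vector_field_on_subset[OF assms(4) Int_lower2]])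
next
  fix V X a assume V: "open V" "p \<in> V" "vector_field_on A V X" "smooth_fun_on A V a"
  have o: "open (V \<inter> U)" "p \<in> V \<inter> U" using V assms by auto
  show "curv (\<lambda>q. a q *\<^sub>t X q) Y Z p f = a p * curv X Y Z p f"
    by (rule curv_scale_left[OF o vector_field_on_subset[OF V(3) Int_lower1]
      vector_field_on_subset[OF assms(3) Int_lower2] vector_field_on_subset[OF assms(4) Int_lower2]
      smooth_fun_on_subset[OF V(4) Int_lower1]])
qed

lemma curv_tensorial_right:
  assumes "open U" "p \<in> U" "vector_field_on A U X" "vector_field_on A U Y"
  shows "tensorial_at A p (\<lambda>Z. curv X Y Z p f)"
  unfolding tensorial_at_def
proof (intro conjI allI impI)
  fix V Z Z' assume V: "open V" "p \<in> V" "vector_field_on A V Z" "\<forall>q\<in>V. Z' q = Z q"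
  have o: "open (V \<inter> U)" "p \<in> V \<inter> U" using V assms by auto
  note XY = vector_field_on_subset[OF assms(3) Int_lower2, of V] vector_field_on_subset[OF assms(4) Int_lower2, of V]
  show "curv X Y Z' p f = curv X Y Z p f"
    using curv_cong[OF o XY vector_field_on_subset[OF V(3) Int_lower1], of X Y Z'] V(4) by simp
next
  fix V Z Z' assume V: "open V" "p \<in> V" "vector_field_on A V Z" "vector_field_on A V Z'"
  have o: "open (V \<inter> U)" "p \<in> V \<inter> U" using V assms by auto
  show "curv X Y (\<lambda>q. Z q +\<^sub>t Z' q) p f = curv X Y Z p f + curv X Y Z' p f"
    by (rule curv_add_right[OF o vector_field_on_subset[OF assms(3) Int_lower2] vector_field_on_subset[OF assms(4) Int_lower2]
       vector_field_on_subset[OF V(3) Int_lower1] vector_field_on_subset[OF V(4) Int_lower1]])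
next
  fix V Z a assume V: "open V" "p \<in> V" "vector_field_on A V Z" "smooth_fun_on A V a"
  have o: "open (V \<inter> U)" "p \<in> V \<inter> U" using V assms by auto
  show "curv X Y (\<lambda>q. a q *\<^sub>t Z q) p f = a p * curv X Y Z p f"
    by (rule curv_scale_right[OF o vector_field_on_subset[OF assms(3) Int_lower2] vector_field_on_subset[OF assms(4) Int_lower2]
      vector_field_on_subset[OF V(3) Int_lower1] smooth_fun_on_subset[OF V(4) Int_lower1]])
qed

lemma curvature_local_ext:
  "curvature A D p u v w = curv (local_ext A p u) (local_ext A p v) (local_ext A p w) p"
  unfolding curvature_def curv_def Let_def ..

lemma curvature_eq_curv:
  assumes "open U" "p \<in> U" "vector_field_on A U X" "vector_field_on A U Y" "vector_field_on A U Z"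
  shows "curvature A D p (X p) (Y p) (Z p) = curv X Y Z p"
proof
  fix f
  obtain V1 where V1: "open V1" "p \<in> V1" "vector_field_on A V1 (local_ext A p (X p))"
    by (rule local_ext[OF vector_field_onD(1)[OF assms(3,2)]])
  obtain V2 where V2: "open V2" "p \<in> V2" "vector_field_on A V2 (local_ext A p (Y p))"
    by (rule local_ext[OF vector_field_onD(1)[OF assms(4,2)]])
  have o: "open (V1 \<inter> V2)" "p \<in> V1 \<inter> V2" using V1 V2 by auto
  have o2: "open (V1 \<inter> U)" "p \<in> V1 \<inter> U" using V1 assms by auto
  let ?X = "local_ext A p (X p)" and ?Y = "local_ext A p (Y p)" and ?Z = "local_ext A p (Z p)"
  have "curv ?X ?Y ?Z p f = curv ?X ?Y Z p f"
    by (rule tensorial_local_ext[OF curv_tensorial_right[OF o vector_field_on_subset[OF V1(3) Int_lower1]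
        vector_field_on_subset[OF V2(3) Int_lower2]] assms(1,2,5) refl])
  \<comment> \<open>Tensoriality is available in the first and third arguments, so antisymmetry
    moves each remaining extension to the first place.\<close>
  also have "\<dots> = - curv ?Y ?X Z p f"
  proof -
    have "open (V1 \<inter> V2 \<inter> U)" "p \<in> V1 \<inter> V2 \<inter> U" using o assms by auto
    then show ?thesis
      by (rule curv_antisym) (rule vector_field_on_subset[OF V2(3)] vector_field_on_subset[OF V1(3)] vector_field_on_subset[OF assms(5)], blast)+
  qed
  also have "curv ?Y ?X Z p f = curv Y ?X Z p f"
    by (rule tensorial_local_ext[OF curv_tensorial_left[OF o2 vector_field_on_subset[OF V1(3) Int_lower1]
        vector_field_on_subset[OF assms(5) Int_lower2]] assms(1,2,4) refl])
  also have "\<dots> = - curv ?X Y Z p f"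
    by (rule curv_antisym[OF o2 vector_field_on_subset[OF V1(3) Int_lower1]
      vector_field_on_subset[OF assms(4) Int_lower2] vector_field_on_subset[OF assms(5) Int_lower2]])
  also have "curv ?X Y Z p f = curv X Y Z p f"
    by (rule tensorial_local_ext[OF curv_tensorial_left[OF assms(1,2,4,5)] assms(1-3) refl])
  finally show "curvature A D p (X p) (Y p) (Z p) f = curv X Y Z p f"
    by (simp add: curvature_local_ext)
qed

lemma curvature_in:
  assumes "u \<in> tangent_space A p" "v \<in> tangent_space A p" "w \<in> tangent_space A p"
  shows "curvature A D p u v w \<in> tangent_space A p"
    and "linear_at A p (\<lambda>u. curvature A D p u v w f)"
    and "linear_at A p (\<lambda>w. curvature A D p u v w f)"
proof -
  obtain V1 where V1: "open V1" "p \<in> V1" "vector_field_on A V1 (local_ext A p u)" by (rule local_ext[OF assms(1)])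
  obtain V2 where V2: "open V2" "p \<in> V2" "vector_field_on A V2 (local_ext A p v)" by (rule local_ext[OF assms(2)])
  obtain V3 where V3: "open V3" "p \<in> V3" "vector_field_on A V3 (local_ext A p w)" by (rule local_ext[OF assms(3)])
  define V where "V = V1 \<inter> (V2 \<inter> V3)"
  have V: "open V" "p \<in> V" and sub: "V \<subseteq> V1" "V \<subseteq> V2" "V \<subseteq> V3" using V1 V2 V3 by (auto simp: V_def)
  note X = vector_field_on_subset[OF V1(3) sub(1)] and Y = vector_field_on_subset[OF V2(3) sub(2)]
    and Z = vector_field_on_subset[OF V3(3) sub(3)]
  show "curvature A D p u v w \<in> tangent_space A p"
    unfolding curvature_local_ext curv_def
    by (intro tangent_diff vector_field_onD(1)[OF _ V(2)] D_vector_field lie_vector_field V(1) X Y Z)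
  show "linear_at A p (\<lambda>u. curvature A D p u v w f)"
    unfolding curvature_local_ext by (rule tensorial_linear_at[OF curv_tensorial_left[OF V Y Z]])
  show "linear_at A p (\<lambda>w. curvature A D p u v w f)"
    unfolding curvature_local_ext by (rule tensorial_linear_at[OF curv_tensorial_right[OF V X Y]])
qed

end

section \<open>Local frames\<close>

text \<open>The frame is kept apart from any metric, because two Levi-Civita connections are
  computed in the same frame.\<close>

locale frame3 = smooth_mfd A
  for A :: "('m::{t2_space, second_countable_topology}, 3) chart set" +
  fixes U :: "'m set" and E1 E2 E3 :: "'m vfield"
  assumes openU: "open U"
    and E1: "vector_field_on A U E1" and E2: "vector_field_on A U E2" and E3: "vector_field_on A U E3"
begin

definition cmb :: "real \<Rightarrow> real \<Rightarrow> real \<Rightarrow> 'm \<Rightarrow> 'm tvec" where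
  "cmb a b c q = a *\<^sub>t E1 q +\<^sub>t (b *\<^sub>t E2 q +\<^sub>t c *\<^sub>t E3 q)"

lemma cmb_add: "cmb a b c q +\<^sub>t cmb a' b' c' q = cmb (a + a') (b + b') (c + c') q"
  and cmb_diff: "cmb a b c q -\<^sub>t cmb a' b' c' q = cmb (a - a') (b - b') (c - c') q"
  and cmb_scale: "k *\<^sub>t cmb a b c q = cmb (k * a) (k * b) (k * c) q"
  by (rule ext, simp add: cmb_def tv_add_def tv_scale_def tv_diff_def algebra_simps)+

lemma cmb_zero: "cmb 0 0 0 q = tv_zero"
  and E1_cmb: "E1 q = cmb 1 0 0 q" and E2_cmb: "E2 q = cmb 0 1 0 q" and E3_cmb: "E3 q = cmb 0 0 1 q"
  by (rule ext, simp add: cmb_def tv_add_def tv_scale_def tv_zero_def)+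

lemma cmb_apply: "cmb a b c q f = a * E1 q f + b * E2 q f + c * E3 q f"
  by (simp add: cmb_def tv_add_def tv_scale_def)

lemma cmb_tangent: "q \<in> U \<Longrightarrow> cmb a b c q \<in> tangent_space A q"
  unfolding cmb_def using vector_field_onD(1)[OF E1] vector_field_onD(1)[OF E2] vector_field_onD(1)[OF E3]
  by (intro tangent_add tangent_scale)

lemma cmb_vf:
  assumes "smooth_fun_on A U a" "smooth_fun_on A U b" "smooth_fun_on A U c"
  shows "vector_field_on A U (\<lambda>q. cmb (a q) (b q) (c q) q)"
  unfolding cmb_def by (intro vector_field_add vector_field_scale E1 E2 E3 assms)

lemma linear_at_cmb:
  assumes "linear_at A q F" "q \<in> U"
  shows "F (cmb a b c q) = a * F (E1 q) + b * F (E2 q) + c * F (E3 q)"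
proof -
  note T = vector_field_onD(1)[OF E1 assms(2)] vector_field_onD(1)[OF E2 assms(2)] vector_field_onD(1)[OF E3 assms(2)]
  have "F (cmb a b c q) = F (a *\<^sub>t E1 q +\<^sub>t 1 *\<^sub>t (b *\<^sub>t E2 q +\<^sub>t c *\<^sub>t E3 q))"
    by (simp add: cmb_def tv_scale_def)
  also have "\<dots> = a * F (E1 q) + 1 * F (b *\<^sub>t E2 q +\<^sub>t c *\<^sub>t E3 q)"
    by (rule linear_atD[OF assms(1) T(1) tangent_lin[OF T(2,3)]])
  finally show ?thesis by (simp add: linear_atD[OF assms(1) T(2,3)])
qed

end

locale lc_frame3 = levi_civita_mfd A g D + frame3 A U E1 E2 E3
  for A :: "('m::{t2_space, second_countable_topology}, 3) chart set" and g D U E1 E2 E3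
begin

lemma D_right_cmb:
  assumes p: "p \<in> U" and X: "vector_field_on A U X"
    and a: "smooth_fun_on A U a" and b: "smooth_fun_on A U b" and c: "smooth_fun_on A U c"
    and Y: "\<And>q. q \<in> U \<Longrightarrow> Y q = cmb (a q) (b q) (c q) q"
  shows "D X Y p = cmb (X p a) (X p b) (X p c) p +\<^sub>t
    (a p *\<^sub>t D X E1 p +\<^sub>t (b p *\<^sub>t D X E2 p +\<^sub>t c p *\<^sub>t D X E3 p))"
proof -
  note aE = vector_field_scale[OF E1 a] and bE = vector_field_scale[OF E2 b] and cE = vector_field_scale[OF E3 c]
  have "D X Y p = D X (\<lambda>q. a q *\<^sub>t E1 q +\<^sub>t (b q *\<^sub>t E2 q +\<^sub>t c q *\<^sub>t E3 q)) p"
    by (rule D_cong[OF openU X vector_field_add[OF aE vector_field_add[OF bE cE]] p refl])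
      (simp only: Y cmb_def)
  also have "\<dots> = D X (\<lambda>q. a q *\<^sub>t E1 q) p +\<^sub>t (D X (\<lambda>q. b q *\<^sub>t E2 q) p +\<^sub>t D X (\<lambda>q. c q *\<^sub>t E3 q) p)"
    by (simp only: D_rules(3)[OF openU p X aE vector_field_add[OF bE cE] smooth_const] D_rules(3)[OF openU p X bE cE smooth_const])
  also have "\<dots> = (X p a *\<^sub>t E1 p +\<^sub>t a p *\<^sub>t D X E1 p) +\<^sub>t ((X p b *\<^sub>t E2 p +\<^sub>t b p *\<^sub>t D X E2 p) +\<^sub>t
      (X p c *\<^sub>t E3 p +\<^sub>t c p *\<^sub>t D X E3 p))"
    by (simp only: D_rules(4)[OF openU p X E1 E1 a] D_rules(4)[OF openU p X E2 E2 b] D_rules(4)[OF openU p X E3 E3 c])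
  finally show ?thesis by (simp add: cmb_def tv_add_def add_ac)
qed

text \<open>\<open>D\<close> is tensorial in the direction, so \<open>X\<close> enters through its
  value at p and the coefficients are plain numbers; in the differentiated argument they have to be
  functions.\<close>

lemma D_left_cmb:
  assumes p: "p \<in> U" and X: "vector_field_on A U X" and Z: "vector_field_on A U Z"
    and v: "X p = cmb a b c p"
  shows "D X Z p = a *\<^sub>t D E1 Z p +\<^sub>t (b *\<^sub>t D E2 Z p +\<^sub>t c *\<^sub>t D E3 Z p)"
proof -
  note aE = vector_field_scale[OF E1 smooth_const, of a] and bE = vector_field_scale[OF E2 smooth_const, of b]
    and cE = vector_field_scale[OF E3 smooth_const, of c]
  have "D X Z p = D (\<lambda>q. a *\<^sub>t E1 q +\<^sub>t (b *\<^sub>t E2 q +\<^sub>t c *\<^sub>t E3 q)) Z p"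
    by (rule D_cong_left[OF openU p Z X vector_field_add[OF aE vector_field_add[OF bE cE]]])
      (simp only: v cmb_def)
  also have "\<dots> = D (\<lambda>q. a *\<^sub>t E1 q) Z p +\<^sub>t (D (\<lambda>q. b *\<^sub>t E2 q) Z p +\<^sub>t D (\<lambda>q. c *\<^sub>t E3 q) Z p)"
    by (simp only: D_rules(1)[OF openU p aE vector_field_add[OF bE cE] Z smooth_const] D_rules(1)[OF openU p bE cE Z smooth_const])
  also have "\<dots> = a *\<^sub>t D E1 Z p +\<^sub>t (b *\<^sub>t D E2 Z p +\<^sub>t c *\<^sub>t D E3 Z p)"
    by (simp only: D_rules(2)[OF openU p E1 E1 Z smooth_const] D_rules(2)[OF openU p E2 E2 Z smooth_const] D_rules(2)[OF openU p E3 E3 Z smooth_const])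
  finally show ?thesis .
qed

end

section \<open>Contact metric algebra\<close>

locale contact3 = levi_civita_mfd A g D
  for A :: "('m::{t2_space, second_countable_topology}, 3) chart set" and g D +
  fixes \<phi> :: "'m endo" and \<xi> :: "'m vfield" and \<eta> :: "'m form1" and \<kappa> \<mu> \<nu> :: "'m \<Rightarrow> real"
  assumes kmn: "kmn_contact_metric A \<phi> \<xi> \<eta> g D \<kappa> \<mu> \<nu>"
    and \<kappa>_less_1: "\<kappa> p < 1"
begin

lemma contact: "contact_metric A \<phi> \<xi> \<eta> g"
  using kmn unfolding kmn_contact_metric_def by (elim conjE)

lemma smooth_\<kappa>: "smooth_fun_on A UNIV \<kappa>"
  using kmn unfolding kmn_contact_metric_def by (elim conjE)

lemma smooth_\<mu>: "smooth_fun_on A UNIV \<mu>"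
  using kmn unfolding kmn_contact_metric_def by (elim conjE)

lemma endo: "endo_field A \<phi>"
  using contact unfolding contact_metric_def by (elim conjE)

lemma \<xi>_vf_UNIV: "vector_field_on A UNIV \<xi>"
  using contact unfolding contact_metric_def by (elim conjE)

lemma form: "one_form A \<eta>"
  using contact unfolding contact_metric_def by (elim conjE)

lemma riem: "riemannian_metric A g"
  using contact unfolding contact_metric_def by (elim conjE)


lemma bilin: "bilinear_field A g"
  using riem unfolding riemannian_metric_def by (elim conjE)

lemma \<eta>_\<xi>: "\<eta> p (\<xi> p) = 1"
  using contact unfolding contact_metric_def by (elim conjE) (rule spec)

lemma \<phi>_\<phi>:
  assumes "u \<in> tangent_space A p"
  shows "\<phi> p (\<phi> p u) = \<eta> p u *\<^sub>t \<xi> p -\<^sub>t u"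
proof -
  have "\<forall>p. \<forall>u\<in>tangent_space A p. \<phi> p (\<phi> p u) = \<eta> p u *\<^sub>t \<xi> p -\<^sub>t u"
    using contact unfolding contact_metric_def by (elim conjE)
  from this[rule_format, OF assms] show ?thesis .
qed

lemma g_\<phi>_\<phi>:
  assumes "u \<in> tangent_space A p" "v \<in> tangent_space A p"
  shows "g p (\<phi> p u) (\<phi> p v) = g p u v - \<eta> p u * \<eta> p v"
proof -
  have "\<forall>p. \<forall>u\<in>tangent_space A p. \<forall>v\<in>tangent_space A p.
        g p (\<phi> p u) (\<phi> p v) = g p u v - \<eta> p u * \<eta> p v"
    using contact unfolding contact_metric_def by (elim conjE)
  from this[rule_format, OF assms] show ?thesis .
qed

lemma d\<eta>:
  assumes "u \<in> tangent_space A p" "v \<in> tangent_space A p"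
  shows "ext_deriv A \<eta> p u v = g p u (\<phi> p v)"
proof -
  have "\<forall>p. \<forall>u\<in>tangent_space A p. \<forall>v\<in>tangent_space A p. ext_deriv A \<eta> p u v = g p u (\<phi> p v)"
    using contact unfolding contact_metric_def by (elim conjE)
  from this[rule_format, OF assms] show ?thesis .
qed

lemma curvature_\<xi>:
  assumes "u \<in> tangent_space A p" "v \<in> tangent_space A p"
  shows "curvature A D p u v (\<xi> p) =
            \<kappa> p *\<^sub>t (\<eta> p v *\<^sub>t u -\<^sub>t \<eta> p u *\<^sub>t v) +\<^sub>t
            \<mu> p *\<^sub>t (\<eta> p v *\<^sub>t contact_h A \<xi> \<phi> p u -\<^sub>t \<eta> p u *\<^sub>t contact_h A \<xi> \<phi> p v) +\<^sub>t
            \<nu> p *\<^sub>t (\<eta> p v *\<^sub>t \<phi> p (contact_h A \<xi> \<phi> p u) -\<^sub>t \<eta> p u *\<^sub>t \<phi> p (contact_h A \<xi> \<phi> p v))"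
proof -
  have "\<forall>p. \<forall>u\<in>tangent_space A p. \<forall>v\<in>tangent_space A p.
        (let h = contact_h A \<xi> \<phi> in
          curvature A D p u v (\<xi> p) =
            \<kappa> p *\<^sub>t (\<eta> p v *\<^sub>t u -\<^sub>t \<eta> p u *\<^sub>t v) +\<^sub>t
            \<mu> p *\<^sub>t (\<eta> p v *\<^sub>t h p u -\<^sub>t \<eta> p u *\<^sub>t h p v) +\<^sub>t
            \<nu> p *\<^sub>t (\<eta> p v *\<^sub>t \<phi> p (h p u) -\<^sub>t \<eta> p u *\<^sub>t \<phi> p (h p v)))"
    using kmn unfolding kmn_contact_metric_def by (elim conjE)
  from this[rule_format, OF assms] show ?thesis unfolding Let_def .
qed

lemma \<phi>_in:
  assumes "u \<in> tangent_space A p"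
  shows "\<phi> p u \<in> tangent_space A p"
proof -
  have "\<forall>p. \<forall>u\<in>tangent_space A p. \<phi> p u \<in> tangent_space A p"
    using endo unfolding endo_field_def by (elim conjE)
  from this[rule_format, OF assms] show ?thesis .
qed

lemma \<phi>_lin:
  assumes "u \<in> tangent_space A p" "v \<in> tangent_space A p"
  shows "\<phi> p (a *\<^sub>t u +\<^sub>t b *\<^sub>t v) = a *\<^sub>t \<phi> p u +\<^sub>t b *\<^sub>t \<phi> p v"
proof -
  have "\<forall>p. \<forall>u\<in>tangent_space A p. \<forall>v\<in>tangent_space A p. \<forall>a b.
        \<phi> p (a *\<^sub>t u +\<^sub>t b *\<^sub>t v) = a *\<^sub>t \<phi> p u +\<^sub>t b *\<^sub>t \<phi> p v"
    using endo unfolding endo_field_def by (elim conjE)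
  from this[rule_format, OF assms] show ?thesis .
qed

lemma \<phi>_vf:
  assumes "open U" "vector_field_on A U X"
  shows "vector_field_on A U (\<lambda>q. \<phi> q (X q))"
proof -
  have "\<forall>U X. open U \<and> vector_field_on A U X \<longrightarrow> vector_field_on A U (\<lambda>p. \<phi> p (X p))"
    using endo unfolding endo_field_def by (elim conjE)
  from this[rule_format, OF conjI, OF assms] show ?thesis .
qed

lemma \<eta>_linear: "linear_at A p (\<eta> p)"
  using form unfolding one_form_def linear_at_def by (elim conjE) (rule spec)

lemma \<eta>_smooth:
  assumes "open U" "vector_field_on A U X"
  shows "smooth_fun_on A U (\<lambda>q. \<eta> q (X q))"
proof -
  have "\<forall>U X. open U \<and> vector_field_on A U X \<longrightarrow> smooth_fun_on A U (\<lambda>p. \<eta> p (X p))"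
    using form unfolding one_form_def by (elim conjE)
  from this[rule_format, OF conjI, OF assms] show ?thesis .
qed

lemma g_smooth:
  assumes "open U" "vector_field_on A U X" "vector_field_on A U Y"
  shows "smooth_fun_on A U (\<lambda>q. g q (X q) (Y q))"
proof -
  have "\<forall>U X Y. open U \<and> vector_field_on A U X \<and> vector_field_on A U Y \<longrightarrow>
        smooth_fun_on A U (\<lambda>p. g p (X p) (Y p))"
    using bilin unfolding bilinear_field_def by (elim conjE)
  from this[rule_format, OF conjI, OF _ conjI, OF assms] show ?thesis .
qed

lemma g_linear:
  assumes "w \<in> tangent_space A p"
  shows "linear_at A p (\<lambda>u. g p u w)" "linear_at A p (g p w)"
proof -
  have *: "\<forall>p. \<forall>u\<in>tangent_space A p. \<forall>v\<in>tangent_space A p. \<forall>w\<in>tangent_space A p. \<forall>a b.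
        g p (a *\<^sub>t u +\<^sub>t b *\<^sub>t v) w = a * g p u w + b * g p v w \<and>
        g p w (a *\<^sub>t u +\<^sub>t b *\<^sub>t v) = a * g p w u + b * g p w v"
    using bilin unfolding bilinear_field_def by (elim conjE)
  show "linear_at A p (\<lambda>u. g p u w)" unfolding linear_at_def
    by (intro ballI allI) (rule *[rule_format, THEN conjunct1, OF _ _ assms])
  show "linear_at A p (g p w)" unfolding linear_at_def
    by (intro ballI allI) (rule *[rule_format, THEN conjunct2, OF _ _ assms])
qed

lemma g_sym:
  assumes "u \<in> tangent_space A p" "v \<in> tangent_space A p"
  shows "g p u v = g p v u"
proof -
  have "\<forall>p. \<forall>u\<in>tangent_space A p. \<forall>v\<in>tangent_space A p. g p u v = g p v u"
    using riem unfolding riemannian_metric_def by (elim conjE)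
  from this[rule_format, OF assms] show ?thesis .
qed

lemma g_pos:
  assumes "u \<in> tangent_space A p" "u \<noteq> tv_zero"
  shows "g p u u > 0"
proof -
  have "\<forall>p. \<forall>u\<in>tangent_space A p. u \<noteq> tv_zero \<longrightarrow> g p u u > 0"
    using riem unfolding riemannian_metric_def by (elim conjE)
  from this[rule_format, OF assms] show ?thesis .
qed

section \<open>Pointwise algebra of the contact metric structure\<close>

lemma \<xi>_vf: "vector_field_on A U \<xi>"
  by (rule vector_field_on_subset[OF \<xi>_vf_UNIV subset_UNIV])

lemma \<xi>_in: "\<xi> p \<in> tangent_space A p"
  by (rule vector_field_onD(1)[OF \<xi>_vf_UNIV UNIV_I])

lemma \<phi>_scale: "u \<in> tangent_space A p \<Longrightarrow> \<phi> p (a *\<^sub>t u) = a *\<^sub>t \<phi> p u"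
  using \<phi>_lin[of u p u a 0] by (simp add: tv_add_def tv_scale_def)

lemma \<phi>_add: "u \<in> tangent_space A p \<Longrightarrow> v \<in> tangent_space A p \<Longrightarrow> \<phi> p (u +\<^sub>t v) = \<phi> p u +\<^sub>t \<phi> p v"
  using \<phi>_lin[of u p v 1 1] by (simp add: tv_scale_def)

lemma \<phi>_diff: "u \<in> tangent_space A p \<Longrightarrow> v \<in> tangent_space A p \<Longrightarrow> \<phi> p (u -\<^sub>t v) = \<phi> p u -\<^sub>t \<phi> p v"
  using \<phi>_lin[of u p v 1 "-1"] by (simp add: tv_scale_def tv_add_def tv_diff_def)

lemma \<xi>_nonzero: "\<xi> p \<noteq> tv_zero"
proof
  assume "\<xi> p = tv_zero"
  then have "0 *\<^sub>t \<xi> p +\<^sub>t 0 *\<^sub>t \<xi> p = \<xi> p" by (simp add: tv_zero_def tv_add_def tv_scale_def)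
  then have "\<eta> p (\<xi> p) = 0 * \<eta> p (\<xi> p) + 0 * \<eta> p (\<xi> p)"
    using linear_atD[OF \<eta>_linear \<xi>_in \<xi>_in, of p 0 0] by simp
  then show False by (simp add: \<eta>_\<xi>)
qed

text \<open>Here phi^2 xi = 0. Computing phi^3 xi also by the formula for phi^2 at phi xi shows that
  phi xi is a multiple k of xi, and then k^2 xi = phi^2 xi = 0.\<close>

lemma \<phi>_\<xi>: "\<phi> p (\<xi> p) = tv_zero"
proof -
  define k where "k = \<eta> p (\<phi> p (\<xi> p))"
  have 1: "\<phi> p (\<phi> p (\<xi> p)) = 0 *\<^sub>t \<xi> p"
    unfolding \<phi>_\<phi>[OF \<xi>_in] \<eta>_\<xi> by (rule ext) (simp add: tv_diff_def tv_scale_def)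
  have "\<phi> p (\<phi> p (\<phi> p (\<xi> p))) = k *\<^sub>t \<xi> p -\<^sub>t \<phi> p (\<xi> p)"
    unfolding k_def by (rule \<phi>_\<phi>[OF \<phi>_in[OF \<xi>_in]])
  moreover have "\<phi> p (\<phi> p (\<phi> p (\<xi> p))) = 0 *\<^sub>t \<phi> p (\<xi> p)"
    unfolding 1 by (rule \<phi>_scale[OF \<xi>_in])
  ultimately have 2: "\<phi> p (\<xi> p) = k *\<^sub>t \<xi> p"
    by (simp add: tv_diff_def tv_scale_def fun_eq_iff)
  have "\<phi> p (\<phi> p (\<xi> p)) = k *\<^sub>t \<phi> p (\<xi> p)" by (subst 2) (rule \<phi>_scale[OF \<xi>_in])
  with 1 2 have "(k * k) *\<^sub>t \<xi> p = tv_zero" by (simp add: tv_scale_def tv_zero_def mult.assoc)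
  with \<xi>_nonzero have "k = 0" by (auto simp: tv_scale_def tv_zero_def fun_eq_iff)
  with 2 show ?thesis by (simp add: tv_scale_def tv_zero_def)
qed

lemma g_zero: "u \<in> tangent_space A p \<Longrightarrow> g p tv_zero u = 0"
  using linear_atD[OF g_linear(1), of u p u u 0 0] by (simp add: tv_zero_def tv_add_def tv_scale_def)

lemma g_\<xi>: "u \<in> tangent_space A p \<Longrightarrow> g p (\<xi> p) u = \<eta> p u"
  using g_\<phi>_\<phi>[OF \<xi>_in, of u p] by (simp add: \<phi>_\<xi> \<eta>_\<xi> g_zero \<phi>_in)

lemma \<eta>_\<phi>:
  assumes u: "u \<in> tangent_space A p"
  shows "\<eta> p (\<phi> p u) = 0"
proof -
  have "\<phi> p (\<phi> p (\<phi> p u)) = \<eta> p u *\<^sub>t \<phi> p (\<xi> p) -\<^sub>t \<phi> p u"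
    unfolding \<phi>_\<phi>[OF u] using u by (simp add: \<phi>_diff \<phi>_scale \<xi>_in tangent_scale)
  moreover have "\<phi> p (\<phi> p (\<phi> p u)) = \<eta> p (\<phi> p u) *\<^sub>t \<xi> p -\<^sub>t \<phi> p u"
    by (rule \<phi>_\<phi>[OF \<phi>_in[OF u]])
  ultimately have "\<eta> p (\<phi> p u) *\<^sub>t \<xi> p = tv_zero"
    by (auto simp: \<phi>_\<xi> tv_diff_def tv_scale_def tv_zero_def fun_eq_iff)
  with \<xi>_nonzero show ?thesis by (auto simp: tv_scale_def tv_zero_def fun_eq_iff)
qed

text \<open>Apply the compatibility of g and phi to u and phi v, and expand phi^2 v; phi u is
  orthogonal to xi.\<close>

lemma g_\<phi>_skew:
  assumes u: "u \<in> tangent_space A p" and v: "v \<in> tangent_space A p"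
  shows "g p u (\<phi> p v) = - g p (\<phi> p u) v"
proof -
  have e: "\<phi> p (\<phi> p v) = \<eta> p v *\<^sub>t \<xi> p +\<^sub>t (-1) *\<^sub>t v"
    unfolding \<phi>_\<phi>[OF v] by (rule ext) (simp add: tv_diff_def tv_scale_def tv_add_def)
  have "g p (\<phi> p u) (\<phi> p (\<phi> p v)) = g p u (\<phi> p v)"
    using g_\<phi>_\<phi>[OF u \<phi>_in[OF v]] by (simp add: \<eta>_\<phi>[OF v])
  then show ?thesis
    unfolding e linear_atD[OF g_linear(2)[OF \<phi>_in[OF u]] \<xi>_in v]
    using g_\<xi>[OF \<phi>_in[OF u]] g_sym[OF \<xi>_in \<phi>_in[OF u]] \<eta>_\<phi>[OF u] by simp
qed

text \<open>As eta = g(xi, .), metric compatibility and vanishing torsion remove all derivatives of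
  \<open>X\<close> and \<open>Y\<close> from d eta. What remains is twice the skew part of D xi,
  which the contact condition identifies.\<close>

lemma ext_deriv_eq:
  assumes "open U" "p \<in> U" "vector_field_on A U X" "vector_field_on A U Y"
  shows "2 * g p (X p) (\<phi> p (Y p)) = g p (D X \<xi> p) (Y p) - g p (D Y \<xi> p) (X p)"
proof -
  note u = vector_field_onD(1)[OF assms(3,2)] and v = vector_field_onD(1)[OF assms(4,2)]
  let ?X = "local_ext A p (X p)" and ?Y = "local_ext A p (Y p)"
  obtain V1 where V1: "open V1" "p \<in> V1" "vector_field_on A V1 ?X" "?X p = X p"
    by (rule local_ext[OF u])
  obtain V2 where V2: "open V2" "p \<in> V2" "vector_field_on A V2 ?Y" "?Y p = Y p"
    by (rule local_ext[OF v])
  define V where "V = V1 \<inter> V2 \<inter> U"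
  have V: "open V" "p \<in> V" using V1 V2 assms unfolding V_def by auto
  have X': "vector_field_on A V ?X" by (rule vector_field_on_subset[OF V1(3)]) (auto simp: V_def)
  have Y': "vector_field_on A V ?Y" by (rule vector_field_on_subset[OF V2(3)]) (auto simp: V_def)
  have X: "vector_field_on A V X" by (rule vector_field_on_subset[OF assms(3)]) (auto simp: V_def)
  have Y: "vector_field_on A V Y" by (rule vector_field_on_subset[OF assms(4)]) (auto simp: V_def)
  have *: "S p (\<lambda>q. \<eta> q (T q)) = g p (D S \<xi> p) (T p) + \<eta> p (D S T p)"
    if S: "vector_field_on A V S" and T: "vector_field_on A V T" for S T
  proof -
    have "S p (\<lambda>q. \<eta> q (T q)) = S p (\<lambda>q. g q (\<xi> q) (T q))"
      by (rule tv_cong[OF vector_field_onD(1)[OF S V(2)] V]) (rule g_\<xi>[OF vector_field_onD(1)[OF T], symmetric])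
    then show ?thesis
      using metric_compatible[OF V S \<xi>_vf T] g_\<xi>[OF vector_field_onD(1)[OF D_vector_field[OF V(1) S T] V(2)]]
      by simp
  qed
  note l = vector_field_onD(1)[OF D_vector_field[OF V(1) X' Y'] V(2)] vector_field_onD(1)[OF D_vector_field[OF V(1) Y' X'] V(2)]
  have "lie_bracket A ?X ?Y p = 1 *\<^sub>t D ?X ?Y p +\<^sub>t (-1) *\<^sub>t D ?Y ?X p"
    unfolding torsion_free[OF V X' Y'] by (rule ext) (simp add: tv_diff_def tv_scale_def tv_add_def)
  then have "\<eta> p (lie_bracket A ?X ?Y p) = \<eta> p (D ?X ?Y p) - \<eta> p (D ?Y ?X p)"
    by (simp add: linear_atD[OF \<eta>_linear l])
  moreover have a: "X p (\<lambda>q. \<eta> q (?Y q)) = g p (D ?X \<xi> p) (Y p) + \<eta> p (D ?X ?Y p)"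
    using *[OF X' Y'] unfolding V1(4) V2(4) .
  moreover have b: "Y p (\<lambda>q. \<eta> q (?X q)) = g p (D ?Y \<xi> p) (X p) + \<eta> p (D ?Y ?X p)"
    using *[OF Y' X'] unfolding V1(4) V2(4) .
  ultimately have "2 * ext_deriv A \<eta> p (X p) (Y p) = g p (D ?X \<xi> p) (Y p) - g p (D ?Y \<xi> p) (X p)"
    unfolding ext_deriv_def Let_def V1(4) V2(4) by simp
  also have "D ?X \<xi> p = D X \<xi> p" by (rule D_cong_left[OF V \<xi>_vf X' X V1(4)])
  also have "D ?Y \<xi> p = D Y \<xi> p" by (rule D_cong_left[OF V \<xi>_vf Y' Y V2(4)])
  finally show ?thesis unfolding d\<eta>[OF u v] .
qed

text \<open>Put X = D_xi xi and Y = xi in \<open>ext_deriv_eq\<close>. The left side vanishes with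
  phi xi, and g(D_X xi, xi) = 0 since xi has unit length; this leaves the squared norm of D_xi xi
  equal to 0.\<close>

lemma D_\<xi>_\<xi>: "D \<xi> \<xi> p = tv_zero"
proof (rule ccontr)
  note dxi = D_vector_field[OF open_UNIV \<xi>_vf \<xi>_vf]
  note T = vector_field_onD(1)[OF dxi UNIV_I, of p]
  assume "D \<xi> \<xi> p \<noteq> tv_zero"
  from g_pos[OF T this] have pos: "g p (D \<xi> \<xi> p) (D \<xi> \<xi> p) > 0" .
  have "D (D \<xi> \<xi>) \<xi> p \<in> tangent_space A p"
    by (rule vector_field_onD(1)[OF D_vector_field[OF open_UNIV dxi \<xi>_vf] UNIV_I])
  note T2 = this
  have "D \<xi> \<xi> p (\<lambda>q. g q (\<xi> q) (\<xi> q)) = 0"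
    using tv_const[OF T, of 1] by (simp add: g_\<xi>[OF \<xi>_in] \<eta>_\<xi>)
  then have "g p (D (D \<xi> \<xi>) \<xi> p) (\<xi> p) = 0"
    using metric_compatible[OF open_UNIV UNIV_I dxi \<xi>_vf \<xi>_vf, of p] g_sym[OF T2 \<xi>_in] by simp
  moreover have "g p (D \<xi> \<xi> p) (\<phi> p (\<xi> p)) = 0"
    using g_\<phi>_skew[OF T \<xi>_in] g_sym[OF \<phi>_in[OF T] \<xi>_in] g_\<xi>[OF \<phi>_in[OF T]] \<eta>_\<phi>[OF T] by simp
  ultimately show False
    using ext_deriv_eq[OF open_UNIV UNIV_I dxi \<xi>_vf, of p] pos by simp
qed

section \<open>The tensor h\<close>

definition L\<xi>\<phi> :: "'m vfield \<Rightarrow> 'm vfield" where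
  "L\<xi>\<phi> X p = lie_bracket A \<xi> (\<lambda>q. \<phi> q (X q)) p -\<^sub>t \<phi> p (lie_bracket A \<xi> X p)"

text \<open>Under scaling by a function a, both brackets contribute the same term xi(a) phi X, with
  opposite signs.\<close>

lemma L\<xi>\<phi>_tensorial: "tensorial_at A p (\<lambda>X. L\<xi>\<phi> X p f)"
  unfolding tensorial_at_def
proof (intro conjI allI impI)
  fix V X X' assume V: "open V" "p \<in> V" "vector_field_on A V X" "\<forall>q\<in>V. X' q = X q"
  have "lie_bracket A \<xi> X' p = lie_bracket A \<xi> X p"
    by (rule lie_cong_right[OF V(1,2) \<xi>_vf V(3)]) (rule V(4)[rule_format])
  moreover have "lie_bracket A \<xi> (\<lambda>q. \<phi> q (X' q)) p = lie_bracket A \<xi> (\<lambda>q. \<phi> q (X q)) p"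
    by (rule lie_cong_right[OF V(1,2) \<xi>_vf \<phi>_vf[OF V(1,3)]]) (simp only: V(4)[rule_format])
  ultimately show "L\<xi>\<phi> X' p f = L\<xi>\<phi> X p f" by (simp add: L\<xi>\<phi>_def)
next
  fix V X Y assume V: "open V" "p \<in> V" "vector_field_on A V X" "vector_field_on A V Y"
  note T = vector_field_onD(1)[OF lie_vector_field[OF V(1) \<xi>_vf V(3)] V(2)]
    vector_field_onD(1)[OF lie_vector_field[OF V(1) \<xi>_vf V(4)] V(2)]
  note pX = \<phi>_vf[OF V(1,3)] and pY = \<phi>_vf[OF V(1,4)]
  have 1: "lie_bracket A \<xi> (\<lambda>q. \<phi> q (X q +\<^sub>t Y q)) p = lie_bracket A \<xi> (\<lambda>q. \<phi> q (X q) +\<^sub>t \<phi> q (Y q)) p"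
    by (rule lie_cong_right[OF V(1,2) \<xi>_vf vector_field_add[OF pX pY]])
      (rule \<phi>_add[OF vector_field_onD(1)[OF V(3)] vector_field_onD(1)[OF V(4)]])
  show "L\<xi>\<phi> (\<lambda>q. X q +\<^sub>t Y q) p f = L\<xi>\<phi> X p f + L\<xi>\<phi> Y p f"
    unfolding L\<xi>\<phi>_def 1 lie_add_right[OF V(1,2) \<xi>_vf pX pY] lie_add_right[OF V(1,2) \<xi>_vf V(3,4)] \<phi>_add[OF T]
    by (simp add: tv_add_def tv_diff_def)
next
  fix V X a assume V: "open V" "p \<in> V" "vector_field_on A V X" "smooth_fun_on A V a"
  note T = vector_field_onD(1)[OF lie_vector_field[OF V(1) \<xi>_vf V(3)] V(2)]
    vector_field_onD(1)[OF V(3,2)]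
  note pX = \<phi>_vf[OF V(1,3)]
  have 1: "lie_bracket A \<xi> (\<lambda>q. \<phi> q (a q *\<^sub>t X q)) p = lie_bracket A \<xi> (\<lambda>q. a q *\<^sub>t \<phi> q (X q)) p"
    by (rule lie_cong_right[OF V(1,2) \<xi>_vf vector_field_scale[OF pX V(4)]])
      (rule \<phi>_scale[OF vector_field_onD(1)[OF V(3)]])
  show "L\<xi>\<phi> (\<lambda>q. a q *\<^sub>t X q) p f = a p * L\<xi>\<phi> X p f"
    unfolding L\<xi>\<phi>_def 1 lie_scale_right[OF V(1,2) \<xi>_vf pX V(4)] lie_scale_right[OF V(1,2) \<xi>_vf V(3,4)] \<phi>_lin[OF T]
    by (simp add: tv_add_def tv_diff_def tv_scale_def algebra_simps)
qed

abbreviation h :: "'m endo" where "h \<equiv> contact_h A \<xi> \<phi>"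

lemma h_local_ext: "h p u f = L\<xi>\<phi> (local_ext A p u) p f / 2"
  by (simp add: contact_h_def lie_deriv_endo_def Let_def L\<xi>\<phi>_def tv_scale_def)

lemma h_field:
  assumes "open U" "p \<in> U" "vector_field_on A U X"
  shows "h p (X p) = (1/2) *\<^sub>t L\<xi>\<phi> X p"
  by (rule ext)
    (simp only: h_local_ext tensorial_local_ext[OF L\<xi>\<phi>_tensorial assms refl] tv_scale_def; simp)

lemma L\<xi>\<phi>_vf:
  assumes "open U" "vector_field_on A U X"
  shows "vector_field_on A U (L\<xi>\<phi> X)"
  unfolding L\<xi>\<phi>_def[abs_def]
  by (intro vector_field_diff lie_vector_field \<phi>_vf \<xi>_vf assms)

lemma h_vf:
  assumes "open U" "vector_field_on A U X"
  shows "vector_field_on A U (\<lambda>q. h q (X q))"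
  by (rule vector_field_on_cong[OF vector_field_scale[OF L\<xi>\<phi>_vf[OF assms] smooth_const]])
    (rule h_field[OF assms(1) _ assms(2), symmetric])

lemma h_in:
  assumes "u \<in> tangent_space A p"
  shows "h p u \<in> tangent_space A p"
proof -
  obtain V where V: "open V" "p \<in> V" "vector_field_on A V (local_ext A p u)" "local_ext A p u p = u"
    by (rule local_ext[OF assms])
  from vector_field_onD(1)[OF h_vf[OF V(1,3)] V(2)] show ?thesis unfolding V(4) .
qed

lemma h_lin:
  assumes "u \<in> tangent_space A p" "v \<in> tangent_space A p"
  shows "h p (a *\<^sub>t u +\<^sub>t b *\<^sub>t v) = a *\<^sub>t h p u +\<^sub>t b *\<^sub>t h p v"
  by (rule ext) (simp only: h_local_ext linear_atD[OF tensorial_linear_at[OF L\<xi>\<phi>_tensorial] assms],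
    simp add: h_local_ext tv_scale_def tv_add_def add_divide_distrib)

lemma h_scale: "u \<in> tangent_space A p \<Longrightarrow> h p (k *\<^sub>t u) = k *\<^sub>t h p u"
  using h_lin[of u p u k 0] by (simp add: tv_add_def tv_scale_def)

lemma h_\<xi>: "h p (\<xi> p) = tv_zero"
proof -
  have "lie_bracket A \<xi> (\<lambda>q. \<phi> q (\<xi> q)) p = lie_bracket A \<xi> (\<lambda>q f. 0) p"
    by (rule lie_cong_right[OF open_UNIV UNIV_I \<xi>_vf vector_field_zero]) (simp add: \<phi>_\<xi> tv_zero_def)
  also have "\<dots> = tv_zero"
    by (rule ext) (simp add: lie_bracket_def tv_zero_def tv_const[OF \<xi>_in])
  moreover have "lie_bracket A \<xi> \<xi> p = 0 *\<^sub>t \<xi> p"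
    unfolding torsion_free[OF open_UNIV UNIV_I \<xi>_vf \<xi>_vf] by (rule ext) (simp add: tv_diff_def tv_scale_def)
  then have "\<phi> p (lie_bracket A \<xi> \<xi> p) = tv_zero"
    by (simp add: \<phi>_scale \<xi>_in) (simp add: tv_scale_def tv_zero_def)
  ultimately show ?thesis
    unfolding h_field[OF open_UNIV UNIV_I \<xi>_vf] L\<xi>\<phi>_def by (simp add: tv_diff_def tv_scale_def tv_zero_def)
qed

end

section \<open>Adapted orthonormal frames\<close>

text \<open>One unit field in the kernel of eta suffices: its image under phi and xi complete it to
  an orthonormal frame.\<close>

locale adapted_frame = contact3 A g D \<phi> \<xi> \<eta> \<kappa> \<mu> \<nu>
  for A :: "('m::{t2_space, second_countable_topology}, 3) chart set" and g D \<phi> \<xi> \<eta> \<kappa> \<mu> \<nu> +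
  fixes U :: "'m set" and E1 :: "'m vfield"
  assumes openU': "open U" and E1_vf: "vector_field_on A U E1"
    and \<eta>_E1: "q \<in> U \<Longrightarrow> \<eta> q (E1 q) = 0" and g_E1: "q \<in> U \<Longrightarrow> g q (E1 q) (E1 q) = 1"
begin

definition E2 :: "'m vfield" where "E2 q = \<phi> q (E1 q)"

lemma E2_vf: "vector_field_on A U E2"
  unfolding E2_def[abs_def] by (rule \<phi>_vf[OF openU' E1_vf])

sublocale lc_frame3 A g D U E1 E2 \<xi>
  by unfold_locales (rule openU' E1_vf E2_vf \<xi>_vf)+

context
  fixes q assumes q: "q \<in> U"
begin

lemma E1_in: "E1 q \<in> tangent_space A q" and E2_in: "E2 q \<in> tangent_space A q"
  by (rule vector_field_onD(1)[OF E1_vf q] vector_field_onD(1)[OF E2_vf q])+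

lemma g_frame:
  "g q (E1 q) (E1 q) = 1" "g q (E2 q) (E2 q) = 1" "g q (\<xi> q) (\<xi> q) = 1"
  "g q (E1 q) (E2 q) = 0" "g q (E2 q) (E1 q) = 0" "g q (E1 q) (\<xi> q) = 0"
  "g q (\<xi> q) (E1 q) = 0" "g q (E2 q) (\<xi> q) = 0" "g q (\<xi> q) (E2 q) = 0"
proof -
  show 1: "g q (E1 q) (E1 q) = 1" by (rule g_E1[OF q])
  show 2: "g q (\<xi> q) (E1 q) = 0" using g_\<xi>[OF E1_in] \<eta>_E1[OF q] by simp
  show 3: "g q (\<xi> q) (E2 q) = 0" using g_\<xi>[OF E2_in] \<eta>_\<phi>[OF E1_in] by (simp add: E2_def)
  show "g q (\<xi> q) (\<xi> q) = 1" using g_\<xi>[OF \<xi>_in] \<eta>_\<xi> by simp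
  show "g q (E1 q) (\<xi> q) = 0" "g q (E2 q) (\<xi> q) = 0"
    using g_sym[OF E1_in \<xi>_in] g_sym[OF E2_in \<xi>_in] 2 3 by simp_all
  show "g q (E2 q) (E2 q) = 1" using g_\<phi>_\<phi>[OF E1_in E1_in] 1 \<eta>_E1[OF q] by (simp add: E2_def)
  have "g q (E1 q) (E2 q) = - g q (E2 q) (E1 q)" using g_\<phi>_skew[OF E1_in E1_in] by (simp add: E2_def)
  then show "g q (E1 q) (E2 q) = 0" "g q (E2 q) (E1 q) = 0"
    using g_sym[OF E1_in E2_in] by simp_all
qed

lemma g_cmb_left: "w \<in> tangent_space A q \<Longrightarrow>
    g q (cmb a b c q) w = a * g q (E1 q) w + b * g q (E2 q) w + c * g q (\<xi> q) w"
  using linear_at_cmb[OF g_linear(1) q] by simp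

lemma g_cmb: "g q (cmb a b c q) (cmb a' b' c' q) = a * a' + b * b' + c * c'"
  by (simp add: g_cmb_left cmb_tangent q linear_at_cmb[OF g_linear(2) q] E1_in E2_in \<xi>_in g_frame)

lemma cmb_inject: "cmb a b c q = cmb a' b' c' q \<longleftrightarrow> a = a' \<and> b = b' \<and> c = c'"
proof
  assume e: "cmb a b c q = cmb a' b' c' q"
  have "a = g q (cmb a b c q) (cmb 1 0 0 q)" "a' = g q (cmb a' b' c' q) (cmb 1 0 0 q)"
    "b = g q (cmb a b c q) (cmb 0 1 0 q)" "b' = g q (cmb a' b' c' q) (cmb 0 1 0 q)"
    "c = g q (cmb a b c q) (cmb 0 0 1 q)" "c' = g q (cmb a' b' c' q) (cmb 0 0 1 q)"
    by (simp_all only: g_cmb; simp)+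
  with e show "a = a' \<and> b = b' \<and> c = c'" by metis
qed simp

lemma \<eta>_cmb: "\<eta> q (cmb a b c q) = c"
  by (simp add: linear_at_cmb[OF \<eta>_linear q] \<eta>_E1 q \<eta>_\<xi> E2_def \<eta>_\<phi> E1_in)

lemma \<phi>_cmb: "\<phi> q (cmb a b c q) = cmb (- b) a 0 q"
proof -
  have 2: "\<phi> q (E2 q) = (- 1) *\<^sub>t E1 q"
    unfolding E2_def \<phi>_\<phi>[OF E1_in] \<eta>_E1[OF q] by (rule ext) (simp add: tv_diff_def tv_scale_def)
  have "\<phi> q (cmb a b c q) = a *\<^sub>t \<phi> q (E1 q) +\<^sub>t (b *\<^sub>t \<phi> q (E2 q) +\<^sub>t c *\<^sub>t \<phi> q (\<xi> q))"
    by (simp add: cmb_def \<phi>_add \<phi>_scale tangent_scale tangent_add E1_in E2_in \<xi>_in)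
  also have "\<dots> = cmb (- b) a 0 q"
    unfolding 2 \<phi>_\<xi> E2_def[symmetric]
    by (rule ext) (simp add: cmb_def tv_add_def tv_scale_def tv_zero_def)
  finally show ?thesis .
qed

text \<open>This is where the dimension enters: the map from coefficients to chart components is an
  injective linear endomorphism of \<open>real^3\<close>, hence onto.\<close>

lemma ex_cmb:
  assumes u: "u \<in> tangent_space A q"
  shows "\<exists>a b c. u = cmb a b c q"
proof -
  obtain V d where V: "(V, d) \<in> A" "q \<in> V" using ex_chart[of q] by blast
  define F :: "real^3 \<Rightarrow> real^3" where "F x = (\<chi> i. cmb (x$1) (x$2) (x$3) q (\<lambda>q. d q $ i))" for x
  have "linear F"
    by (rule linearI) (simp_all add: F_def vec_eq_iff cmb_apply algebra_simps)
  moreover have "inj F"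
  proof (rule injI)
    fix x y assume "F x = F y"
    then have "cmb (x$1) (x$2) (x$3) q = cmb (y$1) (y$2) (y$3) q"
      using tangent_eq_chart_dir[OF V cmb_tangent[OF q]] unfolding F_def by metis
    then show "x = y" by (simp add: cmb_inject vec_eq_iff forall_3)
  qed
  ultimately have "surj F" by (rule linear_inj_imp_surj)
  then obtain x where x: "F x = (\<chi> i. u (\<lambda>q. d q $ i))" by (metis surjD)
  have "u = cmb (x$1) (x$2) (x$3) q"
    using tangent_eq_chart_dir[OF V u] tangent_eq_chart_dir[OF V cmb_tangent[OF q], of "x$1" "x$2" "x$3"] x
    unfolding F_def by metis
  then show ?thesis by auto
qed

lemma expand:
  assumes u: "u \<in> tangent_space A q"
  shows "u = cmb (g q u (E1 q)) (g q u (E2 q)) (g q u (\<xi> q)) q"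
proof -
  obtain a b c where "u = cmb a b c q" using ex_cmb[OF u] by auto
  then show ?thesis by (simp add: g_cmb_left E1_in E2_in \<xi>_in g_frame)
qed

end

text \<open>If h E1 = t E1 + s E2, the classical formula D xi = - phi - phi h predicts y = - s and z
  = - 1 - t. The coefficients stay independent until this is established. The remaining three,
  \<open>a\<close>, \<open>b\<close>, \<open>c\<close>, describe how \<open>E1\<close> and
  \<open>E2\<close> rotate into each other.\<close>

definition s where "s q = g q (D E1 \<xi> q) (E1 q)"
definition y where "y q = g q (D E2 \<xi> q) (E2 q)"
definition z where "z q = g q (D E1 \<xi> q) (E2 q)"
definition a where "a q = g q (D \<xi> E1 q) (E2 q)"
definition b where "b q = g q (D E1 E1 q) (E2 q)"
definition c where "c q = g q (D E2 E2 q) (E1 q)"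

lemma smooth_coeffs:
  "smooth_fun_on A U s" "smooth_fun_on A U y" "smooth_fun_on A U z" "smooth_fun_on A U a"
  "smooth_fun_on A U b" "smooth_fun_on A U c"
  unfolding s_def[abs_def] y_def[abs_def] z_def[abs_def] a_def[abs_def] b_def[abs_def] c_def[abs_def]
  by (intro g_smooth[OF openU] D_vector_field[OF openU] E1_vf E2_vf \<xi>_vf)+

context
  fixes q assumes q: "q \<in> U"
begin

lemma D_in: "vector_field_on A U X \<Longrightarrow> vector_field_on A U Y \<Longrightarrow> D X Y q \<in> tangent_space A q"
  by (rule vector_field_onD(1)[OF D_vector_field[OF openU] q])

lemma D_frame_skew:
  assumes X: "vector_field_on A U X" and Y: "vector_field_on A U Y" and Z: "vector_field_on A U Z"
    and k: "\<And>r. r \<in> U \<Longrightarrow> g r (Y r) (Z r) = k"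
  shows "g q (D X Y q) (Z q) = - g q (D X Z q) (Y q)"
proof -
  have "X q (\<lambda>r. g r (Y r) (Z r)) = X q (\<lambda>r. k)"
    by (rule tv_cong[OF vector_field_onD(1)[OF X q] openU q k])
  then have "g q (D X Y q) (Z q) + g q (Y q) (D X Z q) = 0"
    using metric_compatible[OF openU q X Y Z] tv_const[OF vector_field_onD(1)[OF X q]] by simp
  then show ?thesis using g_sym[OF vector_field_onD(1)[OF Y q] D_in[OF X Z]] by simp
qed

lemma D_skew:
  assumes X: "vector_field_on A U X"
  shows "g q (D X E1 q) (E1 q) = 0" "g q (D X E2 q) (E2 q) = 0" "g q (D X \<xi> q) (\<xi> q) = 0"
    "g q (D X E2 q) (E1 q) = - g q (D X E1 q) (E2 q)"
    "g q (D X E1 q) (\<xi> q) = - g q (D X \<xi> q) (E1 q)"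
    "g q (D X E2 q) (\<xi> q) = - g q (D X \<xi> q) (E2 q)"
  using D_frame_skew[OF X E1_vf E1_vf g_frame(1)] D_frame_skew[OF X E2_vf E2_vf g_frame(2)]
    D_frame_skew[OF X \<xi>_vf \<xi>_vf g_frame(3)] D_frame_skew[OF X E2_vf E1_vf g_frame(5)]
    D_frame_skew[OF X E1_vf \<xi>_vf g_frame(6)] D_frame_skew[OF X E2_vf \<xi>_vf g_frame(8)] by simp_all

text \<open>From d eta(E1, E2) = g(E1, phi E2) = - 1; the 2 stems from the normalisation of d
  eta.\<close>

lemma z2: "g q (D E2 \<xi> q) (E1 q) = z q + 2"
proof -
  have "\<phi> q (E2 q) = cmb (- 1) 0 0 q" using \<phi>_cmb[OF q, of 0 1 0] by (simp add: E2_cmb)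
  then have "g q (E1 q) (\<phi> q (E2 q)) = - 1"
    using g_cmb[OF q, of 1 0 0 "-1" 0 0] by (simp add: E1_cmb)
  then show ?thesis using ext_deriv_eq[OF openU q E1_vf E2_vf] by (simp add: z_def)
qed

text \<open>Each D_X is skew in an orthonormal frame. With D_xi xi = 0 and \<open>z2\<close>, six
  functions remain.\<close>

lemma D_table0:
  "D \<xi> \<xi> q = cmb 0 0 0 q"
  "D E1 \<xi> q = cmb (s q) (z q) 0 q"
  "D E2 \<xi> q = cmb (z q + 2) (y q) 0 q"
  "D \<xi> E1 q = cmb 0 (a q) 0 q"
  "D \<xi> E2 q = cmb (- a q) 0 0 q"
  "D E1 E1 q = cmb 0 (b q) (- s q) q"
  "D E1 E2 q = cmb (- b q) 0 (- z q) q"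
  "D E2 E1 q = cmb 0 (- c q) (- (z q + 2)) q"
  "D E2 E2 q = cmb (c q) 0 (- y q) q"
proof -
  note S = D_skew[OF E1_vf] D_skew[OF E2_vf] D_skew[OF \<xi>_vf]
  note X = expand[OF q D_in]
  show 0: "D \<xi> \<xi> q = cmb 0 0 0 q" by (simp add: D_\<xi>_\<xi> cmb_zero)
  show "D E1 \<xi> q = cmb (s q) (z q) 0 q"
    by (subst X[OF E1_vf \<xi>_vf]) (simp add: S s_def z_def)
  show "D E2 \<xi> q = cmb (z q + 2) (y q) 0 q"
    by (subst X[OF E2_vf \<xi>_vf]) (simp add: S z2 y_def)
  show "D \<xi> E1 q = cmb 0 (a q) 0 q"
    by (subst X[OF \<xi>_vf E1_vf]) (simp add: S D_\<xi>_\<xi> g_zero E1_in q a_def)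
  show "D \<xi> E2 q = cmb (- a q) 0 0 q"
    by (subst X[OF \<xi>_vf E2_vf]) (simp add: S D_\<xi>_\<xi> g_zero E2_in q a_def)
  show "D E1 E1 q = cmb 0 (b q) (- s q) q"
    by (subst X[OF E1_vf E1_vf]) (simp add: S b_def s_def)
  show "D E1 E2 q = cmb (- b q) 0 (- z q) q"
    by (subst X[OF E1_vf E2_vf]) (simp add: S b_def z_def)
  show "D E2 E1 q = cmb 0 (- c q) (- (z q + 2)) q"
    using S(10) by (subst X[OF E2_vf E1_vf]) (simp add: S z2 c_def)
  show "D E2 E2 q = cmb (c q) 0 (- y q) q"
    by (subst X[OF E2_vf E2_vf]) (simp add: S c_def y_def del: S(10))
qed

lemma lie_table:
  "lie_bracket A E1 E2 q = cmb (- b q) (c q) 2 q"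
  "lie_bracket A E2 \<xi> q = cmb (z q + 2 + a q) (y q) 0 q"
  "lie_bracket A \<xi> E1 q = cmb (- s q) (a q - z q) 0 q"
  "lie_bracket A \<xi> E2 q = cmb (- a q - z q - 2) (- y q) 0 q"
  "lie_bracket A E1 \<xi> q = cmb (s q) (z q - a q) 0 q"
  by (simp_all add: torsion_free[OF openU q E1_vf E2_vf] torsion_free[OF openU q E2_vf \<xi>_vf]
    torsion_free[OF openU q \<xi>_vf E1_vf] torsion_free[OF openU q \<xi>_vf E2_vf]
    torsion_free[OF openU q E1_vf \<xi>_vf] D_table0 cmb_diff cmb_inject[OF q])

lemma frame_derivs:
  assumes X: "vector_field_on A U X" and f: "smooth_fun_on A U f" and f': "smooth_fun_on A U f'"
  shows "X q (\<lambda>r. k) = 0" "X q (\<lambda>r. - f r) = - X q f" "X q (\<lambda>r. f r + f' r) = X q f + X q f'"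
    "X q (\<lambda>r. f r - f' r) = X q f - X q f'" "X q (\<lambda>r. f r * f' r) = f q * X q f' + X q f * f' q"
  using tv_const[OF vector_field_onD(1)[OF X q]] tv_minus_fun[OF vector_field_onD(1)[OF X q] openU q f]
    tv_add_fun[OF vector_field_onD(1)[OF X q] openU q f f'] tv_diff_fun[OF vector_field_onD(1)[OF X q] openU q f f']
    tv_mult_fun[OF vector_field_onD(1)[OF X q] openU q f f'] by simp_all

end

text \<open>Torsion-freeness expresses the nested brackets of the Jacobi identity through the known
  table of \<open>D\<close>, with the coefficients of \<open>W\<close> differentiated along
  \<open>Z\<close>.\<close>

lemma lie_cmb_left:
  assumes "q \<in> U" "vector_field_on A U W" "vector_field_on A U Z"
    and "smooth_fun_on A U \<alpha>" "smooth_fun_on A U \<beta>" "smooth_fun_on A U \<gamma>"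
    and "\<And>r. r \<in> U \<Longrightarrow> W r = cmb (\<alpha> r) (\<beta> r) (\<gamma> r) r"
  shows "lie_bracket A W Z q =
    (\<alpha> q *\<^sub>t D E1 Z q +\<^sub>t (\<beta> q *\<^sub>t D E2 Z q +\<^sub>t \<gamma> q *\<^sub>t D \<xi> Z q)) -\<^sub>t
    (cmb (Z q \<alpha>) (Z q \<beta>) (Z q \<gamma>) q +\<^sub>t
     (\<alpha> q *\<^sub>t D Z E1 q +\<^sub>t (\<beta> q *\<^sub>t D Z E2 q +\<^sub>t \<gamma> q *\<^sub>t D Z \<xi> q)))"
proof -
  have "D Z W q = cmb (Z q \<alpha>) (Z q \<beta>) (Z q \<gamma>) q +\<^sub>t
     (\<alpha> q *\<^sub>t D Z E1 q +\<^sub>t (\<beta> q *\<^sub>t D Z E2 q +\<^sub>t \<gamma> q *\<^sub>t D Z \<xi> q))"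
    by (rule D_right_cmb[OF assms(1,3-6)]) (rule assms(7))
  then show ?thesis
    by (simp only: torsion_free[OF openU assms(1-3)] D_left_cmb[OF assms(1-3) assms(7)[OF assms(1)]])
qed

text \<open>The third identity says that \<open>\<xi>\<close> is divergence free.\<close>

lemma jacobi_frame:
  assumes q: "q \<in> U"
  shows "c q * (z q + 2 + a q) + \<xi> q b - E1 q z - E1 q a + y q * b q + E2 q s = 0"
    and "- b q * z q - \<xi> q c + b q * a q - E1 q y - E2 q a + E2 q z - s q * c q = 0"
    and "y q = - s q"
proof -
  note sm = smooth_coeffs smooth_minus[OF openU] smooth_add[OF openU] smooth_diff[OF openU] smooth_const
  note fd = frame_derivs(1)[OF q _ smooth_const smooth_const] frame_derivs(2)[OF q _ _ smooth_const] frame_derivs(3,4)[OF q]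
  note T = D_table0[OF q] cmb_add cmb_diff cmb_scale
  have 1: "lie_bracket A (lie_bracket A E1 E2) \<xi> q =
      cmb (- b q * s q + c q * (z q + 2) + \<xi> q b + c q * a q) (- b q * z q + c q * y q - \<xi> q c + b q * a q) 0 q"
    by (subst lie_cmb_left[OF q lie_vector_field[OF openU E1_vf E2_vf] \<xi>_vf _ _ _ lie_table(1)])
      (intro sm, simp_all add: T fd \<xi>_vf sm cmb_inject[OF q])
  have "E1 q (\<lambda>r. z r + 2 + a r) = E1 q (\<lambda>r. z r + 2) + E1 q a"
    by (rule fd(3)[OF E1_vf]) (intro sm)+
  also have "E1 q (\<lambda>r. z r + 2) = E1 q z + E1 q (\<lambda>r. 2)"
    by (rule fd(3)[OF E1_vf]) (intro sm)+
  finally have d: "E1 q (\<lambda>r. z r + 2 + a r) = E1 q z + E1 q a"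
    by (simp add: fd(1)[OF E1_vf])
  have 2: "lie_bracket A (lie_bracket A E2 \<xi>) E1 q =
      cmb (- E1 q z - E1 q a + y q * b q) (- y q * c q - E1 q y) (- 2 * y q) q"
    by (subst lie_cmb_left[OF q lie_vector_field[OF openU E2_vf \<xi>_vf] E1_vf _ _ _ lie_table(2)])
      (simp_all add: T d fd(1) E1_vf sm cmb_inject[OF q], simp add: algebra_simps)
  have 3: "lie_bracket A (lie_bracket A \<xi> E1) E2 q =
      cmb (s q * b q + E2 q s) (- E2 q a + E2 q z - s q * c q) (- 2 * s q) q"
    by (subst lie_cmb_left[OF q lie_vector_field[OF openU \<xi>_vf E1_vf] E2_vf _ _ _ lie_table(3)])
      (intro sm, simp_all add: T fd E2_vf sm cmb_inject[OF q] algebra_simps)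
  have "lie_bracket A (lie_bracket A E1 E2) \<xi> q +\<^sub>t lie_bracket A (lie_bracket A E2 \<xi>) E1 q +\<^sub>t
      lie_bracket A (lie_bracket A \<xi> E1) E2 q = cmb 0 0 0 q"
    unfolding cmb_zero tv_add_def tv_zero_def
    by (rule ext) (rule jacobi[OF openU q E1_vf E2_vf \<xi>_vf])
  then have J: "- b q * s q + c q * (z q + 2) + \<xi> q b + c q * a q + (- E1 q z - E1 q a + y q * b q) + (s q * b q + E2 q s) = 0 \<and>
    - b q * z q + c q * y q - \<xi> q c + b q * a q + (- y q * c q - E1 q y) + (- E2 q a + E2 q z - s q * c q) = 0 \<and>
    0 + - 2 * y q + - 2 * s q = 0"
    unfolding 1 2 3 cmb_add cmb_inject[OF q] .
  show "c q * (z q + 2 + a q) + \<xi> q b - E1 q z - E1 q a + y q * b q + E2 q s = 0"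
    using J by (simp add: algebra_simps)
  show "- b q * z q - \<xi> q c + b q * a q - E1 q y - E2 q a + E2 q z - s q * c q = 0"
    using J by (simp add: algebra_simps)
  show "y q = - s q" using J by simp
qed

definition t where "t q = - 1 - z q"

lemma smooth_t: "smooth_fun_on A U t"
  unfolding t_def[abs_def] by (intro smooth_diff openU smooth_const smooth_coeffs)

lemma y_z:
  assumes "q \<in> U"
  shows "y q = - s q" "z q = - 1 - t q"
  using jacobi_frame(3)[OF assms] by (simp_all add: t_def)

text \<open>The brackets with xi give the off-diagonal entry as (s - y) / 2, which equals s because
  xi is divergence free.\<close>

lemma h_frame:
  assumes q: "q \<in> U"
  shows "h q (E1 q) = cmb (t q) (s q) 0 q" "h q (E2 q) = cmb (s q) (- t q) 0 q"
proof -
  note T = lie_table[OF q] cmb_add cmb_diff cmb_scale \<phi>_cmb[OF q]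
  show "h q (E1 q) = cmb (t q) (s q) 0 q"
    unfolding h_field[OF openU q E1_vf] L\<xi>\<phi>_def E2_def[symmetric]
    by (simp add: T cmb_inject[OF q] y_z[OF q] field_simps)
  have "lie_bracket A \<xi> (\<lambda>q. \<phi> q (E2 q)) q = lie_bracket A \<xi> (\<lambda>q. (-1) *\<^sub>t E1 q) q"
    by (rule lie_cong_right[OF openU q \<xi>_vf vector_field_scale[OF E1_vf smooth_const]])
      (simp add: E2_cmb \<phi>_cmb E1_cmb cmb_scale)
  also have "\<dots> = cmb (s q) (z q - a q) 0 q"
    unfolding lie_scale_right[OF openU q \<xi>_vf E1_vf smooth_const] tv_const[OF \<xi>_in]
    by (simp add: T E1_cmb)
  finally show "h q (E2 q) = cmb (s q) (- t q) 0 q"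
    unfolding h_field[OF openU q E2_vf] L\<xi>\<phi>_def
    by (simp add: T cmb_inject[OF q] y_z[OF q] field_simps)
qed

lemma h_cmb:
  assumes q: "q \<in> U"
  shows "h q (cmb a' b' c' q) = cmb (a' * t q + b' * s q) (a' * s q - b' * t q) 0 q"
proof -
  have l: "linear_at A q (\<lambda>u. h q u f)" for f
    unfolding linear_at_def by (intro ballI allI) (simp only: h_lin, simp add: tv_add_def tv_scale_def)
  show ?thesis
    by (rule ext) (simp add: linear_at_cmb[OF l q] h_frame[OF q] h_\<xi> cmb_apply tv_zero_def algebra_simps)
qed

end

section \<open>Frames of eigenvectors\<close>

context adapted_frame
begin

lemma D_table:
  assumes q: "q \<in> U"
  shows "D E1 (D \<xi> \<xi>) q = cmb 0 0 0 q" "D E2 (D \<xi> \<xi>) q = cmb 0 0 0 q"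
    and "D \<xi> (D E1 \<xi>) q = cmb (\<xi> q s - z q * a q) (\<xi> q z + s q * a q) 0 q"
    and "D \<xi> (D E2 \<xi>) q = cmb (\<xi> q z - y q * a q) (\<xi> q y + (z q + 2) * a q) 0 q"
    and "D E1 (D E2 \<xi>) q = cmb (E1 q z - y q * b q) (E1 q y + (z q + 2) * b q) (- (z q + 2) * s q - y q * z q) q"
    and "D E2 (D E1 \<xi>) q = cmb (E2 q s + z q * c q) (E2 q z - s q * c q) (- s q * (z q + 2) - z q * y q) q"
proof -
  note sm = smooth_coeffs smooth_add[OF openU] smooth_const
  note T = D_table0[OF q] cmb_add cmb_scale cmb_inject[OF q]
  have z2: "X q (\<lambda>r. z r + 2) = X q z" if X: "vector_field_on A U X" for X
    using frame_derivs(3)[OF q X smooth_coeffs(3) smooth_const, of 2]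
      frame_derivs(1)[OF q X smooth_const smooth_const, of 2] by simp
  note fd = z2[OF E1_vf] z2[OF E2_vf] z2[OF \<xi>_vf] tv_const[OF vector_field_onD(1)[OF E1_vf q]]
    tv_const[OF vector_field_onD(1)[OF E2_vf q]] tv_const[OF vector_field_onD(1)[OF \<xi>_vf q]]
  show "D E1 (D \<xi> \<xi>) q = cmb 0 0 0 q"
    by (subst D_right_cmb[OF q E1_vf _ _ _ D_table0(1)]) (simp_all add: T fd)
  show "D E2 (D \<xi> \<xi>) q = cmb 0 0 0 q"
    by (subst D_right_cmb[OF q E2_vf _ _ _ D_table0(1)]) (simp_all add: T fd)
  show "D \<xi> (D E1 \<xi>) q = cmb (\<xi> q s - z q * a q) (\<xi> q z + s q * a q) 0 q"
    by (subst D_right_cmb[OF q \<xi>_vf _ _ _ D_table0(2)]) (simp_all add: T fd sm)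
  show "D \<xi> (D E2 \<xi>) q = cmb (\<xi> q z - y q * a q) (\<xi> q y + (z q + 2) * a q) 0 q"
    by (subst D_right_cmb[OF q \<xi>_vf _ _ _ D_table0(3)]) (simp_all add: T fd sm)
  show "D E1 (D E2 \<xi>) q = cmb (E1 q z - y q * b q) (E1 q y + (z q + 2) * b q) (- (z q + 2) * s q - y q * z q) q"
    by (subst D_right_cmb[OF q E1_vf _ _ _ D_table0(3)]) (simp_all add: T fd sm, simp add: algebra_simps)
  show "D E2 (D E1 \<xi>) q = cmb (E2 q s + z q * c q) (E2 q z - s q * c q) (- s q * (z q + 2) - z q * y q) q"
    by (subst D_right_cmb[OF q E2_vf _ _ _ D_table0(2)]) (simp_all add: T fd sm, simp add: algebra_simps)
qed

text \<open>Components of R(E1, xi) xi, R(E2, xi) xi and R(E1, E2) xi. The last is 0 because eta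
  vanishes on \<open>E1\<close> and \<open>E2\<close>; it relates the derivatives of h along the
  contact plane to \<open>b\<close> and \<open>c\<close>.\<close>

lemma curvature_frame:
  assumes q: "q \<in> U"
  shows "- \<xi> q s + z q * a q - s q * s q - (z q - a q) * (z q + 2) = \<kappa> q + \<mu> q * t q - \<nu> q * s q"
    and "- \<xi> q z - s q * a q - s q * z q - (z q - a q) * y q = \<mu> q * s q + \<nu> q * t q"
    and "- \<xi> q y - (z q + 2) * a q - (z q + 2 + a q) * z q - y q * y q = \<kappa> q - \<mu> q * t q + \<nu> q * s q"
    and "E1 q z - y q * b q - E2 q s - z q * c q + b q * s q - c q * (z q + 2) = 0"
    and "E1 q y + (z q + 2) * b q - E2 q z + s q * c q + b q * z q - c q * y q = 0"
proof -
  note l = D_left_cmb[OF q lie_vector_field[OF openU E1_vf \<xi>_vf] \<xi>_vf lie_table(5)[OF q]]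
    D_left_cmb[OF q lie_vector_field[OF openU E2_vf \<xi>_vf] \<xi>_vf lie_table(2)[OF q]]
    D_left_cmb[OF q lie_vector_field[OF openU E1_vf E2_vf] \<xi>_vf lie_table(1)[OF q]]
  note R = curv_def D_table[OF q] l D_table0[OF q] cmb_add cmb_diff cmb_scale
  note \<eta>s = \<eta>_\<xi> \<eta>_cmb[OF q, of 1 0 0, folded E1_cmb] \<eta>_cmb[OF q, of 0 1 0, folded E2_cmb]
  have "curv E1 \<xi> \<xi> q = \<kappa> q *\<^sub>t cmb 1 0 0 q +\<^sub>t \<mu> q *\<^sub>t cmb (t q) (s q) 0 q +\<^sub>t \<nu> q *\<^sub>t cmb (- s q) (t q) 0 q"
    unfolding curvature_eq_curv[OF openU q E1_vf \<xi>_vf \<xi>_vf, symmetric] curvature_\<xi>[OF E1_in[OF q] \<xi>_in] \<eta>s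
      h_frame[OF q] h_\<xi> \<phi>_cmb[OF q]
    by (rule ext) (simp add: tv_add_def tv_scale_def tv_diff_def cmb_apply)
  then show "- \<xi> q s + z q * a q - s q * s q - (z q - a q) * (z q + 2) = \<kappa> q + \<mu> q * t q - \<nu> q * s q"
    "- \<xi> q z - s q * a q - s q * z q - (z q - a q) * y q = \<mu> q * s q + \<nu> q * t q"
    by (simp_all add: R cmb_inject[OF q] algebra_simps)
  have "curv E2 \<xi> \<xi> q = \<kappa> q *\<^sub>t cmb 0 1 0 q +\<^sub>t \<mu> q *\<^sub>t cmb (s q) (- t q) 0 q +\<^sub>t \<nu> q *\<^sub>t cmb (t q) (s q) 0 q"
    unfolding curvature_eq_curv[OF openU q E2_vf \<xi>_vf \<xi>_vf, symmetric] curvature_\<xi>[OF E2_in[OF q] \<xi>_in] \<eta>s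
      h_frame[OF q] h_\<xi> \<phi>_cmb[OF q]
    by (rule ext) (simp add: tv_add_def tv_scale_def tv_diff_def cmb_apply)
  then show "- \<xi> q y - (z q + 2) * a q - (z q + 2 + a q) * z q - y q * y q = \<kappa> q - \<mu> q * t q + \<nu> q * s q"
    by (simp add: R cmb_inject[OF q] algebra_simps)
  have "curv E1 E2 \<xi> q = cmb 0 0 0 q"
    unfolding curvature_eq_curv[OF openU q E1_vf E2_vf \<xi>_vf, symmetric] curvature_\<xi>[OF E1_in[OF q] E2_in[OF q]] \<eta>s
    by (rule ext) (simp add: tv_add_def tv_scale_def tv_diff_def cmb_apply)
  then show "E1 q z - y q * b q - E2 q s - z q * c q + b q * s q - c q * (z q + 2) = 0"
    "E1 q y + (z q + 2) * b q - E2 q z + s q * c q + b q * z q - c q * y q = 0"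
    by (simp_all add: R cmb_inject[OF q] algebra_simps)
qed

text \<open>Adding the two diagonal equations takes the trace of u -> R(u, xi) xi. The terms in mu
  and nu drop out since h and phi h are trace free. In the frame this is the known h^2 = (kappa - 1)
  phi^2.\<close>

lemma h_norm:
  assumes q: "q \<in> U"
  shows "s q * s q + t q * t q = 1 - \<kappa> q"
proof -
  have "\<xi> q y = \<xi> q (\<lambda>r. - s r)"
    by (rule tv_cong[OF \<xi>_in openU q]) (rule y_z(1))
  also have "\<dots> = - \<xi> q s"
    by (rule tv_minus_fun[OF \<xi>_in openU q smooth_coeffs(1)])
  finally have "\<xi> q y = - \<xi> q s" .
  with curvature_frame(1,3)[OF q] y_z[OF q] show ?thesis by (simp add: algebra_simps)
qed

end

section \<open>Local existence of orthonormal frames and of eigenframes\<close>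

context contact3
begin

definition lam :: "'m \<Rightarrow> real" where "lam p = sqrt (1 - \<kappa> p)"

lemma lam_pos: "lam p > 0"
  using \<kappa>_less_1[of p] by (simp add: lam_def)

lemma lam_sq: "lam p * lam p = 1 - \<kappa> p"
  using \<kappa>_less_1[of p] by (simp add: lam_def)

lemma smooth_lam: "smooth_fun_on A UNIV lam"
  unfolding lam_def[abs_def]
  by (rule smooth_sqrt[OF open_UNIV]) (intro smooth_diff open_UNIV smooth_const smooth_\<kappa>, simp add: \<kappa>_less_1)

text \<open>Positivity of the squared norm at p persists on a neighbourhood, and there the
  reciprocal of its root is smooth.\<close>

lemma normalise_field:
  assumes V: "open V" "p \<in> V" "vector_field_on A V X" and X: "X p \<noteq> tv_zero"
  obtains U where "open U" "p \<in> U" "U \<subseteq> V" "vector_field_on A U (\<lambda>q. (1 / sqrt (g q (X q) (X q))) *\<^sub>t X q)"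
    "\<And>q. q \<in> U \<Longrightarrow> g q ((1 / sqrt (g q (X q) (X q))) *\<^sub>t X q) ((1 / sqrt (g q (X q) (X q))) *\<^sub>t X q) = 1"
proof -
  define N where "N q = g q (X q) (X q)" for q
  define U where "U = {q \<in> V. N q > 0}"
  have sN: "smooth_fun_on A V N" unfolding N_def by (rule g_smooth[OF V(1,3,3)])
  have U: "open U" "U \<subseteq> V" unfolding U_def by (rule open_pos_set[OF V(1) sN]) auto
  have p: "p \<in> U" using V(2) g_pos[OF vector_field_onD(1)[OF V(3,2)] X] by (simp add: U_def N_def)
  have pos: "N q > 0" if "q \<in> U" for q using that by (simp add: U_def)
  have "smooth_fun_on A U (\<lambda>q. 1 / sqrt (N q))"
    by (rule smooth_inverse[OF U(1) smooth_sqrt[OF U(1) smooth_fun_on_subset[OF sN U(2)] pos]])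
      (simp_all add: pos)
  then have vf: "vector_field_on A U (\<lambda>q. (1 / sqrt (N q)) *\<^sub>t X q)"
    by (rule vector_field_scale[OF vector_field_on_subset[OF V(3) U(2)]])
  have one: "g q ((1 / sqrt (N q)) *\<^sub>t X q) ((1 / sqrt (N q)) *\<^sub>t X q) = 1" if q: "q \<in> U" for q
  proof -
    have T: "X q \<in> tangent_space A q" using vector_field_onD(1)[OF V(3)] q U(2) by auto
    have sc: "g q (k *\<^sub>t X q) w = k * g q (X q) w" "g q w (k *\<^sub>t X q) = k * g q w (X q)"
      if w: "w \<in> tangent_space A q" for w k
      using linear_atD[OF g_linear(1)[OF w] T T, of k 0] linear_atD[OF g_linear(2)[OF w] T T, of k 0]
      by (simp_all add: tv_add_def tv_scale_def)
    show ?thesis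
      unfolding sc(1)[OF tangent_scale[OF T]] sc(2)[OF T] N_def[symmetric]
      using pos[OF q] by (simp add: field_simps)
  qed
  show ?thesis by (rule that[OF U(1) p U(2) vf[unfolded N_def] one[unfolded N_def]])
qed

lemma \<eta>_scale: "u \<in> tangent_space A p \<Longrightarrow> \<eta> p (k *\<^sub>t u) = k * \<eta> p u"
  using linear_atD[OF \<eta>_linear, of u p u k 0] by (simp add: tv_add_def tv_scale_def)

text \<open>Project the coordinate fields along xi to the kernel of eta. At least one projection
  survives at p, since the coordinate vectors cannot all be multiples of xi.\<close>

lemma ex_adapted_frame:
  "\<exists>U E1. p \<in> U \<and> adapted_frame A g D \<phi> \<xi> \<eta> \<kappa> \<mu> \<nu> U E1"
proof -
  obtain V d where V: "(V, d) \<in> A" "p \<in> V" using ex_chart[of p] by blast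
  define d' where "d' i q = chart_dir A (V, d) q (axis i 1)" for i q
  define X where "X i q = d' i q -\<^sub>t \<eta> q (d' i q) *\<^sub>t \<xi> q" for i q
  note oV = chartD(1)[OF V(1)]
  have d_vf: "vector_field_on A V (d' i)" for i
    unfolding d'_def by (rule vector_field_chart_dir[OF V(1)])
  have X_vf: "vector_field_on A V (X i)" for i
    unfolding X_def by (intro vector_field_diff vector_field_scale d_vf \<xi>_vf \<eta>_smooth oV)
  have \<eta>_X: "\<eta> q (X i q) = 0" if "q \<in> V" for i q
  proof -
    have "X i q = 1 *\<^sub>t d' i q +\<^sub>t (- \<eta> q (d' i q)) *\<^sub>t \<xi> q"
      unfolding X_def by (rule ext) (simp add: tv_add_def tv_scale_def tv_diff_def)
    then show ?thesis
      by (simp add: linear_atD[OF \<eta>_linear vector_field_onD(1)[OF d_vf that] \<xi>_in] \<eta>_\<xi>)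
  qed
  have "\<exists>i. X i p \<noteq> tv_zero"
  proof (rule ccontr)
    assume "\<not> ?thesis"
    then have "X i p f = tv_zero f" for i f by simp
    then have e: "d' i p f = \<eta> p (d' i p) * \<xi> p f" for i f
      by (simp add: X_def tv_zero_def tv_diff_def tv_scale_def)
    have ax: "d' i p (\<lambda>q. d q $ j) = (if i = j then 1 else 0)" for i j
      unfolding d'_def chart_dir_coordinate[OF V] by (simp add: axis_def)
    \<comment> \<open>The first two equations make both factors of the third product
      nonzero.\<close>
    have "1 = \<eta> p (d' 1 p) * \<xi> p (\<lambda>q. d q $ 1)" "1 = \<eta> p (d' 2 p) * \<xi> p (\<lambda>q. d q $ 2)"
      "0 = \<eta> p (d' 1 p) * \<xi> p (\<lambda>q. d q $ 2)"
      using e[of 1 "\<lambda>q. d q $ 1"] e[of 2 "\<lambda>q. d q $ 2"] e[of 1 "\<lambda>q. d q $ 2"] by (simp_all add: ax)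
    then show False by auto
  qed
  then obtain i where i: "X i p \<noteq> tv_zero" by blast
  define F where "F q = (1 / sqrt (g q (X i q) (X i q))) *\<^sub>t X i q" for q
  obtain U where U: "open U" "p \<in> U" "U \<subseteq> V" "vector_field_on A U F" "\<And>q. q \<in> U \<Longrightarrow> g q (F q) (F q) = 1"
    by (rule normalise_field[OF oV V(2) X_vf i, folded F_def]) (rule that)
  have "\<eta> q (F q) = 0" if "q \<in> U" for q
    unfolding F_def \<eta>_scale[OF vector_field_onD(1)[OF X_vf subsetD[OF U(3) that]]] \<eta>_X[OF subsetD[OF U(3) that]] by simp
  then have "adapted_frame A g D \<phi> \<xi> \<eta> \<kappa> \<mu> \<nu> U F"
    by unfold_locales (use U in simp_all)
  with U(2) show ?thesis by blast
qed

end

locale eigen_frame = adapted_frame +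
  assumes h_E1: "q \<in> U \<Longrightarrow> h q (E1 q) = lam q *\<^sub>t E1 q"

lemma (in adapted_frame) eigen_frameI:
  assumes X: "vector_field_on A U X" and \<eta>X: "\<And>q. q \<in> U \<Longrightarrow> \<eta> q (X q) = 0"
    and hX: "\<And>q. q \<in> U \<Longrightarrow> h q (X q) = lam q *\<^sub>t X q"
    and p: "p \<in> U" "X p \<noteq> tv_zero"
  shows "\<exists>U E1. p \<in> U \<and> eigen_frame A g D \<phi> \<xi> \<eta> \<kappa> \<mu> \<nu> U E1"
proof -
  define k where "k q = 1 / sqrt (g q (X q) (X q))" for q
  define F where "F q = k q *\<^sub>t X q" for q
  obtain V where V: "open V" "p \<in> V" "V \<subseteq> U" "vector_field_on A V F" "\<And>q. q \<in> V \<Longrightarrow> g q (F q) (F q) = 1"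
    by (rule normalise_field[OF openU p(1) X p(2), folded k_def, folded F_def]) (rule that)
  have T: "X q \<in> tangent_space A q" if "q \<in> V" for q
    using vector_field_onD(1)[OF X] that V(3) by auto
  have "\<eta> q (F q) = 0" if "q \<in> V" for q
    unfolding F_def \<eta>_scale[OF T[OF that]] using \<eta>X that V(3) by auto
  moreover have "h q (F q) = lam q *\<^sub>t F q" if "q \<in> V" for q
  proof -
    have "h q (X q) = lam q *\<^sub>t X q" using hX that V(3) by auto
    then show ?thesis
      unfolding F_def h_scale[OF T[OF that]] by (simp add: tv_scale_def mult_ac)
  qed
  ultimately have "eigen_frame A g D \<phi> \<xi> \<eta> \<kappa> \<mu> \<nu> V F"
    by unfold_locales (use V in simp_all)
  with V(2) show ?thesis by blast
qed

text \<open>On the contact plane h has the matrix with rows (t, s) and (s, -t), where s^2 + t^2 =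
  lam^2. Hence the columns (t + lam, s) and (s, lam - t) of h + lam are smooth and satisfy h X = lam
  X. They cannot both vanish at p: if t = - lam, the second has the entry 2 lam > 0.\<close>

lemma (in contact3) ex_eigen_frame:
  "\<exists>U E1. p \<in> U \<and> eigen_frame A g D \<phi> \<xi> \<eta> \<kappa> \<mu> \<nu> U E1"
proof -
  obtain U E1 where p: "p \<in> U" and "adapted_frame A g D \<phi> \<xi> \<eta> \<kappa> \<mu> \<nu> U E1"
    using ex_adapted_frame[of p] by blast
  then interpret adapted_frame A g D \<phi> \<xi> \<eta> \<kappa> \<mu> \<nu> U E1 by blast
  note sl = smooth_fun_on_subset[OF smooth_lam subset_UNIV, of U]
  have st: "s q * s q = lam q * lam q - t q * t q" if "q \<in> U" for q
    using h_norm[OF that] lam_sq[of q] by simp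
  show ?thesis
  proof (cases "t p + lam p = 0 \<and> s p = 0")
    case False
    show ?thesis
    proof (rule eigen_frameI[OF cmb_vf _ _ p])
      show "smooth_fun_on A U (\<lambda>q. t q + lam q)" "smooth_fun_on A U s" "smooth_fun_on A U (\<lambda>q. 0)"
        by (intro smooth_add openU smooth_t sl smooth_coeffs smooth_const)+
      show "\<eta> q (cmb (t q + lam q) (s q) 0 q) = 0" if "q \<in> U" for q by (rule \<eta>_cmb[OF that])
      show "h q (cmb (t q + lam q) (s q) 0 q) = lam q *\<^sub>t cmb (t q + lam q) (s q) 0 q" if "q \<in> U" for q
        unfolding h_cmb[OF that] cmb_scale cmb_inject[OF that] using st[OF that] by (simp add: algebra_simps)
      show "cmb (t p + lam p) (s p) 0 p \<noteq> tv_zero"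
        unfolding cmb_zero[of p, symmetric] cmb_inject[OF p] using False by simp
    qed
  next
    case True
    show ?thesis
    proof (rule eigen_frameI[OF cmb_vf _ _ p])
      show "smooth_fun_on A U s" "smooth_fun_on A U (\<lambda>q. lam q - t q)" "smooth_fun_on A U (\<lambda>q. 0)"
        by (intro smooth_diff openU smooth_t sl smooth_coeffs smooth_const)+
      show "\<eta> q (cmb (s q) (lam q - t q) 0 q) = 0" if "q \<in> U" for q by (rule \<eta>_cmb[OF that])
      show "h q (cmb (s q) (lam q - t q) 0 q) = lam q *\<^sub>t cmb (s q) (lam q - t q) 0 q" if "q \<in> U" for q
        unfolding h_cmb[OF that] cmb_scale cmb_inject[OF that] using st[OF that] by (simp add: algebra_simps)
      show "cmb (s p) (lam p - t p) 0 p \<noteq> tv_zero"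
        unfolding cmb_zero[of p, symmetric] cmb_inject[OF p] using True lam_pos[of p] by simp
    qed
  qed
qed

section \<open>Structure equations in an eigenframe\<close>

locale invariant_eigen_frame = eigen_frame A g D \<phi> \<xi> \<eta> \<kappa> \<mu> \<nu> U E1
  for A :: "('m::{t2_space, second_countable_topology}, 3) chart set" and g D \<phi> \<xi> \<eta> \<kappa> \<mu> \<nu> U E1 +
  fixes k :: real
  assumes \<nu>_const: "\<nu> q = k" and \<xi>_I: "\<xi> q (I_inv \<kappa> \<mu>) = 0"
begin

lemma coeffs:
  assumes q: "q \<in> U"
  shows "s q = 0" "t q = lam q" "y q = 0" "z q = - 1 - lam q"
proof -
  have "cmb (t q) (s q) 0 q = cmb (lam q) 0 0 q"
    using h_E1[OF q] h_frame(1)[OF q] by (simp add: E1_cmb cmb_scale)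
  then show "s q = 0" "t q = lam q" by (simp_all add: cmb_inject[OF q])
  with y_z[OF q] show "y q = 0" "z q = - 1 - lam q" by simp_all
qed

lemma smooth_lam': "smooth_fun_on A U lam"
  by (rule smooth_fun_on_subset[OF smooth_lam subset_UNIV])

lemma coeff_derivs:
  assumes X: "vector_field_on A U X" and q: "q \<in> U"
  shows "X q s = 0" "X q y = 0" "X q z = - X q lam"
proof -
  note T = vector_field_onD(1)[OF X q]
  show "X q s = 0" using tv_cong[OF T openU q, of s "\<lambda>r. 0"] coeffs(1) tv_const[OF T] by simp
  show "X q y = 0" using tv_cong[OF T openU q, of y "\<lambda>r. 0"] coeffs(3) tv_const[OF T] by simp
  show "X q z = - X q lam"
    using tv_cong[OF T openU q, of z "\<lambda>r. - 1 - lam r"] coeffs(4) tv_const[OF T, of "-1"]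
      tv_diff_fun[OF T openU q smooth_const smooth_lam', of "-1"] by simp
qed

text \<open>With s = y = 0 and z = - 1 - lam each curvature equation determines one unknown. The
  equation for \<open>a\<close> carries a factor lam, which can be cancelled because kappa <
  1.\<close>

lemma first_order:
  assumes q: "q \<in> U"
  shows "a q = - \<mu> q / 2" "\<xi> q lam = k * lam q" "E1 q lam = 2 * lam q * c q" "E2 q lam = 2 * lam q * b q"
proof -
  note d = coeff_derivs[OF E1_vf q] coeff_derivs[OF E2_vf q] coeff_derivs[OF \<xi>_vf q]
  note R = curvature_frame[OF q, unfolded coeffs[OF q] d]
  have "2 * a q * lam q = - \<mu> q * lam q"
    using R(1) lam_sq[of q] by (simp add: algebra_simps)
  then have "(2 * a q + \<mu> q) * lam q = 0" by (simp add: algebra_simps)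
  then have "2 * a q + \<mu> q = 0" using lam_pos[of q] by simp
  then show "a q = - \<mu> q / 2" by simp
  show "\<xi> q lam = k * lam q" using R(2) by (simp add: \<nu>_const)
  show "E1 q lam = 2 * lam q * c q" using R(4) by (simp add: algebra_simps)
  show "E2 q lam = 2 * lam q * b q" using R(5) by (simp add: algebra_simps)
qed

text \<open>\<open>F\<close> and \<open>G\<close> stand for the known first derivatives of
  \<open>f\<close>. They must hold on all of \<open>U\<close>, since they are differentiated once
  more.\<close>

lemma bracket_apply:
  assumes q: "q \<in> U" and f: "smooth_fun_on A U f"
    and X: "\<And>r. r \<in> U \<Longrightarrow> X r f = F r" and Y: "\<And>r. r \<in> U \<Longrightarrow> Y r f = G r"
    and vf: "vector_field_on A U X" "vector_field_on A U Y"
  shows "lie_bracket A X Y q f = X q G - Y q F"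
proof -
  have "X q (\<lambda>r. Y r f) = X q G" by (rule tv_cong[OF vector_field_onD(1)[OF vf(1) q] openU q Y])
  moreover have "Y q (\<lambda>r. X r f) = Y q F" by (rule tv_cong[OF vector_field_onD(1)[OF vf(2) q] openU q X])
  moreover have "smooth_fun_near A q f" using q openU f unfolding smooth_fun_near_def by auto
  ultimately show ?thesis by (simp add: lie_bracket_def)
qed

text \<open>Apply [E2, xi] and [xi, E1] to lam: since k is constant, the terms containing it cancel,
  and dividing by 2 lam yields xi(b) and xi(c). The Jacobi equations then have E1(a) and E2(a) as
  their only unknowns.\<close>

lemma second_order:
  assumes q: "q \<in> U"
  shows "\<xi> q b = - (1 - lam q + a q) * c q" "\<xi> q c = (1 + lam q + a q) * b q"
    "E1 q a = 2 * lam q * c q" "E2 q a = - 2 * lam q * b q"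
proof -
  note sm = smooth_mult[OF openU] smooth_const smooth_lam' smooth_coeffs
  have mult: "X q (\<lambda>r. k1 * f r) = k1 * X q f" "X q (\<lambda>r. 2 * lam r * f r) = 2 * lam q * X q f + 2 * X q lam * f q"
    if X: "vector_field_on A U X" and f: "smooth_fun_on A U f" for X f k1
    using frame_derivs(5)[OF q X smooth_const f, of k1] frame_derivs(5)[OF q X _ f, of "\<lambda>r. 2 * lam r"]
      frame_derivs(5)[OF q X smooth_const smooth_lam', of 2] frame_derivs(1)[OF q X f f]
    by (simp_all add: sm)
  have "lie_bracket A E2 \<xi> q lam = E2 q (\<lambda>r. k * lam r) - \<xi> q (\<lambda>r. 2 * lam r * b r)"
    by (rule bracket_apply[OF q smooth_lam' first_order(4) first_order(2) E2_vf \<xi>_vf])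
  then have "(1 - lam q + a q) * (2 * lam q * c q) = - 2 * lam q * \<xi> q b"
    unfolding mult(1)[OF E2_vf smooth_lam'] mult(2)[OF \<xi>_vf smooth_coeffs(5)] lie_table[OF q] cmb_apply
      coeffs[OF q] first_order(2-4)[OF q]
    by (simp add: algebra_simps)
  then have "2 * lam q * (\<xi> q b + (1 - lam q + a q) * c q) = 0" by (simp add: algebra_simps)
  then have "\<xi> q b + (1 - lam q + a q) * c q = 0" using lam_pos[of q] by simp
  then show xb: "\<xi> q b = - (1 - lam q + a q) * c q" by (simp add: algebra_simps)
  have "lie_bracket A \<xi> E1 q lam = \<xi> q (\<lambda>r. 2 * lam r * c r) - E1 q (\<lambda>r. k * lam r)"
    by (rule bracket_apply[OF q smooth_lam' first_order(2) first_order(3) \<xi>_vf E1_vf])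
  then have "(1 + lam q + a q) * (2 * lam q * b q) = 2 * lam q * \<xi> q c"
    unfolding mult(1)[OF E1_vf smooth_lam'] mult(2)[OF \<xi>_vf smooth_coeffs(6)] lie_table[OF q] cmb_apply
      coeffs[OF q] first_order(2-4)[OF q]
    by (simp add: algebra_simps)
  then have "2 * lam q * (\<xi> q c - (1 + lam q + a q) * b q) = 0" by (simp add: algebra_simps)
  then show xc: "\<xi> q c = (1 + lam q + a q) * b q" using lam_pos[of q] by simp
  note d = coeff_derivs[OF E1_vf q] coeff_derivs[OF E2_vf q] coeff_derivs[OF \<xi>_vf q]
  note J = jacobi_frame(1,2)[OF q, unfolded coeffs[OF q] d]
  show "E1 q a = 2 * lam q * c q" using J(1) xb first_order(3)[OF q] by (simp add: algebra_simps)
  show "E2 q a = - 2 * lam q * b q" using J(2) xc first_order(4)[OF q] by (simp add: algebra_simps)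
qed

text \<open>As a = - mu / 2, the product lam I equals 1 + a. If I is constant along xi, then 1 + a
  changes along xi at the same relative rate k as lam.\<close>

lemma \<xi>_a:
  assumes q: "q \<in> U"
  shows "\<xi> q a = k * (1 + a q)"
proof -
  have I: "lam r * I_inv \<kappa> \<mu> r = 1 + a r" if "r \<in> U" for r
    using lam_pos[of r] first_order(1)[OF that] by (simp add: I_inv_def lam_def)
  have sI: "smooth_fun_on A U (I_inv \<kappa> \<mu>)"
    unfolding I_inv_def[abs_def] lam_def[symmetric]
    by (intro smooth_divide[OF openU _ smooth_lam' lam_pos] smooth_diff[OF openU smooth_const]
      smooth_divide[OF openU _ smooth_const] smooth_fun_on_subset[OF smooth_\<mu> subset_UNIV]) simp
  have "\<xi> q (\<lambda>r. lam r * I_inv \<kappa> \<mu> r) = \<xi> q (\<lambda>r. 1 + a r)"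
    by (rule tv_cong[OF \<xi>_in openU q I])
  also have "\<dots> = \<xi> q a"
    using tv_add_fun[OF \<xi>_in openU q smooth_const smooth_coeffs(4), of 1] tv_const[OF \<xi>_in] by simp
  finally show ?thesis
    using tv_mult_fun[OF \<xi>_in openU q smooth_lam' sI] I[OF q]
    by (simp add: \<xi>_I first_order(2)[OF q] mult.assoc)
qed

text \<open>[E2, xi] annihilates m, because E2(k m) = k E2(m) = 0 and E2(m) vanishes identically.
  But [E2, xi] = n E1 and E1(m) = 4 lam c, so n c = 0. Likewise [E1, xi] = - m E2 annihilates n, and
  E2(n) = - 4 lam b.\<close>

lemma vanishing:
  assumes q: "q \<in> U"
  shows "b q * (1 + lam q + a q) = 0" "c q * (1 - lam q + a q) = 0"
proof -
  define m where "m r = (1 + lam r) + a r" for r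
  define n where "n r = (1 - lam r) + a r" for r
  have sm: "smooth_fun_on A U m" "smooth_fun_on A U n"
    unfolding m_def n_def by (intro smooth_add smooth_diff openU smooth_const smooth_lam' smooth_coeffs)+
  have mn: "X r m = X r lam + X r a" "X r n = X r a - X r lam"
    if X: "vector_field_on A U X" and r: "r \<in> U" for X r
    using frame_derivs(3)[OF r X _ smooth_coeffs(4), of "\<lambda>r. 1 + lam r"] frame_derivs(3)[OF r X smooth_const smooth_lam', of 1]
      frame_derivs(3)[OF r X _ smooth_coeffs(4), of "\<lambda>r. 1 - lam r"] frame_derivs(4)[OF r X smooth_const smooth_lam', of 1]
      frame_derivs(1)[OF r X sm]
    by (simp_all add: m_def[abs_def] n_def[abs_def] smooth_add smooth_diff openU smooth_lam')
  \<comment> \<open>In E2(m) and E1(n) the derivatives of lam and a cancel; along xi, 1 + a and lam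
    both scale with k.\<close>
  have d: "E2 r m = 0" "\<xi> r m = k * m r" "E1 r n = 0" "\<xi> r n = k * n r" if r: "r \<in> U" for r
    by (simp_all add: mn[OF E1_vf r] mn[OF E2_vf r] mn[OF \<xi>_vf r] first_order[OF r] second_order[OF r] \<xi>_a[OF r]
        m_def n_def algebra_simps)
  have km: "X q (\<lambda>r. k * f r) = k * X q f" if X: "vector_field_on A U X" and f: "smooth_fun_on A U f" for X f
    using frame_derivs(5)[OF q X smooth_const f, of k] frame_derivs(1)[OF q X f f] by simp
  have "lie_bracket A E2 \<xi> q m = E2 q (\<lambda>r. k * m r) - \<xi> q (\<lambda>r. 0)"
    by (rule bracket_apply[OF q sm(1) d(1,2) E2_vf \<xi>_vf])
  then have "(1 - lam q + a q) * (4 * lam q * c q) = 0"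
    by (simp add: lie_table[OF q] cmb_apply coeffs[OF q] km[OF E2_vf sm(1)] tv_const[OF \<xi>_in] d[OF q] mn[OF E1_vf q]
        first_order[OF q] second_order[OF q])
  then show "c q * (1 - lam q + a q) = 0" using lam_pos[of q] by auto
  have "lie_bracket A E1 \<xi> q n = E1 q (\<lambda>r. k * n r) - \<xi> q (\<lambda>r. 0)"
    by (rule bracket_apply[OF q sm(2) d(3,4) E1_vf \<xi>_vf])
  then have "(1 + lam q + a q) * (4 * lam q * b q) = 0"
    by (simp add: lie_table[OF q] cmb_apply coeffs[OF q] km[OF E1_vf sm(2)] tv_const[OF \<xi>_in] d[OF q] mn[OF E2_vf q]
        first_order[OF q] second_order[OF q] algebra_simps)
  then show "b q * (1 + lam q + a q) = 0" using lam_pos[of q] by auto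
qed

end

section \<open>The canonical paracontact metric\<close>

locale paracontact_frame = invariant_eigen_frame A g D \<phi> \<xi> \<eta> \<kappa> \<mu> \<nu> U E1 k + P: levi_civita_mfd A g' D'
  for A :: "('m::{t2_space, second_countable_topology}, 3) chart set" and g D \<phi> \<xi> \<eta> \<kappa> \<mu> \<nu> U E1 k g' D' +
  assumes g': "g' p u v = (1 / lam p) * ext_deriv A \<eta> p u (h p v) + \<eta> p u * \<eta> p v"
begin

sublocale P: lc_frame3 A g' D' U E1 E2 \<xi> ..

text \<open>phi h interchanges \<open>E1\<close> and \<open>E2\<close> up to the factor lam, which 1
  / lam removes; so both vectors are null and their product is 1.\<close>

lemma g'_cmb:
  assumes q: "q \<in> U"
  shows "g' q (cmb x1 x2 x3 q) (cmb y1 y2 y3 q) = x1 * y2 + x2 * y1 + x3 * y3"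
proof -
  have T: "h q (cmb y1 y2 y3 q) \<in> tangent_space A q" by (rule h_in[OF cmb_tangent[OF q]])
  have "ext_deriv A \<eta> q (cmb x1 x2 x3 q) (h q (cmb y1 y2 y3 q)) = x1 * (lam q * y2) + x2 * (lam q * y1)"
    by (subst d\<eta>[OF cmb_tangent[OF q] T])
      (simp add: h_cmb[OF q] \<phi>_cmb[OF q] g_cmb[OF q] coeffs[OF q])
  then show ?thesis
    unfolding g' \<eta>_cmb[OF q] using lam_pos[of q] by (simp add: field_simps)
qed

lemma D'_skew:
  assumes q: "q \<in> U" and X: "vector_field_on A U X"
  shows "g' q (D' X (cmb x1 x2 x3) q) (cmb y1 y2 y3 q) + g' q (cmb x1 x2 x3 q) (D' X (cmb y1 y2 y3) q) = 0"
proof -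
  have v: "vector_field_on A U (cmb x1 x2 x3)" for x1 x2 x3
    by (rule cmb_vf[OF smooth_const smooth_const smooth_const])
  have "X q (\<lambda>r. g' r (cmb x1 x2 x3 r) (cmb y1 y2 y3 r)) = X q (\<lambda>r. x1 * y2 + x2 * y1 + x3 * y3)"
    by (rule tv_cong[OF vector_field_onD(1)[OF X q] openU q g'_cmb])
  then show ?thesis
    using P.metric_compatible[OF openU q X v v] tv_const[OF vector_field_onD(1)[OF X q]] by simp
qed

lemma frame_eq_cmb: "cmb 1 0 0 = E1" "cmb 0 1 0 = E2" "cmb 0 0 1 = \<xi>"
  by (rule ext, simp add: E1_cmb E2_cmb E3_cmb)+

text \<open>\<open>g'\<close> is constant on the frame, so each D'_X acts as a skew-adjoint matrix.
  In a null basis this means opposite diagonal entries on \<open>E1\<close> and \<open>E2\<close>,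
  no mixing of these two, and three free parameters.\<close>

lemma D'_form:
  assumes q: "q \<in> U" and X: "vector_field_on A U X"
  shows "\<exists>x y z. D' X E1 q = cmb x 0 (- z) q \<and> D' X E2 q = cmb 0 (- x) (- y) q \<and> D' X \<xi> q = cmb y z 0 q"
proof -
  have T: "D' X Y q \<in> tangent_space A q" if "vector_field_on A U Y" for Y
    by (rule vector_field_onD(1)[OF P.D_vector_field[OF openU X that] q])
  obtain a1 a2 a3 where e1: "D' X E1 q = cmb a1 a2 a3 q" using ex_cmb[OF q T[OF E1_vf]] by blast
  obtain b1 b2 b3 where e2: "D' X E2 q = cmb b1 b2 b3 q" using ex_cmb[OF q T[OF E2_vf]] by blast
  obtain c1 c2 c3 where e3: "D' X \<xi> q = cmb c1 c2 c3 q" using ex_cmb[OF q T[OF \<xi>_vf]] by blast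
  note S = D'_skew[OF q X]
  note S' = S[of 1 0 0 1 0 0] S[of 0 1 0 0 1 0] S[of 0 0 1 0 0 1] S[of 1 0 0 0 1 0] S[of 1 0 0 0 0 1] S[of 0 1 0 0 0 1]
  have "a2 = 0" "b1 = 0" "c3 = 0" "b2 = - a1" "a3 = - c2" "b3 = - c1"
    using S' by (simp_all add: frame_eq_cmb e1 e2 e3 g'_cmb[OF q]
      flip: E1_cmb E2_cmb E3_cmb) (simp_all add: E1_cmb E2_cmb E3_cmb g'_cmb[OF q])
  then show ?thesis using e1 e2 e3 by auto
qed

text \<open>Metric compatibility leaves three unknowns for each of the three directions; the nine
  components of the torsion equations for [E1, E2], [E1, xi] and [E2, xi] determine them.\<close>

lemma D'_table:
  assumes q: "q \<in> U"
  shows "D' E1 E1 q = cmb (- c q) 0 (1 + lam q + a q) q" "D' E1 E2 q = cmb 0 (c q) 1 q"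
    "D' E1 \<xi> q = cmb (- 1) (- (1 + lam q + a q)) 0 q"
    "D' E2 E1 q = cmb (b q) 0 (- 1) q" "D' E2 E2 q = cmb 0 (- b q) (- (1 - lam q + a q)) q"
    "D' E2 \<xi> q = cmb (1 - lam q + a q) 1 0 q"
    "D' \<xi> E1 q = cmb (- 1) 0 0 q" "D' \<xi> E2 q = cmb 0 1 0 q" "D' \<xi> \<xi> q = cmb 0 0 0 q"
proof -
  obtain x1 y1 z1 where 1: "D' E1 E1 q = cmb x1 0 (- z1) q" "D' E1 E2 q = cmb 0 (- x1) (- y1) q" "D' E1 \<xi> q = cmb y1 z1 0 q"
    using D'_form[OF q E1_vf] by blast
  obtain x2 y2 z2 where 2: "D' E2 E1 q = cmb x2 0 (- z2) q" "D' E2 E2 q = cmb 0 (- x2) (- y2) q" "D' E2 \<xi> q = cmb y2 z2 0 q"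
    using D'_form[OF q E2_vf] by blast
  obtain x3 y3 z3 where 3: "D' \<xi> E1 q = cmb x3 0 (- z3) q" "D' \<xi> E2 q = cmb 0 (- x3) (- y3) q" "D' \<xi> \<xi> q = cmb y3 z3 0 q"
    using D'_form[OF q \<xi>_vf] by blast
  have "cmb (- b q) (c q) 2 q = cmb (- x2) (- x1) (- y1 + z2) q"
    using P.torsion_free[OF openU q E1_vf E2_vf] unfolding lie_table[OF q] 1 2 cmb_diff by simp
  moreover have "cmb 0 (- 1 - lam q - a q) 0 q = cmb (y1 - x3) z1 z3 q"
    using P.torsion_free[OF openU q E1_vf \<xi>_vf] unfolding lie_table[OF q] 1 3 cmb_diff coeffs[OF q] by simp
  moreover have "cmb (1 - lam q + a q) 0 0 q = cmb y2 (z2 + x3) y3 q"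
    using P.torsion_free[OF openU q E2_vf \<xi>_vf] unfolding lie_table[OF q] 2 3 cmb_diff coeffs[OF q] by simp
  ultimately have v: "x2 = b q" "x1 = - c q" "z2 = 1" "y1 = - 1" "x3 = - 1" "z1 = - (1 + lam q + a q)" "z3 = 0"
    "y2 = 1 - lam q + a q" "y3 = 0"
    unfolding cmb_inject[OF q] by simp_all
  show "D' E1 E1 q = cmb (- c q) 0 (1 + lam q + a q) q" "D' E1 E2 q = cmb 0 (c q) 1 q"
    "D' E1 \<xi> q = cmb (- 1) (- (1 + lam q + a q)) 0 q"
    "D' E2 E1 q = cmb (b q) 0 (- 1) q" "D' E2 E2 q = cmb 0 (- b q) (- (1 - lam q + a q)) q"
    "D' E2 \<xi> q = cmb (1 - lam q + a q) 1 0 q"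
    "D' \<xi> E1 q = cmb (- 1) 0 0 q" "D' \<xi> E2 q = cmb 0 1 0 q" "D' \<xi> \<xi> q = cmb 0 0 0 q"
    unfolding 1 2 3 v by (simp_all add: cmb_inject[OF q])
qed

text \<open>Only the components that enter Ric(xi, E1) and Ric(xi, E2) are recorded. In the two
  middle formulas the 0 reflects that curvature is skew-adjoint for \<open>g'\<close>; in the outer
  two the entries are 2 m b and - 2 n c, with m = 1 + lam + a and n = 1 - lam + a.\<close>

lemma curv'_frame:
  assumes q: "q \<in> U"
  shows "\<exists>x y. P.curv E1 \<xi> E1 q = cmb 0 x y q" "\<exists>x y. P.curv E2 \<xi> E1 q = cmb x 0 y q"
    "\<exists>x y. P.curv E1 \<xi> E2 q = cmb 0 x y q" "\<exists>x y. P.curv E2 \<xi> E2 q = cmb x 0 y q"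
proof -
  have l: "D' (lie_bracket A E1 \<xi>) Z q = cmb 0 0 0 q +\<^sub>t (- (1 + lam q + a q)) *\<^sub>t D' E2 Z q"
    "D' (lie_bracket A E2 \<xi>) Z q = cmb 0 0 0 q +\<^sub>t (1 - lam q + a q) *\<^sub>t D' E1 Z q"
    if Z: "vector_field_on A U Z" for Z
    unfolding P.D_left_cmb[OF q lie_vector_field[OF openU E1_vf \<xi>_vf] Z lie_table(5)[OF q]]
      P.D_left_cmb[OF q lie_vector_field[OF openU E2_vf \<xi>_vf] Z lie_table(2)[OF q]] coeffs[OF q]
    by (rule ext, simp add: tv_add_def tv_scale_def cmb_apply algebra_simps)+
  note sm = smooth_coeffs smooth_minus[OF openU] smooth_add[OF openU] smooth_diff[OF openU] smooth_const smooth_lam'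
  note fd = tv_const[OF vector_field_onD(1)[OF E1_vf q]]
    tv_const[OF vector_field_onD(1)[OF E2_vf q]] tv_const[OF vector_field_onD(1)[OF \<xi>_vf q]]
    frame_derivs(2)[OF q \<xi>_vf smooth_coeffs(5) smooth_const] frame_derivs(2)[OF q \<xi>_vf smooth_coeffs(6) smooth_const]
  note T = D'_table[OF q] cmb_add cmb_diff cmb_scale l[OF E1_vf] l[OF E2_vf]
  have A1: "D' X (D' \<xi> E1) q = (-1) *\<^sub>t D' X E1 q" if X: "vector_field_on A U X" for X
    by (subst P.D_right_cmb[OF q X _ _ _ D'_table(7)]) (simp_all add: tv_const[OF vector_field_onD(1)[OF X q]] cmb_zero tv_add_def tv_scale_def tv_zero_def)
  have A2: "D' X (D' \<xi> E2) q = D' X E2 q" if X: "vector_field_on A U X" for X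
    by (subst P.D_right_cmb[OF q X _ _ _ D'_table(8)]) (simp_all add: tv_const[OF vector_field_onD(1)[OF X q]] cmb_zero tv_add_def tv_scale_def tv_zero_def)
  have B1: "D' \<xi> (D' E1 E1) q = cmb (- \<xi> q c + c q) 0 (\<xi> q (\<lambda>r. 1 + lam r + a r)) q"
    by (subst P.D_right_cmb[OF q \<xi>_vf _ _ _ D'_table(1)]) (simp_all add: sm T fd cmb_inject[OF q])
  have B2: "D' \<xi> (D' E2 E1) q = cmb (\<xi> q b - b q) 0 0 q"
    by (subst P.D_right_cmb[OF q \<xi>_vf _ _ _ D'_table(4)]) (simp_all add: sm T fd cmb_inject[OF q])
  have B3: "D' \<xi> (D' E1 E2) q = cmb 0 (\<xi> q c + c q) 0 q"
    by (subst P.D_right_cmb[OF q \<xi>_vf _ _ _ D'_table(2)]) (simp_all add: sm T fd cmb_inject[OF q])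
  have B4: "D' \<xi> (D' E2 E2) q = cmb 0 (- \<xi> q b - b q) (\<xi> q (\<lambda>r. - (1 - lam r + a r))) q"
    by (subst P.D_right_cmb[OF q \<xi>_vf _ _ _ D'_table(5)]) (simp_all add: sm T fd cmb_inject[OF q])
  note W = A1[OF E1_vf] A1[OF E2_vf] A2[OF E1_vf] A2[OF E2_vf] B1 B2 B3 B4
  \<comment> \<open>The signs are opposite to those in \<open>second_order\<close>, which is
    consistent because both sides are 0. In this form the entries xi(c) + m b and xi(b) - n c cancel
    directly.\<close>
  have V: "\<xi> q c = (- 1 - lam q - a q) * b q" "\<xi> q b = (1 - lam q + a q) * c q"
    using second_order(1,2)[OF q] vanishing[OF q] by (simp_all add: algebra_simps)
  show "\<exists>x y. P.curv E1 \<xi> E1 q = cmb 0 x y q"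
    unfolding P.curv_def by (simp add: W T V(1) cmb_inject[OF q])
  show "\<exists>x y. P.curv E2 \<xi> E1 q = cmb x 0 y q"
    unfolding P.curv_def by (simp add: W T cmb_inject[OF q])
  show "\<exists>x y. P.curv E1 \<xi> E2 q = cmb 0 x y q"
    unfolding P.curv_def by (simp add: W T cmb_inject[OF q])
  show "\<exists>x y. P.curv E2 \<xi> E2 q = cmb x 0 y q"
    unfolding P.curv_def by (simp add: W T V(2) cmb_inject[OF q])
qed

text \<open>The frame is null for \<open>g'\<close>: the dual of \<open>E1\<close> is \<open>g'(\<cdot>, E2)\<close> and vice versa.\<close>

lemma ricci_eq:
  assumes q: "q \<in> U" and w: "w \<in> tangent_space A q"
  shows "ricci A D' q (\<xi> q) w = g' q (curvature A D' q (E1 q) (\<xi> q) w) (E2 q) +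
    g' q (curvature A D' q (E2 q) (\<xi> q) w) (E1 q) + g' q (curvature A D' q (\<xi> q) (\<xi> q) w) (\<xi> q)"
proof -
  define E :: "3 \<Rightarrow> 'm tvec" where "E i = (if i = 1 then E1 q else if i = 2 then E2 q else \<xi> q)" for i
  define F :: "3 \<Rightarrow> 'm tvec" where "F i = (if i = 1 then E2 q else if i = 2 then E1 q else \<xi> q)" for i
  have E: "E i \<in> tangent_space A q" for i by (simp add: E_def E1_in[OF q] E2_in[OF q] \<xi>_in)
  have 3: "(3::3) \<noteq> 1" "(3::3) \<noteq> 2" "(2::3) \<noteq> 1" by simp_all
  have lin: "linear_at A q (\<lambda>u. g' q u (F i))" for i
    unfolding linear_at_def
  proof (intro ballI allI)
    fix u v x y assume "u \<in> tangent_space A q" "v \<in> tangent_space A q"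
    then obtain u1 u2 u3 v1 v2 v3 where uv: "u = cmb u1 u2 u3 q" "v = cmb v1 v2 v3 q" using ex_cmb[OF q] by metis
    show "g' q (x *\<^sub>t u +\<^sub>t y *\<^sub>t v) (F i) = x * g' q u (F i) + y * g' q v (F i)"
      by (simp add: uv F_def cmb_scale cmb_add E1_cmb E2_cmb E3_cmb g'_cmb[OF q] algebra_simps)
  qed
  have "tangent_trace A q (\<lambda>u. curvature A D' q u (\<xi> q) w) =
      (\<Sum>i\<in>UNIV. g' q (curvature A D' q (E i) (\<xi> q) w) (F i))"
  proof (rule tangent_trace_frame[OF E lin])
    fix u assume u: "u \<in> tangent_space A q"
    then obtain u1 u2 u3 where uc: "u = cmb u1 u2 u3 q" using ex_cmb[OF q] by metis
    show "u = (\<lambda>f. \<Sum>i\<in>UNIV. g' q u (F i) * E i f)"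
      unfolding sum_3 F_def E_def using 3
      by (simp add: uc) (simp add: E1_cmb E2_cmb E3_cmb g'_cmb[OF q], rule ext, simp add: cmb_apply)
    show "curvature A D' q u (\<xi> q) w \<in> tangent_space A q" by (rule P.curvature_in(1)[OF u \<xi>_in w])
  next
    show "linear_at A q (\<lambda>u. curvature A D' q u (\<xi> q) w f)" for f by (rule P.curvature_in(2)[OF \<xi>_in \<xi>_in w])
  qed
  then show ?thesis unfolding ricci_def sum_3 E_def F_def using 3 by simp
qed

text \<open>Against \<open>E1\<close> and \<open>E2\<close>, the pairings in \<open>ricci_eq\<close>
  select exactly the components that vanish by \<open>curv'_frame\<close>, and R(xi, xi) is 0 by
  antisymmetry. Linearity does the rest.\<close>

lemma ricci_\<xi>:
  assumes q: "q \<in> U"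
  shows "ricci A D' q (\<xi> q) (cmb x1 x2 x3 q) = x3 * ricci A D' q (\<xi> q) (\<xi> q)"
proof -
  have z0: "P.curv \<xi> \<xi> Z q = cmb 0 0 0 q" if Z: "vector_field_on A U Z" for Z
    using P.curv_antisym[OF openU q \<xi>_vf \<xi>_vf Z] by (intro ext) (simp add: cmb_apply)
  note C = P.curvature_eq_curv[OF openU q]
  have 1: "ricci A D' q (\<xi> q) (E1 q) = 0"
    using curv'_frame(1,2)[OF q]
    by (auto simp: ricci_eq[OF q E1_in[OF q]] C E1_vf E2_vf \<xi>_vf z0) (simp add: E1_cmb E2_cmb E3_cmb g'_cmb[OF q])
  have 2: "ricci A D' q (\<xi> q) (E2 q) = 0"
    using curv'_frame(3,4)[OF q]
    by (auto simp: ricci_eq[OF q E2_in[OF q]] C E1_vf E2_vf \<xi>_vf z0) (simp add: E1_cmb E2_cmb E3_cmb g'_cmb[OF q])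
  have "linear_at A q (ricci A D' q (\<xi> q))"
    unfolding linear_at_def
  proof (intro ballI allI)
    fix u v x y assume u: "u \<in> tangent_space A q" and v: "v \<in> tangent_space A q"
    have c: "curvature A D' q e (\<xi> q) (x *\<^sub>t u +\<^sub>t y *\<^sub>t v) =
        x *\<^sub>t curvature A D' q e (\<xi> q) u +\<^sub>t y *\<^sub>t curvature A D' q e (\<xi> q) v"
      if e: "e \<in> tangent_space A q" for e
      by (rule ext) (simp only: linear_atD[OF P.curvature_in(3)[OF e \<xi>_in u] u v], simp add: tv_add_def tv_scale_def)
    have gl: "g' q (x *\<^sub>t w1 +\<^sub>t y *\<^sub>t w2) w3 = x * g' q w1 w3 + y * g' q w2 w3"
      if w: "w1 \<in> tangent_space A q" "w2 \<in> tangent_space A q" "w3 \<in> tangent_space A q" for w1 w2 w3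
    proof -
      obtain a1 a2 a3 b1 b2 b3 c1 c2 c3 where
        "w1 = cmb a1 a2 a3 q" "w2 = cmb b1 b2 b3 q" "w3 = cmb c1 c2 c3 q" using ex_cmb[OF q] w by metis
      then show ?thesis by (simp add: cmb_scale cmb_add g'_cmb[OF q] algebra_simps)
    qed
    note in' = P.curvature_in(1) E1_in[OF q] E2_in[OF q] \<xi>_in u v
    show "ricci A D' q (\<xi> q) (x *\<^sub>t u +\<^sub>t y *\<^sub>t v) = x * ricci A D' q (\<xi> q) u + y * ricci A D' q (\<xi> q) v"
      unfolding ricci_eq[OF q tangent_lin[OF u v]] ricci_eq[OF q u] ricci_eq[OF q v]
        c[OF E1_in[OF q]] c[OF E2_in[OF q]] c[OF \<xi>_in]
      by (simp add: gl in' algebra_simps)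
  qed
  from linear_at_cmb[OF this q] show ?thesis by (simp add: 1 2)
qed

text \<open>The eigenvalue is Ric(xi, xi). Uniqueness in the definite description comes from the
  nondegeneracy of \<open>g'\<close>.\<close>

lemma ricci_operator_\<xi>:
  assumes q: "q \<in> U"
  shows "ricci_operator A g' D' q (\<xi> q) = ricci A D' q (\<xi> q) (\<xi> q) *\<^sub>t \<xi> q"
  unfolding ricci_operator_def
proof (rule the_equality)
  let ?r = "ricci A D' q (\<xi> q) (\<xi> q)"
  have e: "?r *\<^sub>t \<xi> q = cmb 0 0 ?r q" by (rule ext) (simp add: cmb_apply tv_scale_def)
  show "?r *\<^sub>t \<xi> q \<in> tangent_space A q \<and> (\<forall>w\<in>tangent_space A q. g' q (?r *\<^sub>t \<xi> q) w = ricci A D' q (\<xi> q) w)"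
  proof (intro conjI ballI)
    show "?r *\<^sub>t \<xi> q \<in> tangent_space A q" by (rule tangent_scale[OF \<xi>_in])
    fix w assume "w \<in> tangent_space A q"
    then obtain w1 w2 w3 where w: "w = cmb w1 w2 w3 q" using ex_cmb[OF q] by metis
    show "g' q (?r *\<^sub>t \<xi> q) w = ricci A D' q (\<xi> q) w"
      unfolding w e g'_cmb[OF q] ricci_\<xi>[OF q] by simp
  qed
  fix v assume v: "v \<in> tangent_space A q \<and> (\<forall>w\<in>tangent_space A q. g' q v w = ricci A D' q (\<xi> q) w)"
  then obtain v1 v2 v3 where vc: "v = cmb v1 v2 v3 q" using ex_cmb[OF q] by metis
  have *: "g' q v (cmb w1 w2 w3 q) = w3 * ?r" for w1 w2 w3
    using v cmb_tangent[OF q] ricci_\<xi>[OF q] by simp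
  \<comment> \<open>The null pairing exchanges indices: testing against \<open>E1\<close> reads off
    \<open>v2\<close>, testing against \<open>E2\<close> reads off \<open>v1\<close>.\<close>
  have "v2 = 0" "v1 = 0" "v3 = ?r"
    using *[of 1 0 0] *[of 0 1 0] *[of 0 0 1] unfolding vc g'_cmb[OF q] by simp_all
  then show "v = ?r *\<^sub>t \<xi> q" unfolding vc e by simp
qed

end

theorem theorem5p10:
  fixes A :: "('m::{t2_space, second_countable_topology}, 3) chart set"
    and \<phi> \<phi>' :: "'m endo" and \<xi> :: "'m vfield" and \<eta> :: "'m form1" and g g' :: "'m form2"
    and D D' :: "'m vfield \<Rightarrow> 'm vfield \<Rightarrow> 'm vfield"
    and \<kappa> \<mu> \<nu> :: "'m \<Rightarrow> real"
  assumes "smooth_manifold A"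
    and "kmn_contact_metric A \<phi> \<xi> \<eta> g D \<kappa> \<mu> \<nu>"
    and "\<forall>p. \<kappa> p < 1"
    and "\<exists>c. \<forall>p. \<nu> p = c"
    and "\<forall>p. \<xi> p (I_inv \<kappa> \<mu>) = 0"
    and "(\<phi>', \<xi>, \<eta>, g') = canonical_paracontact A \<kappa> \<phi> \<xi> \<eta>"
    and "levi_civita A g' D'"
  shows "\<forall>p. tangent_eigenvector A p (ricci_operator A g' D' p) (\<xi> p)"
proof
  fix p
  have lc: "levi_civita A g D"
    using assms(2) unfolding kmn_contact_metric_def by (elim conjE)
  interpret contact3 A g D \<phi> \<xi> \<eta> \<kappa> \<mu> \<nu>
    by unfold_locales (use assms lc in simp_all)
  obtain k where k: "\<And>p. \<nu> p = k" using assms(4) by blast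
  \<comment> \<open>The claim is pointwise, so an eigenframe on a neighbourhood of p is
    enough.\<close>
  obtain U E1 where p: "p \<in> U" and "eigen_frame A g D \<phi> \<xi> \<eta> \<kappa> \<mu> \<nu> U E1"
    using ex_eigen_frame[of p] by blast
  then interpret eigen_frame A g D \<phi> \<xi> \<eta> \<kappa> \<mu> \<nu> U E1 by blast
  have g': "g' q u v = (1 / lam q) * ext_deriv A \<eta> q u (h q v) + \<eta> q u * \<eta> q v" for q u v
    using assms(6) by (simp add: canonical_paracontact_def Let_def lam_def)
  interpret paracontact_frame A g D \<phi> \<xi> \<eta> \<kappa> \<mu> \<nu> U E1 k g' D'
    by unfold_locales (use k assms(5,7) g' in simp_all)
  show "tangent_eigenvector A p (ricci_operator A g' D' p) (\<xi> p)"
    unfolding tangent_eigenvector_def using ricci_operator_\<xi>[OF p] \<xi>_in \<xi>_nonzero by blast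
qed

end
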